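(* The series $Q(3,0,t,1,1;0,y)$, which counts properly $3$-colored near-triangulations by edges ($t$) and outer degree ($y$), is algebraic of degree $6$ over $\mathbb{Q}(t,y)$. Let $Q_i(t)=[y^i]Q(3,0,t,1,1;0,y)$. Then $Q_1(t)=0$, and for $i\ge2$, $Q_i(t)$ is of degree at most $2$ over $\mathbb{Q}(t)$ and admits a rational parametrization: letting $S\equiv S(t)$ be the unique power series in $t$ satisfying $S=t^3(1+2S)^2$ (so $S$ has constant term $0$), $t^iQ_i(t)$ is a rational function of $S$, and in particular $$Q_2(t)=2t(1+S-S^2),\qquad Q_3(t)=2S(1-S).$$
   Context: Planar maps are connected planar graphs properly embedded in the oriented sphere up to orientation-preserving homeomorphism (loops and multiple edges allowed), rooted by a distinguished corner whose vertex/face are the root-vertex/root-face (other faces are internal); degrees count edges with multiplicity; the atomic map is included; $e,v,f$ count edges, vertices, faces; $d_f$ is the root-face degree. The Potts polynomial is $P_G(q,\nu)=\sum_{c:V(G)\to\{1,\dots,q\}}\nu^{m(c)}$, $m(c)$ = number of monochromatic edges (loops always monochromatic); $P_G(q,0)$ is the chromatic polynomial. A quasi-triangulation is a rooted planar map whose internal faces are digons incident to the root-vertex or triangles; $\mathrm{dig}(Q)$, $\mathrm{ddig}(Q)$ count internal digons and internal digons doubly incident to the root-vertex. $Q(q,\nu,t,w,z;x,y)=\frac1q\sum_Q t^{e(Q)}w^{v(Q)-1}z^{f(Q)-1}x^{\mathrm{dig}(Q)}y^{d_f(Q)}2^{\mathrm{ddig}(Q)}P_Q(q,\nu)$. A near-triangulation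 is a rooted planar map all of whose internal faces have degree 3; $Q(q,\nu,t,1,1;0,y)$ is the generating function of near-triangulations weighted by $P/q$. *)

theory Defs
  imports "HOL-Computational_Algebra.Computational_Algebra"
          "HOL-Combinatorics.Permutations"
          "HOL-Library.FuncSet"
begin

section \<open>Rooted planar maps as rotation systems\<close>

text \<open>A rooted planar map with n \<ge> 1 edges is encoded on the dart set {0..<2n} by a
  fixed-point-free involution a (edges) and a permutation s (rotation around vertices);
  the faces are the cycles of s o a.  The root corner corresponds to dart 0: the root vertex
  is the s-orbit of 0 and the root face is the (s o a)-orbit of 0.  Connectivity is
  transitivity of the generated group, and planarity is Euler's formula v - e + f = 2.
  Each isomorphism class of rooted maps with n edges has exactly (2n-1)! labellings with
  root dart 0 (rooted maps have no nontrivial automorphisms).\<close>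

definition orb :: "(nat \<Rightarrow> nat) \<Rightarrow> nat \<Rightarrow> nat set" where
  "orb f x = {(f ^^ k) x | k. True}"

definition cycs :: "(nat \<Rightarrow> nat) \<Rightarrow> nat set \<Rightarrow> nat set set" where
  "cycs f D = (\<lambda>d. orb f d) ` D"

definition darts :: "nat \<Rightarrow> nat set" where
  "darts n = {0..<2*n}"

definition planar_map :: "nat \<Rightarrow> (nat \<Rightarrow> nat) \<Rightarrow> (nat \<Rightarrow> nat) \<Rightarrow> bool" where
  "planar_map n a s \<longleftrightarrow>
     a permutes darts n \<and> s permutes darts n \<and>
     (\<forall>d\<in>darts n. a d \<noteq> d \<and> a (a d) = d) \<and>
     (\<forall>d\<in>darts n. (0, d) \<in> ({(x, a x) | x. x \<in> darts n} \<union> {(x, s x) | x. x \<in> darts n})\<^sup>*) \<and>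
     card (cycs s (darts n)) + card (cycs (s \<circ> a) (darts n)) = n + 2"

text \<open>Near-triangulation: every internal face (face other than the root face) has degree 3;
  the degree of a face is the number of darts in it (edges counted with multiplicity).\<close>
definition near_tri :: "nat \<Rightarrow> (nat \<Rightarrow> nat) \<Rightarrow> (nat \<Rightarrow> nat) \<Rightarrow> bool" where
  "near_tri n a s \<longleftrightarrow> planar_map n a s \<and>
     (\<forall>d\<in>darts n. orb (s \<circ> a) d \<noteq> orb (s \<circ> a) 0 \<longrightarrow> card (orb (s \<circ> a) d) = 3)"

text \<open>Root-face degree.\<close>
definition root_face_deg :: "(nat \<Rightarrow> nat) \<Rightarrow> (nat \<Rightarrow> nat) \<Rightarrow> nat" where
  "root_face_deg a s = card (orb (s \<circ> a) 0)"

text \<open>Potts polynomial P(q,nu): sum over colourings of the vertices (= functions on darts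
  constant on s-orbits) of nu to the number of monochromatic edges.\<close>
definition potts :: "nat \<Rightarrow> rat \<Rightarrow> nat \<Rightarrow> (nat \<Rightarrow> nat) \<Rightarrow> (nat \<Rightarrow> nat) \<Rightarrow> rat" where
  "potts q \<nu> n a s =
     (\<Sum>c\<in>{c \<in> darts n \<rightarrow>\<^sub>E {0..<q}. \<forall>d\<in>darts n. c (s d) = c d}.
        \<nu> ^ card {e \<in> cycs a (darts n). \<forall>d\<in>e. \<forall>d'\<in>e. c d = c d'})"

text \<open>[t^n y^i] Q(q,nu,t,1,1;0,y): near-triangulations with n edges and root-face degree i,
  weighted by P/q.  For n = 0 the only map is the atomic map (one vertex, no edge,
  root-face degree 0), whose Potts polynomial is q.\<close>
definition nt_coeff :: "nat \<Rightarrow> rat \<Rightarrow> nat \<Rightarrow> nat \<Rightarrow> rat" where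
  "nt_coeff q \<nu> n i =
     (if n = 0 then (if i = 0 then of_nat q / of_nat q else 0)
      else (\<Sum>(a, s)\<in>{(a, s). near_tri n a s \<and> root_face_deg a s = i}. potts q \<nu> n a s)
           / (of_nat q * fact (2 * n - 1)))"

text \<open>The bivariate series, as a power series in y whose coefficients are power series in t.\<close>
definition ntgf :: "nat \<Rightarrow> rat \<Rightarrow> rat fps fps" where
  "ntgf q \<nu> = Abs_fps (\<lambda>i. Abs_fps (\<lambda>n. nt_coeff q \<nu> n i))"

section \<open>Algebraicity\<close>

text \<open>Polynomials in t,y over Q as nested univariate polynomials (outer variable y),
  embedded into Q[[t]][[y]].\<close>
definition biv_of :: "rat poly poly \<Rightarrow> rat fps fps" where
  "biv_of p = fps_of_poly (map_poly fps_of_poly p)"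

definition annihilates_biv :: "rat poly poly poly \<Rightarrow> rat fps fps \<Rightarrow> bool" where
  "annihilates_biv P F \<longleftrightarrow> P \<noteq> 0 \<and> poly (map_poly biv_of P) F = 0"

text \<open>F is algebraic of degree d over Q(t,y): the minimal annihilating polynomial (after
  clearing denominators, coefficients in Q[t,y]) has degree d.\<close>
definition alg_degree_biv :: "rat fps fps \<Rightarrow> nat \<Rightarrow> bool" where
  "alg_degree_biv F d \<longleftrightarrow>
     (\<exists>P. annihilates_biv P F \<and> degree P = d) \<and>
     (\<forall>P. annihilates_biv P F \<longrightarrow> d \<le> degree P)"

text \<open>f is of degree at most d over Q(t).\<close>
definition alg_deg_le :: "rat fps \<Rightarrow> nat \<Rightarrow> bool" where
  "alg_deg_le f d \<longleftrightarrow>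
     (\<exists>P :: rat poly poly. P \<noteq> 0 \<and> degree P \<le> d \<and> poly (map_poly fps_of_poly P) f = 0)"

text \<open>g is a rational function (over Q) of S.\<close>
definition rat_fun_of :: "rat fps \<Rightarrow> rat fps \<Rightarrow> bool" where
  "rat_fun_of g S \<longleftrightarrow>
     (\<exists>A B :: rat poly. B \<noteq> 0 \<and>
        g * poly (map_poly fps_const B) S = poly (map_poly fps_const A) S)"

end

theory Submission
  imports Defs "HOL-Combinatorics.Cycles" "HOL-Computational_Algebra.Field_as_Ring"
begin

text \<open>Deleting the root edge of a properly 3-coloured near-triangulation either opens the triangle
  next to it or cuts the map in two.  What matters is the boundary word recording whether the
  colour increases or decreases (mod 3) along each outer edge, and the word series satisfy a
  recursion in two letters A, B.  In the letters X = A + B and Y = A - B the recursion is that of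
  an O(1) loop model: the series of X^k and of Y X^j Y X^k form a closed system, whose kernel
  2 + 1/a + 1/b vanishes along the involution 1/b = -2 - 1/a.  A cubic expression in the outer
  series is invariant under it, hence (being polynomial in a at each order in t) vanishes.
  This cubic equation involves the unknown degree-2 coefficient q; it determines q and the series
  uniquely, and a rational curve parametrized by S provides a solution.  Recursion then puts every
  coefficient into Q(S).  Since q is quadratic over Q(t), the norm of the cubic is a sextic over
  Q(t,y); Newton polygons along two curves show that every factor has degree divisible by 2 and
  by 3.\<close>

section \<open>Cycles of permutations\<close>

text \<open>Around a properly 3-coloured triangle the three colour changes are +1 or -1 with sum 0
  mod 3, so they are equal. Opening a triangle therefore replaces a boundary letter by two opposite
  ones, A by BB and B by AA. For X and Y this reads 2 X -> XX + YY and 2 Y -> -(XY + YX), and a cut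
  pairs X only with X and Y only with Y. So the Y's behave like the ends of loop strands, and words
  with at most two of them suffice. The combinatorial obstacle is the bridge case, where both pieces
  have to be planar again. Euler's formula of the whole map fixes only the sum of their two defects;
  the genus inequality makes each defect nonnegative, hence both vanish. Isomorphism classes are
  never formed. All structures on a fixed dart set are counted, so splitting at a bridge includes
  the choice of a subset of the darts, and the factorials cancel against binomial
  coefficients.\<close>

lemma orb_self: "x \<in> orb f x"
  unfolding orb_def by (auto intro: exI[of _ "0::nat"])

lemma orb_step: "y \<in> orb f x \<Longrightarrow> f y \<in> orb f x"
  unfolding orb_def by (auto intro: exI[of _ "Suc _"])

lemma orb_minimal:
  assumes "x \<in> A" "f ` A \<subseteq> A"
  shows "orb f x \<subseteq> A"
proof -
  have "(f ^^ k) x \<in> A" for k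
    using assms by (induction k) auto
  then show ?thesis unfolding orb_def by auto
qed

text \<open>An injective map of a finite set into itself is onto, so forward invariance implies
  backward invariance. Hence connectivity can be tested with images alone, and complements of
  invariant sets are invariant.\<close>

lemma inv_set_iff:
  assumes "finite D" "bij_betw f D D" "A \<subseteq> D" "f ` A \<subseteq> A" "x \<in> D"
  shows "f x \<in> A \<longleftrightarrow> x \<in> A"
proof -
  have i: "inj_on f D" using assms(2) by (rule bij_betw_imp_inj_on)
  have "f ` A = A"
    using assms i by (meson endo_inj_surj finite_subset inj_on_subset)
  then show ?thesis using i assms(3,5) by (auto simp: inj_on_def)
qed

lemma inv_set_bij:
  assumes "finite D" "bij_betw f D D" "A \<subseteq> D" "f ` A \<subseteq> A"
  shows "bij_betw f A A"
proof -
  have i: "inj_on f A" using assms(2,3) by (meson bij_betw_imp_inj_on inj_on_subset)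
  then show ?thesis
    using assms by (metis bij_betw_def endo_inj_surj finite_subset)
qed

lemma inv_set_compl:
  assumes "finite D" "bij_betw f D D" "A \<subseteq> D" "f ` A \<subseteq> A"
  shows "f ` (D - A) \<subseteq> D - A"
  using inv_set_iff[OF assms] assms(2) by (auto simp: bij_betw_def)

lemma orb_subset:
  assumes "bij_betw f D D" "x \<in> D"
  shows "orb f x \<subseteq> D"
  using assms by (intro orb_minimal) (auto simp: bij_betw_def)

lemma orb_invariant: "f ` orb f x \<subseteq> orb f x"
  by (auto intro: orb_step)

lemma orb_eq:
  assumes "finite D" "bij_betw f D D" "x \<in> D" "y \<in> orb f x"
  shows "orb f y = orb f x"
proof
  have yD: "y \<in> D" using assms orb_subset by blast
  show "orb f y \<subseteq> orb f x" by (rule orb_minimal[OF assms(4) orb_invariant])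
  have sub: "orb f y \<subseteq> D" using orb_subset[OF assms(2) yD] .
  obtain k where k: "y = (f ^^ k) x" using assms(4) unfolding orb_def by auto
  have "(f ^^ j) x \<in> D" for j
    using assms(2,3) by (induction j) (auto simp: bij_betw_def)
  then have "(f ^^ j) x \<in> orb f y \<Longrightarrow> x \<in> orb f y" for j
  proof (induction j)
    case (Suc j)
    then show ?case
      using inv_set_iff[OF assms(1,2) sub orb_invariant, of "(f ^^ j) x"] by auto
  qed simp
  then have "x \<in> orb f y" using k orb_self[of y f] by blast
  then show "orb f x \<subseteq> orb f y" by (rule orb_minimal[OF _ orb_invariant])
qed

lemma orb_cong:
  assumes "x \<in> A" "f ` A \<subseteq> A" "\<And>y. y \<in> A \<Longrightarrow> g y = f y"
  shows "orb g x = orb f x"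
proof
  have g: "g ` A \<subseteq> A" using assms by auto
  have fA: "orb f x \<subseteq> A" "orb g x \<subseteq> A" using orb_minimal assms(1,2) g by metis+
  show "orb g x \<subseteq> orb f x"
    using fA assms(3) by (intro orb_minimal) (auto simp: orb_self intro!: orb_step)
  show "orb f x \<subseteq> orb g x"
  proof (intro orb_minimal)
    show "f ` orb g x \<subseteq> orb g x"
    proof
      fix z assume "z \<in> f ` orb g x"
      then obtain y where "y \<in> orb g x" "z = f y" by auto
      then show "z \<in> orb g x" using fA(2) assms(3)[of y] orb_step[of y g x] by auto
    qed
  qed (rule orb_self)
qed

definition ncyc :: "(nat \<Rightarrow> nat) \<Rightarrow> nat set \<Rightarrow> nat" where
  "ncyc f D = card (cycs f D)"

lemma ncyc_cong:
  assumes "f ` D \<subseteq> D" "\<And>y. y \<in> D \<Longrightarrow> g y = f y"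
  shows "ncyc g D = ncyc f D"
  unfolding ncyc_def cycs_def using orb_cong[OF _ assms] by (metis (mono_tags, lifting) image_cong)

lemma ncyc_Un:
  assumes "finite A" "finite B" "A \<inter> B = {}" "f ` A \<subseteq> A" "f ` B \<subseteq> B"
  shows "ncyc f (A \<union> B) = ncyc f A + ncyc f B"
proof -
  have "cycs f A \<inter> cycs f B = {}"
  proof (rule ccontr)
    assume "cycs f A \<inter> cycs f B \<noteq> {}"
    then obtain x y where "x \<in> A" "y \<in> B" "orb f x = orb f y" unfolding cycs_def by auto
    then have "x \<in> B" using orb_minimal[of y B f] assms orb_self[of x f] by auto
    then show False using \<open>x \<in> A\<close> assms(3) by auto
  qed
  then show ?thesis
    unfolding ncyc_def cycs_def using assms(1,2) by (simp add: image_Un card_Un_disjoint)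
qed

text \<open>The first-return map of f outside r, with r made a fixed point. It describes what is
  left of a face or vertex cycle when a dart is removed.\<close>

definition excise :: "(nat \<Rightarrow> nat) \<Rightarrow> nat \<Rightarrow> nat \<Rightarrow> nat" where
  "excise f r x = (if x = r then r else if f x = r then f r else f x)"

lemma excise_bij:
  assumes "finite D" "bij_betw f D D" "r \<in> D"
  shows "bij_betw (excise f r) (D - {r}) (D - {r})"
proof -
  have inj: "inj_on f D" and im: "f ` D = D" using assms(2) by (auto simp: bij_betw_def)
  have "inj_on (excise f r) (D - {r})"
    using inj assms(3) unfolding inj_on_def excise_def by (auto split: if_splits)
  moreover have "excise f r ` (D - {r}) \<subseteq> D - {r}"
    using inj im assms(3) unfolding excise_def inj_on_def by auto
  ultimately show ?thesis
    using assms(1) by (simp add: bij_betw_def endo_inj_surj)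
qed

lemma orb_excise:
  assumes "finite D" "bij_betw f D D" "r \<in> D" "x \<in> D - {r}"
  shows "orb (excise f r) x = orb f x - {r}"
proof
  have inj: "inj_on f D" and im: "f ` D = D" using assms(2) by (auto simp: bij_betw_def)
  have sub: "orb f x \<subseteq> D" using assms orb_subset by blast
  show "orb (excise f r) x \<subseteq> orb f x - {r}"
  proof (rule orb_minimal)
    show "x \<in> orb f x - {r}" using assms(4) orb_self by auto
    show "excise f r ` (orb f x - {r}) \<subseteq> orb f x - {r}"
    proof
      fix z assume "z \<in> excise f r ` (orb f x - {r})"
      then obtain y where y: "y \<in> orb f x" "y \<noteq> r" "z = excise f r y" by auto
      have "f y \<in> orb f x" using y orb_step by auto
      moreover have "f y = r \<Longrightarrow> f r \<in> orb f x \<and> f r \<noteq> r"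
        using inj sub y assms(3) \<open>f y \<in> orb f x\<close> orb_step[of "f y" f x] by (auto simp: inj_on_def)
      ultimately show "z \<in> orb f x - {r}"
        using y unfolding excise_def by auto
    qed
  qed
  let ?O = "orb (excise f r) x"
  \<comment> \<open>The point r is put back only when its predecessor lies in the shortened orbit;
    this makes the set closed under f.\<close>
  let ?T = "?O \<union> {z. z = r \<and> (\<exists>y\<in>?O. f y = r)}"
  have rO: "r \<notin> ?O" using \<open>?O \<subseteq> orb f x - {r}\<close> by auto
  have "orb f x \<subseteq> ?T"
  proof (rule orb_minimal)
    show "x \<in> ?T" using orb_self by auto
    show "f ` ?T \<subseteq> ?T"
    proof
      fix z assume "z \<in> f ` ?T"
      then obtain y where y: "y \<in> ?T" "z = f y" by auto
      show "z \<in> ?T"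
      proof (cases "y \<in> ?O")
        case True
        then have "excise f r y \<in> ?O" by (rule orb_step)
        then show ?thesis using True y rO unfolding excise_def by (auto split: if_splits)
      next
        case False
        then obtain y' where y': "y = r" "y' \<in> ?O" "f y' = r" using y by auto
        then have "excise f r y' \<in> ?O" by (auto intro: orb_step)
        moreover have "y' \<noteq> r" using y' rO by auto
        ultimately have "f r \<in> ?O" using y' unfolding excise_def by auto
        then show ?thesis using y y' by auto
      qed
    qed
  qed
  then show "orb f x - {r} \<subseteq> ?O" by auto
qed

text \<open>A cycle is lost by excision only if it is {r}, which \<open>f r \<noteq> r\<close>
  excludes.\<close>

lemma ncyc_excise:
  assumes "finite D" "bij_betw f D D" "r \<in> D" "f r \<noteq> r"
  shows "ncyc (excise f r) (D - {r}) = ncyc f D"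
proof -
  have im: "f ` D = D" using assms(2) by (auto simp: bij_betw_def)
  have fr: "f r \<in> D - {r}" using im assms(3,4) by auto
  have "orb f r = orb f (f r)"
    using orb_eq[OF assms(1-3), of "f r"] orb_step[OF orb_self] by auto
  then have c: "cycs f D = (\<lambda>d. orb f d) ` (D - {r})"
    unfolding cycs_def using fr by (metis insert_absorb insert_Diff[OF assms(3)] image_insert)
  have "cycs (excise f r) (D - {r}) = (\<lambda>C. C - {r}) ` cycs f D"
    unfolding c unfolding cycs_def image_image
    by (intro image_cong refl orb_excise[OF assms(1-3)])
  moreover have "inj_on (\<lambda>C. C - {r}) (cycs f D)"
  proof (rule inj_onI)
    fix C C' assume h: "C \<in> cycs f D" "C' \<in> cycs f D" "C - {r} = C' - {r}"
    obtain x y where x: "x \<in> D - {r}" "C = orb f x" and y: "y \<in> D" "C' = orb f y"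
      using h unfolding c by auto
    then have "x \<in> orb f y" using h(3) orb_self[of x f] by auto
    then show "C = C'" using orb_eq[OF assms(1,2) y(1)] x y by auto
  qed
  ultimately show ?thesis unfolding ncyc_def by (simp add: card_image)
qed

section \<open>Cycles of a permutation composed with a transposition\<close>

lemma cycs_avoiding_eq:
  assumes "bij_betw f D D"
  shows "{C \<in> cycs f D. x \<notin> C \<and> y \<notin> C} \<subseteq> {C \<in> cycs (f \<circ> transpose x y) D. x \<notin> C \<and> y \<notin> C}"
proof
  fix C assume "C \<in> {C \<in> cycs f D. x \<notin> C \<and> y \<notin> C}"
  then obtain d where d: "d \<in> D" "C = orb f d" "x \<notin> C" "y \<notin> C" unfolding cycs_def by auto
  have "orb (f \<circ> transpose x y) d = orb f d"
  proof (rule orb_cong[where A = C])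
    fix z assume "z \<in> C"
    then show "(f \<circ> transpose x y) z = f z" using d by (metis comp_apply transpose_apply_other)
  qed (use d orb_self orb_invariant in auto)
  then show "C \<in> {C \<in> cycs (f \<circ> transpose x y) D. x \<notin> C \<and> y \<notin> C}"
    using d unfolding cycs_def by auto
qed

lemma transpose_bij_betw:
  assumes "bij_betw f D D" "x \<in> D" "y \<in> D"
  shows "bij_betw (f \<circ> transpose x y) D D"
  using assms by (meson bij_betw_trans permutes_imp_bij permutes_swap_id)

lemma cycs_avoiding:
  assumes "bij_betw f D D" "x \<in> D" "y \<in> D"
  shows "{C \<in> cycs (f \<circ> transpose x y) D. x \<notin> C \<and> y \<notin> C} = {C \<in> cycs f D. x \<notin> C \<and> y \<notin> C}"
proof
  have "f \<circ> transpose x y \<circ> transpose x y = f" by (simp add: comp_assoc)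
  then show "{C \<in> cycs (f \<circ> transpose x y) D. x \<notin> C \<and> y \<notin> C} \<subseteq> {C \<in> cycs f D. x \<notin> C \<and> y \<notin> C}"
    using cycs_avoiding_eq[OF transpose_bij_betw[OF assms], of x y] by simp
qed (rule cycs_avoiding_eq[OF assms(1)])

text \<open>Transposing x and y affects only the cycles through x or y. Once these are separated
  from the others, the next two lemmas only compare numbers in {1, 2}.\<close>

lemma ncyc_split:
  assumes "finite D" "bij_betw f D D" "x \<in> D" "y \<in> D"
  shows "ncyc f D = card {C \<in> cycs f D. x \<notin> C \<and> y \<notin> C} + card {orb f x, orb f y}"
proof -
  have fin: "finite (cycs f D)" using assms(1) unfolding cycs_def by auto
  let ?K = "{C \<in> cycs f D. x \<notin> C \<and> y \<notin> C}"
  have "C = orb f z" if C: "C \<in> cycs f D" and z: "z \<in> C" for C z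
  proof -
    obtain d where d: "d \<in> D" "C = orb f d" using C unfolding cycs_def by auto
    then show ?thesis using orb_eq[OF assms(1,2) d(1), of z] z by simp
  qed
  then have "cycs f D \<subseteq> ?K \<union> {orb f x, orb f y}" by blast
  moreover have "{orb f x, orb f y} \<subseteq> cycs f D" using assms(3,4) unfolding cycs_def by auto
  ultimately have "cycs f D = ?K \<union> {orb f x, orb f y}" by auto
  moreover have "?K \<inter> {orb f x, orb f y} = {}"
    using orb_self[of x f] orb_self[of y f] by auto
  ultimately have "card (cycs f D) = card ?K + card {orb f x, orb f y}"
    using fin by (metis card_Un_disjoint finite_Un)
  then show ?thesis unfolding ncyc_def .
qed

text \<open>The cycles through x or y number at least 1 before the transposition and at most 2 after
  it.\<close>

lemma ncyc_transpose_le: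
  assumes "finite D" "bij_betw f D D" "x \<in> D" "y \<in> D"
  shows "ncyc (f \<circ> transpose x y) D \<le> Suc (ncyc f D)"
proof -
  have "card {orb (f \<circ> transpose x y) x, orb (f \<circ> transpose x y) y} \<le> 2" by (simp add: card_insert_if)
  moreover have "card {orb f x, orb f y} \<ge> 1" by (simp add: card_insert_if)
  ultimately show ?thesis
    using ncyc_split[OF assms] ncyc_split[OF assms(1) transpose_bij_betw[OF assms(2-4)] assms(3,4)]
      cycs_avoiding[OF assms(2-4)] by simp
qed

lemma ncyc_transpose_merge:
  assumes "finite D" "bij_betw f D D" "x \<in> D" "y \<in> D" "orb f x \<noteq> orb f y"
  shows "Suc (ncyc (f \<circ> transpose x y) D) = ncyc f D"
proof -
  let ?g = "f \<circ> transpose x y"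
  have nx: "(f ^^ j) y \<noteq> x" for j
  proof
    assume "(f ^^ j) y = x"
    then have "x \<in> orb f y" unfolding orb_def by auto
    then show False using orb_eq[OF assms(1,2,4)] assms(5) by auto
  qed
  \<comment> \<open>From x the new permutation runs along the old cycle of y. That cycle never meets
    x, so the transposition interferes only at y, and there the walk restarts at \<open>f y\<close>,
    which is the image of x.\<close>
  have step: "(f ^^ Suc j) y \<in> orb ?g x" for j
  proof (induction j)
    case 0
    have "?g x \<in> orb ?g x" by (rule orb_step[OF orb_self])
    moreover have "?g x = (f ^^ Suc 0) y" by simp
    ultimately show ?case by (simp only:)
  next
    case (Suc j)
    show ?case
    proof (cases "(f ^^ Suc j) y = y")
      case True
      have "?g x \<in> orb ?g x" by (rule orb_step[OF orb_self])
      moreover have "?g x = (f ^^ Suc (Suc j)) y" using True by simp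
      ultimately show ?thesis by (simp only:)
    next
      case False
      have "?g ((f ^^ Suc j) y) \<in> orb ?g x" using Suc by (rule orb_step)
      moreover have "?g ((f ^^ Suc j) y) = (f ^^ Suc (Suc j)) y"
        using False nx[of "Suc j"] by (simp add: transpose_apply_other)
      ultimately show ?thesis by (simp only:)
    qed
  qed
  have "y \<in> orb f (f y)"
    using orb_eq[OF assms(1,2,4), of "f y"] orb_step[OF orb_self] orb_self by auto
  then obtain j where "y = (f ^^ j) (f y)" unfolding orb_def by auto
  then have "y = (f ^^ Suc j) y" by (simp add: funpow_swap1)
  then have "y \<in> orb ?g x" using step by metis
  then have "orb ?g y = orb ?g x"
    by (rule orb_eq[OF assms(1) transpose_bij_betw[OF assms(2-4)] assms(3)])
  then show ?thesis
    using ncyc_split[OF assms(1-4)] ncyc_split[OF assms(1) transpose_bij_betw[OF assms(2-4)] assms(3,4)]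
      cycs_avoiding[OF assms(2-4)] assms(5) by simp
qed

section \<open>The genus inequality\<close>

text \<open>Transitivity of the group generated by f and a, expressed by invariant subsets; for
  bijections of a finite set images suffice. The empty dart set counts as connected, as the atomic
  map requires.\<close>

definition conn :: "nat set \<Rightarrow> (nat \<Rightarrow> nat) \<Rightarrow> (nat \<Rightarrow> nat) \<Rightarrow> bool" where
  "conn D f a \<longleftrightarrow> (\<forall>A. A \<subseteq> D \<longrightarrow> A \<noteq> {} \<longrightarrow> f ` A \<subseteq> A \<longrightarrow> a ` A \<subseteq> A \<longrightarrow> A = D)"

text \<open>A and B are joined only by the edge between r and r'. An invariant subset of A
  containing r is completed by all of B to an invariant subset of D, and one avoiding r is already
  invariant in D.\<close>

lemma conn_part:
  assumes c: "conn D f a" and AB: "A \<union> B = D" "A \<inter> B = {}"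
    and f: "f ` B \<subseteq> B" and b: "b ` B \<subseteq> B"
    and r: "r \<in> A" "r' \<in> B" "a r = r'" "a r' = r"
    and ab: "\<And>d. d \<in> D \<Longrightarrow> d \<noteq> r \<Longrightarrow> d \<noteq> r' \<Longrightarrow> a d = b d"
  shows "conn A f b"
  unfolding conn_def
proof (intro allI impI)
  fix A' assume h: "A' \<subseteq> A" "A' \<noteq> {}" "f ` A' \<subseteq> A'" "b ` A' \<subseteq> A'"
  show "A' = A"
  proof (cases "r \<in> A'")
    case True
    have "a ` (A' \<union> B) \<subseteq> A' \<union> B"
    proof
      fix z assume "z \<in> a ` (A' \<union> B)"
      then obtain d where d: "d \<in> A' \<union> B" "z = a d" by auto
      show "z \<in> A' \<union> B"
      proof (cases "d = r \<or> d = r'")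
        case False
        then have "a d = b d" using ab d h(1) AB by auto
        then show ?thesis using d h(4) b by auto
      qed (use d r True in auto)
    qed
    moreover have "f ` (A' \<union> B) \<subseteq> A' \<union> B" using h f by auto
    ultimately have "A' \<union> B = D" using c h(1,2) AB unfolding conn_def by (metis Un_mono order_refl Un_empty)
    then show ?thesis using AB h(1) by auto
  next
    case False
    have "a ` A' \<subseteq> A'"
    proof
      fix z assume "z \<in> a ` A'"
      then obtain d where d: "d \<in> A'" "z = a d" by auto
      then have "d \<noteq> r" "d \<noteq> r'" "d \<in> D" using False h(1) AB r by auto
      then have "a d = b d" using ab by auto
      then show "z \<in> A'" using d h(4) by auto
    qed
    then have "A' = D" using c h AB unfolding conn_def by (metis Un_upper1 order_trans)
    then show ?thesis using h(1) AB by auto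
  qed
qed

text \<open>Cutting one edge leaves at most two components: an invariant proper subset cannot
  contain both ends of the edge, and it cannot miss both because its complement is of the same
  kind.\<close>

lemma disconnected_split:
  assumes fin: "finite D" and f: "bij_betw f D D" and b: "bij_betw b D D"
    and nc: "\<not> conn D f b" and c: "conn D f a"
    and r: "r \<in> D" "r' \<in> D" "a r = r'" "a r' = r" "r \<noteq> r'"
    and ab: "\<And>d. d \<in> D \<Longrightarrow> d \<noteq> r \<Longrightarrow> d \<noteq> r' \<Longrightarrow> a d = b d"
  obtains A B where "A \<union> B = D" "A \<inter> B = {}" "r \<in> A" "r' \<in> B"
    "f ` A \<subseteq> A" "f ` B \<subseteq> B" "b ` A \<subseteq> A" "b ` B \<subseteq> B" "conn A f b" "conn B f b"
proof -
  note res = that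
  obtain A where A: "A \<subseteq> D" "A \<noteq> {}" "f ` A \<subseteq> A" "b ` A \<subseteq> A" "A \<noteq> D"
    using nc unfolding conn_def by blast
  have B: "f ` (D - A) \<subseteq> D - A" "b ` (D - A) \<subseteq> D - A"
    using inv_set_compl[OF fin f A(1,3)] inv_set_compl[OF fin b A(1,4)] by auto
  have key: "\<not> (r \<in> X \<and> r' \<in> X)" if X: "X \<subseteq> D" "X \<noteq> {}" "f ` X \<subseteq> X" "b ` X \<subseteq> X" "X \<noteq> D" for X
  proof
    assume h: "r \<in> X \<and> r' \<in> X"
    have "a ` X \<subseteq> X"
    proof
      fix z assume "z \<in> a ` X"
      then obtain d where d: "d \<in> X" "z = a d" by auto
      show "z \<in> X"
        by (cases "d = r \<or> d = r'") (use d h r ab[of d] X in auto)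
    qed
    then show False using c X unfolding conn_def by blast
  qed
  have p1: thesis if "r \<in> X" "r' \<in> D - X" "X \<subseteq> D" "f ` X \<subseteq> X" "b ` X \<subseteq> X" "f ` (D - X) \<subseteq> D - X" "b ` (D - X) \<subseteq> D - X" for X
  proof -
    have "conn X f b"
      by (rule conn_part[OF c _ _ that(6,7) that(1,2) r(3,4) ab]) (use that(3) in auto)
    moreover have "conn (D - X) f b"
      by (rule conn_part[OF c _ _ that(4,5) that(2,1) r(4,3)]) (use that(3) ab in auto)
    ultimately show thesis using that by (intro res[of X "D - X"]) auto
  qed
  show thesis
  proof (cases "r \<in> A")
    case True
    then have "r' \<in> D - A" using key[OF A] r(2) by auto
    then show ?thesis using p1[of A] True A B by auto
  next
    case False
    have "\<not> (r \<in> D - A \<and> r' \<in> D - A)"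
      by (rule key) (use A B in auto)
    then have "r' \<in> A" using False r by auto
    moreover have "D - (D - A) = A" using A(1) by auto
    ultimately show ?thesis using p1[of "D - A"] False A B r by auto
  qed
qed

text \<open>The inequality v + f - e \<le> 2 for partially glued polygons: a dart fixed by the
  involution is a side not yet glued, so edges can be cut one at a time without creating
  isolated vertices.\<close>

lemma genus_inequality:
  assumes "finite D" "bij_betw f D D" "bij_betw a D D" "\<And>d. d \<in> D \<Longrightarrow> a (a d) = d" "conn D f a"
  shows "2 * (ncyc f D + ncyc (f \<circ> a) D) \<le> card {d \<in> D. a d \<noteq> d} + 4"
  using assms
proof (induction "card {d \<in> D. a d \<noteq> d}" arbitrary: D a rule: less_induct)
  case less
  note fin = less.prems(1) and f = less.prems(2) and a = less.prems(3) and aa = less.prems(4) and c = less.prems(5)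
  have aD: "a d \<in> D" if "d \<in> D" for d using a that by (auto simp: bij_betw_def)
  show ?case
  proof (cases "\<exists>r\<in>D. a r \<noteq> r")
    \<comment> \<open>Nothing is glued, so D is empty or a single cycle of f. Both cycle counts are
      at most 1, and the constant 4 suffices.\<close>
    case False
    then have id: "\<And>d. d \<in> D \<Longrightarrow> a d = d" by auto
    have fD: "f ` D \<subseteq> D" using f by (auto simp: bij_betw_def)
    have "ncyc (f \<circ> a) D = ncyc f D" using fD id by (intro ncyc_cong) auto
    moreover have "ncyc f D \<le> 1"
    proof -
      have "orb f d = D" if "d \<in> D" for d
      proof -
        have "orb f d \<subseteq> D" using f that by (rule orb_subset)
        moreover have "a ` orb f d \<subseteq> orb f d" using calculation id by auto
        ultimately show ?thesis
          using c orb_self[of d f] orb_invariant[of f d] unfolding conn_def by (metis empty_iff)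
      qed
      then have "cycs f D \<subseteq> {D}" unfolding cycs_def by auto
      then have "card (cycs f D) \<le> card {D}" by (intro card_mono) auto
      then show ?thesis unfolding ncyc_def by simp
    qed
    ultimately show ?thesis by simp
  next
    case True
    then obtain r where r: "r \<in> D" "a r \<noteq> r" by auto
    define r' where "r' = a r"
    define b where "b = a \<circ> transpose r r'"
    have r': "r' \<in> D" "r' \<noteq> r" "a r' = r" "a r = r'" using r aD aa unfolding r'_def by auto
    have bo: "b d = a d" if "d \<noteq> r" "d \<noteq> r'" for d using that unfolding b_def by simp
    have br: "b r = r" "b r' = r'" using r' unfolding b_def by auto
    have bb: "bij_betw b D D" unfolding b_def by (rule transpose_bij_betw[OF a r(1) r'(1)])
    have bbd: "b (b d) = d" if "d \<in> D" for d
    proof (cases "d = r \<or> d = r'")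
      case False
      then have "a d \<noteq> r" "a d \<noteq> r'" using aa[OF that] r' by auto
      then show ?thesis using bo aa[OF that] False by auto
    qed (use br in auto)
    have fb: "bij_betw (f \<circ> b) D D" using bb f by (rule bij_betw_trans)
    have fa: "f \<circ> a = (f \<circ> b) \<circ> transpose r r'"
      unfolding b_def by (simp add: comp_assoc)
    let ?m = "\<lambda>a D. {d \<in> D. a d \<noteq> d}"
    have ma: "?m a D = insert r (insert r' (?m b D))"
    proof (rule set_eqI)
      fix d show "d \<in> ?m a D \<longleftrightarrow> d \<in> insert r (insert r' (?m b D))"
        by (cases "d = r"; cases "d = r'") (use bo[of d] br r r' in simp_all)
    qed
    have fm: "finite (?m b D)" using fin by auto
    have cm: "card (?m a D) = card (?m b D) + 2" unfolding ma using fm br r' by auto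
    show ?thesis
    proof (cases "conn D f b")
      \<comment> \<open>Gluing the edge back adds at most one cycle, which its two darts pay
        for.\<close>
      case True
      have "2 * (ncyc f D + ncyc (f \<circ> b) D) \<le> card (?m b D) + 4"
        by (rule less.hyps[OF _ fin f bb bbd True]) (use cm in auto)
      moreover have "ncyc (f \<circ> a) D \<le> Suc (ncyc (f \<circ> b) D)"
        unfolding fa by (rule ncyc_transpose_le[OF fin fb r(1) r'(1)])
      ultimately show ?thesis using cm by simp
    next
      case False
      obtain A B where AB: "A \<union> B = D" "A \<inter> B = {}" "r \<in> A" "r' \<in> B"
        "f ` A \<subseteq> A" "f ` B \<subseteq> B" "b ` A \<subseteq> A" "b ` B \<subseteq> B" "conn A f b" "conn B f b"
        by (rule disconnected_split[OF fin f bb False c r(1) r'(1) r'(4,3) r'(2)[symmetric]])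
          (use bo in auto)
      have fAB: "finite A" "finite B" using fin AB(1) by auto
      have A: "2 * (ncyc f A + ncyc (f \<circ> b) A) \<le> card (?m b A) + 4"
      proof (rule less.hyps[OF _ fAB(1)])
        have "card (?m b A) \<le> card (?m b D)" using fm AB(1) by (intro card_mono) auto
        then show "card (?m b A) < card (?m a D)" using cm by simp
      qed (use AB inv_set_bij[OF fin f] inv_set_bij[OF fin bb] bbd in auto)
      have B: "2 * (ncyc f B + ncyc (f \<circ> b) B) \<le> card (?m b B) + 4"
      proof (rule less.hyps[OF _ fAB(2)])
        have "card (?m b B) \<le> card (?m b D)" using fm AB(1) by (intro card_mono) auto
        then show "card (?m b B) < card (?m a D)" using cm by simp
      qed (use AB inv_set_bij[OF fin f] inv_set_bij[OF fin bb] bbd in auto)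
      have s1: "ncyc f D = ncyc f A + ncyc f B"
        using ncyc_Un[OF fAB AB(2,5,6)] AB(1) by simp
      have s2: "ncyc (f \<circ> b) D = ncyc (f \<circ> b) A + ncyc (f \<circ> b) B"
        using ncyc_Un[OF fAB AB(2), of "f \<circ> b"] AB by fastforce
      have "orb (f \<circ> b) r \<subseteq> A" "orb (f \<circ> b) r' \<subseteq> B"
        using AB by (intro orb_minimal; fastforce)+
      then have "orb (f \<circ> b) r \<noteq> orb (f \<circ> b) r'"
        using orb_self[of r "f \<circ> b"] AB(2) by auto
      \<comment> \<open>The two pieces bring the constant 4 twice. Half of the surplus 4 is absorbed
        here, where gluing merges two cycles, and the other half by the two darts of the
        edge.\<close>
      then have s3: "Suc (ncyc (f \<circ> a) D) = ncyc (f \<circ> b) D"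
        unfolding fa by (rule ncyc_transpose_merge[OF fin fb r(1) r'(1)])
      have "?m b D = ?m b A \<union> ?m b B" using AB(1) by auto
      moreover have "?m b A \<inter> ?m b B = {}" using AB(2) by auto
      ultimately have s4: "card (?m b D) = card (?m b A) + card (?m b B)"
        using fAB by (simp add: card_Un_disjoint)
      show ?thesis using A B s1 s2 s3 s4 cm by simp
    qed
  qed
qed

section \<open>Coloured near-triangulations with a listed outer face\<close>

text \<open>The image e of the last entry is left open: e = \<open>hd l\<close> closes the list to a
  cycle, another e makes it a stretch of a longer boundary.\<close>

fun nx :: "nat list \<Rightarrow> nat \<Rightarrow> nat \<Rightarrow> nat" where
  "nx [] e d = d"
| "nx (x # l) e d = (if d = x then hd (l @ [e]) else nx l e d)"

lemma nx_append: "nx (l1 @ l2) e d = (if d \<in> set l1 then nx l1 (hd (l2 @ [e])) d else nx l2 e d)"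
  by (induction l1) (auto simp: hd_append)

lemma nx_other: "d \<notin> set l \<Longrightarrow> nx l e d = d"
  by (induction l) auto

lemma nx_in: "d \<in> set l \<Longrightarrow> nx l e d \<in> insert e (set l)"
  by (induction l) (auto simp: hd_append)

text \<open>Only the last entry sees the end value, so closing the list at another point alters a
  single image. The outer cycles before and after a deletion are compared through this.\<close>

lemma nx_change_end:
  "x \<notin> set l \<Longrightarrow> d \<in> set l \<Longrightarrow>
    nx l x d = x \<and> nx l e d = e \<or> nx l x d \<in> set l \<and> nx l e d = nx l x d"
proof (induction l)
  case (Cons z l)
  then show ?case by (cases l) auto
qed simp

lemma nx_image: "distinct l \<Longrightarrow> l \<noteq> [] \<Longrightarrow> nx l e ` set l = set (tl l @ [e])"
proof (induction l)
  case (Cons x l)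
  have "nx (x # l) e ` set (x # l) = insert (hd (l @ [e])) (nx l e ` set l)"
    using Cons.prems by (auto intro!: image_cong)
  also have "\<dots> = set (l @ [e])"
  proof (cases "l = []")
    case False
    then show ?thesis using Cons by (cases l) auto
  qed simp
  finally show ?case by simp
qed simp

lemma nx_bij:
  assumes "distinct l"
  shows "bij_betw (nx l (hd l)) (set l) (set l)"
proof (cases "l = []")
  case False
  then have "nx l (hd l) ` set l = set l" using nx_image[OF assms False] by (cases l) auto
  then show ?thesis by (simp add: bij_betw_def eq_card_imp_inj_on)
qed (simp add: bij_betw_def)

lemma nx_closed:
  assumes "hd (l @ [e]) \<in> A" "\<And>d. d \<in> A \<Longrightarrow> d \<in> set l \<Longrightarrow> nx l e d \<in> A" "distinct l"
  shows "set l \<subseteq> A"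
  using assms
proof (induction l)
  case (Cons x l)
  have "hd (l @ [e]) \<in> A" using Cons.prems(1) Cons.prems(2)[of x] by auto
  moreover have "nx l e d \<in> A" if "d \<in> A" "d \<in> set l" for d
    using Cons.prems(2)[of d] Cons.prems(3) that by (auto split: if_splits)
  ultimately have "set l \<subseteq> A" using Cons.IH Cons.prems(3) by auto
  then show ?case using Cons.prems(1) by auto
qed simp

lemma orb_nx:
  assumes "distinct l" "d \<in> set l"
  shows "orb (nx l (hd l)) d = set l"
proof -
  have h: "hd l \<in> set l" using assms(2) by (cases l) auto
  have b: "bij_betw (nx l (hd l)) (set l) (set l)" using nx_bij[OF assms(1)] .
  have "set l \<subseteq> orb (nx l (hd l)) (hd l)"
    using h orb_self by (intro nx_closed[OF _ _ assms(1), of "hd l"]) (auto simp: hd_append intro: orb_step)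
  moreover have "orb (nx l (hd l)) (hd l) \<subseteq> set l" using b h by (rule orb_subset)
  ultimately have "orb (nx l (hd l)) (hd l) = set l" by (rule antisym[rotated])
  then show ?thesis using orb_eq[OF finite_set b h, of d] assms(2) by metis
qed

text \<open>For a rotation system s this plays the role of \<open>s \<circ> a\<close>, so the vertex
  rotation is recovered as \<open>face_perm l \<tau> \<circ> a\<close>.\<close>

definition face_perm :: "nat list \<Rightarrow> (nat \<Rightarrow> nat) \<Rightarrow> nat \<Rightarrow> nat" where
  "face_perm l \<tau> d = (if d \<in> set l then nx l (hd l) d else \<tau> d)"

lemma face_perm_bij:
  assumes "finite D" "distinct l" "set l \<subseteq> D" "\<tau> permutes D - set l"
  shows "bij_betw (face_perm l \<tau>) D D"
proof -
  have 1: "bij_betw (face_perm l \<tau>) (set l) (set l)"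
    using nx_bij[OF assms(2)] by (simp add: face_perm_def cong: bij_betw_cong)
  have "bij_betw (face_perm l \<tau>) (D - set l) (D - set l) \<longleftrightarrow> bij_betw \<tau> (D - set l) (D - set l)"
    by (rule bij_betw_cong) (simp add: face_perm_def)
  then have 2: "bij_betw (face_perm l \<tau>) (D - set l) (D - set l)"
    using permutes_imp_bij[OF assms(4)] by simp
  have "set l \<union> (D - set l) = D" using assms(3) by auto
  then show ?thesis using bij_betw_combine[OF 1 2] by simp
qed

definition is_inv :: "nat set \<Rightarrow> (nat \<Rightarrow> nat) \<Rightarrow> bool" where
  "is_inv D a \<longleftrightarrow> a permutes D \<and> (\<forall>d\<in>D. a d \<noteq> d \<and> a (a d) = d)"

text \<open>Replacing d by \<open>a d\<close> turns the equation into constancy of c along the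
  cycles of \<open>f \<circ> a\<close>, that is, on vertices. The inequality is properness.\<close>

definition coloured :: "nat set \<Rightarrow> (nat \<Rightarrow> nat) \<Rightarrow> (nat \<Rightarrow> nat) \<Rightarrow> (nat \<Rightarrow> nat) \<Rightarrow> bool" where
  "coloured D f a c \<longleftrightarrow> c \<in> D \<rightarrow>\<^sub>E {0..<3} \<and> (\<forall>d\<in>D. c (f d) = c (a d) \<and> c (a d) \<noteq> c d)"

definition tri :: "nat set \<Rightarrow> (nat \<Rightarrow> nat) \<Rightarrow> bool" where
  "tri B \<tau> \<longleftrightarrow> \<tau> permutes B \<and> (\<forall>d\<in>B. \<tau> d \<noteq> d \<and> \<tau> (\<tau> (\<tau> d)) = d)"

text \<open>A near-triangulation with the outer darts in cyclic order l, inner face rotation \<tau> and edge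
  involution a; c d is the colour of the initial vertex of the dart d.  Vertices are the cycles of
  the face rotation composed with a, and the equation with factor 6 is Euler's formula.  The empty
  set of darts stands for the atomic map.\<close>

definition pmap :: "nat set \<Rightarrow> nat list \<Rightarrow> (nat \<Rightarrow> nat) \<Rightarrow> (nat \<Rightarrow> nat) \<Rightarrow> (nat \<Rightarrow> nat) \<Rightarrow> bool" where
  "pmap D l \<tau> a c \<longleftrightarrow>
     finite D \<and> distinct l \<and> set l \<subseteq> D \<and> (D = {} \<or> l \<noteq> []) \<and> tri (D - set l) \<tau> \<and> is_inv D a \<and>
     conn D (face_perm l \<tau>) a \<and>
     (D = {} \<or> 6 * ncyc (face_perm l \<tau> \<circ> a) D = card D + 2 * length l + 6) \<and>
     coloured D (face_perm l \<tau>) a c"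

definition step :: "(nat \<Rightarrow> nat) \<Rightarrow> (nat \<Rightarrow> nat) \<Rightarrow> nat \<Rightarrow> bool" where
  "step c a d \<longleftrightarrow> c (a d) = (c d + 1) mod 3"

text \<open>The colour of the root vertex is prescribed. The atomic map has no dart that could carry
  a colour, so it is counted once for every k.\<close>

definition pmaps :: "nat set \<Rightarrow> bool list \<Rightarrow> nat \<Rightarrow> (nat list \<times> (nat \<Rightarrow> nat) \<times> (nat \<Rightarrow> nat) \<times> (nat \<Rightarrow> nat)) set" where
  "pmaps D w k = {(l, \<tau>, a, c). pmap D l \<tau> a c \<and> map (step c a) l = w \<and> (l \<noteq> [] \<longrightarrow> c (hd l) = k)}"

definition rooted :: "nat set \<Rightarrow> nat \<Rightarrow> bool list \<Rightarrow> nat \<Rightarrow> (nat list \<times> (nat \<Rightarrow> nat) \<times> (nat \<Rightarrow> nat) \<times> (nat \<Rightarrow> nat)) set" where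
  "rooted D r w k = {(l, \<tau>, a, c). (l, \<tau>, a, c) \<in> pmaps D w k \<and> l \<noteq> [] \<and> hd l = r}"

lemma is_inv_bij: "is_inv D a \<Longrightarrow> bij_betw a D D"
  unfolding is_inv_def by (auto intro: permutes_imp_bij)

section \<open>Deleting the root edge\<close>

text \<open>Deletion of the edge r, r' separating the outer face from the inner triangle r', x, y.\<close>

locale merge =
  fixes D' :: "nat set" and r r' x y :: nat and f f' a a' :: "nat \<Rightarrow> nat"
  assumes fin: "finite D'" and r: "r \<notin> D'" "r' \<notin> D'" "r \<noteq> r'"
    and xy: "x \<in> D'" "y \<in> D'" "x \<noteq> y"
    and f: "bij_betw f (insert r (insert r' D')) (insert r (insert r' D'))"
    and f': "bij_betw f' D' D'"
    and a': "bij_betw a' D' D'"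
    and a: "a r = r'" "a r' = r" "\<And>d. d \<in> D' \<Longrightarrow> a d = a' d"
    and fr: "f r' = x" "f x = y" "f y = r'" "f' x = y"
    and cr: "f r = r \<and> f' y = x \<or> f r \<in> D' \<and> f' y = f r"
    and cd: "\<And>d. d \<in> D' \<Longrightarrow> d \<noteq> x \<Longrightarrow> d \<noteq> y \<Longrightarrow> f d = r \<and> f' d = x \<or> f d \<in> D' \<and> f' d = f d"
begin

abbreviation "D \<equiv> insert r (insert r' D')"

lemma finD: "finite D" using fin by simp

lemma a'D: "d \<in> D' \<Longrightarrow> a' d \<in> D'" using a' by (auto simp: bij_betw_def)

lemma a_bij: "bij_betw a D D"
proof -
  have "a ` D = D" using a r a' by (auto simp: bij_betw_def image_iff)
  then show ?thesis unfolding bij_betw_def using eq_card_imp_inj_on[OF finD, of a] by metis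
qed

text \<open>Before the deletion r, r', x and y lie in one orbit, after it x and y still do.
  Invariant sets of the two systems therefore correspond to each other by adding or removing r and
  r' together.\<close>

lemma conn_iff: "conn D f a \<longleftrightarrow> conn D' f' a'"
proof
  assume c: "conn D f a"
  show "conn D' f' a'" unfolding conn_def
  proof (intro allI impI)
    fix A assume h: "A \<subseteq> D'" "A \<noteq> {}" "f' ` A \<subseteq> A" "a' ` A \<subseteq> A"
    have xyA: "y \<in> A \<longleftrightarrow> x \<in> A" using inv_set_iff[OF fin f' h(1,3) xy(1)] fr by simp
    have aA: "a d \<in> A" if "d \<in> A" for d using h(1,4) that a(3)[of d] by auto
    have fA': "f' d \<in> A" if "d \<in> A" for d using h(3) that by auto
    show "A = D'"
    proof (cases "x \<in> A")
      case True
      have "f d \<in> insert r (insert r' A)" if "d \<in> A" for d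
        using cd[of d] that fA'[of d] fr True xyA h(1) by (cases "d = x"; cases "d = y") auto
      moreover have "f r \<in> insert r (insert r' A)" using cr fA'[of y] True xyA by auto
      moreover have "f r' \<in> insert r (insert r' A)" using fr(1) True by simp
      ultimately have "f ` insert r (insert r' A) \<subseteq> insert r (insert r' A)"
        by (simp only: image_subset_iff ball_simps) blast
      moreover have "a ` insert r (insert r' A) \<subseteq> insert r (insert r' A)" using a aA by auto
      ultimately have "insert r (insert r' A) = D"
        using c h(1) unfolding conn_def by (metis insert_mono insert_not_empty)
      then show ?thesis using r h(1) by auto
    next
      case False
      have "f d \<in> A" if "d \<in> A" for d
      proof -
        have "d \<noteq> x" "d \<noteq> y" "d \<in> D'" using that h(1) False xyA by auto
        then have "f d = r \<and> f' d = x \<or> f d \<in> D' \<and> f' d = f d" by (intro cd)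
        then show ?thesis using fA'[OF that] False by metis
      qed
      then have "f ` A \<subseteq> A" "a ` A \<subseteq> A" "A \<subseteq> D" using aA h(1) by blast+
      then have "A = D" using c h(2) unfolding conn_def by blast
      then show ?thesis using h(1) r by blast
    qed
  qed
next
  assume c: "conn D' f' a'"
  show "conn D f a" unfolding conn_def
  proof (intro allI impI)
    fix A assume h: "A \<subseteq> D" "A \<noteq> {}" "f ` A \<subseteq> A" "a ` A \<subseteq> A"
    note fi = inv_set_iff[OF finD f h(1,3)] and ai = inv_set_iff[OF finD a_bij h(1,4)]
    have i: "x \<in> A \<longleftrightarrow> r' \<in> A" "y \<in> A \<longleftrightarrow> x \<in> A" "r' \<in> A \<longleftrightarrow> r \<in> A"
    proof -
      have "f r' \<in> A \<longleftrightarrow> r' \<in> A" "f x \<in> A \<longleftrightarrow> x \<in> A" "a r \<in> A \<longleftrightarrow> r \<in> A"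
        using xy by (intro fi ai; simp)+
      then show "x \<in> A \<longleftrightarrow> r' \<in> A" "y \<in> A \<longleftrightarrow> x \<in> A" "r' \<in> A \<longleftrightarrow> r \<in> A"
        unfolding fr a(1) by simp_all
    qed
    have ne: "A \<inter> D' \<noteq> {}" using h(1,2) i xy by blast
    have fA: "f d \<in> A" "a d \<in> A" if "d \<in> A" for d using h(3,4) that by auto
    have "f' d \<in> A \<inter> D'" if d: "d \<in> A \<inter> D'" for d
    proof -
      consider "d = x" | "d = y" | "d \<noteq> x" "d \<noteq> y" by blast
      then show ?thesis
      proof cases
        case 1
        then show ?thesis using fr i xy d by simp
      next
        case 2
        then have "r \<in> A" "x \<in> A" using i d by simp_all
        then show ?thesis using 2 cr fA(1)[of r] xy by (metis IntI)
      next
        case 3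
        then have "f d = r \<and> f' d = x \<or> f d \<in> D' \<and> f' d = f d" using d by (intro cd) simp_all
        moreover have "f d \<in> A" using d by (intro fA) simp
        ultimately show ?thesis using i xy by auto
      qed
    qed
    moreover have "a' d \<in> A \<inter> D'" if "d \<in> A \<inter> D'" for d
      using that a'D[of d] a(3)[of d] fA(2)[of d] by simp
    ultimately have "f' ` (A \<inter> D') \<subseteq> A \<inter> D'" "a' ` (A \<inter> D') \<subseteq> A \<inter> D'" by blast+
    then have "A \<inter> D' = D'" using c ne unfolding conn_def by (metis inf_le2)
    then have "x \<in> A" "D' \<subseteq> A" using xy by auto
    then show "A = D" using i h(1) by blast
  qed
qed

text \<open>Neither r nor r' is alone at its vertex, so both can be excised in turn from the vertex
  rotation without losing a vertex.\<close>

lemma ncyc_eq: "ncyc (f \<circ> a) D = ncyc (f' \<circ> a') D'"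
proof -
  define s where "s = f \<circ> a"
  have sb: "bij_betw s D D" unfolding s_def using a_bij f by (rule bij_betw_trans)
  have s: "s r = x" "s r' = f r" unfolding s_def using a fr by auto
  have "ncyc (excise s r) (D - {r}) = ncyc s D"
    by (rule ncyc_excise[OF finD sb]) (use s xy r in auto)
  moreover have "ncyc (excise (excise s r) r') (D - {r} - {r'}) = ncyc (excise s r) (D - {r})"
  proof (rule ncyc_excise)
    show "bij_betw (excise s r) (D - {r}) (D - {r})" by (rule excise_bij[OF finD sb]) simp
    show "excise s r r' \<noteq> r'" using s cr xy r unfolding excise_def by auto
  qed (use finD r in auto)
  moreover have "D - {r} - {r'} = D'" using r by auto
  moreover have "ncyc (excise (excise s r) r') D' = ncyc (f' \<circ> a') D'"
  proof (rule ncyc_cong)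
    show "(f' \<circ> a') ` D' \<subseteq> D'" using a' f' by (auto simp: bij_betw_def)
    fix d assume d: "d \<in> D'"
    have sd: "s d = f (a' d)" unfolding s_def using a(3)[OF d] by simp
    have e1: "excise s r z = (if s z = r then x else s z)" if "z \<noteq> r" for z
      using that s unfolding excise_def by auto
    have e2: "excise (excise s r) r' d = (if excise s r d = r' then excise s r r' else excise s r d)"
      using d r unfolding excise_def by auto
    have z: "a' d \<in> D'" using a'D[OF d] .
    have dr: "d \<noteq> r" "r' \<noteq> r" using d r by auto
    consider "a' d = x" | "a' d = y" | "a' d \<noteq> x" "a' d \<noteq> y" by auto
    then show "excise (excise s r) r' d = (f' \<circ> a') d"
    proof cases
      case 1
      then show ?thesis using e2 e1[OF dr(1)] sd fr xy r by auto
    next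
      case 2
      then show ?thesis using e2 e1[OF dr(1)] e1[OF dr(2)] sd fr xy r s cr by auto
    next
      case 3
      then show ?thesis using e2 e1[OF dr(1)] sd xy r cd[OF z] by auto
    qed
  qed
  ultimately show ?thesis unfolding s_def by simp
qed

end

section \<open>Component rules, and colours around a triangle\<close>

lemma is_invI:
  assumes "\<And>d. d \<in> D \<Longrightarrow> a d \<in> D \<and> a d \<noteq> d \<and> a (a d) = d" "\<And>d. d \<notin> D \<Longrightarrow> a d = d"
  shows "is_inv D a"
proof -
  have "bij_betw a D D" by (rule bij_betw_byWitness[where f' = a]) (use assms in auto)
  then show ?thesis unfolding is_inv_def using assms by (auto intro: bij_imp_permutes)
qed

lemma triI:
  assumes "\<And>d. d \<in> B \<Longrightarrow> \<tau> d \<in> B \<and> \<tau> d \<noteq> d \<and> \<tau> (\<tau> (\<tau> d)) = d" "\<And>d. d \<notin> B \<Longrightarrow> \<tau> d = d"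
  shows "tri B \<tau>"
proof -
  have "bij_betw \<tau> B B" by (rule bij_betw_byWitness[where f' = "\<lambda>d. \<tau> (\<tau> d)"]) (use assms in auto)
  then show ?thesis unfolding tri_def using assms by (auto intro: bij_imp_permutes)
qed

lemma is_invD:
  assumes "is_inv D a"
  shows "d \<in> D \<Longrightarrow> a d \<in> D" "d \<in> D \<Longrightarrow> a d \<noteq> d" "d \<in> D \<Longrightarrow> a (a d) = d" "d \<notin> D \<Longrightarrow> a d = d"
proof -
  have p: "a permutes D" and b: "\<forall>d\<in>D. a d \<noteq> d \<and> a (a d) = d" using assms unfolding is_inv_def by blast+
  show "d \<in> D \<Longrightarrow> a d \<in> D" "d \<notin> D \<Longrightarrow> a d = d" using permutes_in_image[OF p] permutes_not_in[OF p] by blast+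
  show "d \<in> D \<Longrightarrow> a d \<noteq> d" "d \<in> D \<Longrightarrow> a (a d) = d" using b by blast+
qed

lemma triD:
  assumes "tri B \<tau>"
  shows "d \<in> B \<Longrightarrow> \<tau> d \<in> B" "d \<in> B \<Longrightarrow> \<tau> d \<noteq> d" "d \<in> B \<Longrightarrow> \<tau> (\<tau> (\<tau> d)) = d" "d \<notin> B \<Longrightarrow> \<tau> d = d"
proof -
  have p: "\<tau> permutes B" and b: "\<forall>d\<in>B. \<tau> d \<noteq> d \<and> \<tau> (\<tau> (\<tau> d)) = d" using assms unfolding tri_def by blast+
  show "d \<in> B \<Longrightarrow> \<tau> d \<in> B" "d \<notin> B \<Longrightarrow> \<tau> d = d" using permutes_in_image[OF p] permutes_not_in[OF p] by blast+
  show "d \<in> B \<Longrightarrow> \<tau> d \<noteq> d" "d \<in> B \<Longrightarrow> \<tau> (\<tau> (\<tau> d)) = d" using b by blast+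
qed

lemma pmapD:
  assumes "pmap D l \<tau> a c"
  shows "finite D" "distinct l" "set l \<subseteq> D" "D = {} \<or> l \<noteq> []" "tri (D - set l) \<tau>" "is_inv D a"
    "conn D (face_perm l \<tau>) a" "D = {} \<or> 6 * ncyc (face_perm l \<tau> \<circ> a) D = card D + 2 * length l + 6"
    "coloured D (face_perm l \<tau>) a c" "bij_betw (face_perm l \<tau>) D D"
proof -
  show 1: "finite D" "distinct l" "set l \<subseteq> D" "D = {} \<or> l \<noteq> []" "tri (D - set l) \<tau>" "is_inv D a"
    "conn D (face_perm l \<tau>) a" "D = {} \<or> 6 * ncyc (face_perm l \<tau> \<circ> a) D = card D + 2 * length l + 6"
    "coloured D (face_perm l \<tau>) a c"
    using assms unfolding pmap_def by blast+
  show "bij_betw (face_perm l \<tau>) D D" using face_perm_bij[OF 1(1-3)] 1(5) unfolding tri_def by blast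
qed

lemma colouredD:
  assumes "coloured D f a c"
  shows "c \<in> D \<rightarrow>\<^sub>E {0..<3}" "d \<in> D \<Longrightarrow> c d < 3" "d \<in> D \<Longrightarrow> c (f d) = c (a d)" "d \<in> D \<Longrightarrow> c (a d) \<noteq> c d"
proof -
  show c: "c \<in> D \<rightarrow>\<^sub>E {0..<3}" using assms unfolding coloured_def by blast
  show "d \<in> D \<Longrightarrow> c d < 3" using PiE_mem[OF c] by simp
  show "d \<in> D \<Longrightarrow> c (f d) = c (a d)" "d \<in> D \<Longrightarrow> c (a d) \<noteq> c d"
    using assms unfolding coloured_def by blast+
qed

text \<open>If the edge from p to q goes up, the detour from p through s to q goes down twice, and
  conversely. This is the replacement of a letter by two opposite ones.\<close>

lemma three_colours:
  assumes "p < 3" "q < 3" "s < (3::nat)" "p \<noteq> q" "q \<noteq> s" "p \<noteq> s"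
  shows "s = (p + 1) mod 3 \<longleftrightarrow> q \<noteq> (p + 1) mod 3" "q = (s + 1) mod 3 \<longleftrightarrow> q \<noteq> (p + 1) mod 3"
proof -
  have "p = 0 \<or> p = 1 \<or> p = 2" "q = 0 \<or> q = 1 \<or> q = 2" "s = 0 \<or> s = 1 \<or> s = 2" using assms(1-3) by auto
  then show "s = (p + 1) mod 3 \<longleftrightarrow> q \<noteq> (p + 1) mod 3" "q = (s + 1) mod 3 \<longleftrightarrow> q \<noteq> (p + 1) mod 3"
    using assms(4-6) by (elim disjE; simp)+
qed

text \<open>Two equal steps mod 3 do not return to their start, so an edge closing them to a
  triangle is properly coloured.\<close>

lemma three_colours':
  assumes "p < 3" "q < 3" "s < (3::nat)" "q \<noteq> s" "p \<noteq> s"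
    "s = (p + 1) mod 3 \<longleftrightarrow> q = (s + 1) mod 3"
  shows "p \<noteq> q"
proof -
  have "p = 0 \<or> p = 1 \<or> p = 2" "q = 0 \<or> q = 1 \<or> q = 2" "s = 0 \<or> s = 1 \<or> s = 2" using assms(1-3) by auto
  then show ?thesis using assms(4-6) by (elim disjE; simp)
qed

text \<open>The outer cycle r, u becomes x, y, u: the predecessor of r now leads to x, and y takes
  over the successor of r. If u is empty, r was its own predecessor, and y leads to x.\<close>

lemma merge_locale:
  fixes D' :: "nat set"
  assumes fin: "finite D'" and r: "r \<notin> D'" "r' \<notin> D'" "r \<noteq> r'"
    and dist: "distinct (x # y # u)" "set (x # y # u) \<subseteq> D'"
    and t: "tri (insert r (insert r' D') - set (r # u)) \<tau>" and t': "tri (D' - set (x # y # u)) \<tau>'"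
    and tx: "\<tau> r' = x" "\<tau> x = y" "\<tau> y = r'"
    and tt: "\<And>d. d \<in> D' - set (x # y # u) \<Longrightarrow> \<tau> d = \<tau>' d"
    and inv: "is_inv D' a'" and a: "a r = r'" "a r' = r" "\<And>d. d \<in> D' \<Longrightarrow> a d = a' d"
  shows "merge D' r r' x y (face_perm (r # u) \<tau>) (face_perm (x # y # u) \<tau>') a a'"
proof
  let ?D = "insert r (insert r' D')"
  have uD: "set u \<subseteq> D'" "x \<in> D'" "y \<in> D'" using dist by auto
  have nn: "x \<noteq> r" "x \<noteq> r'" "y \<noteq> r" "y \<noteq> r'" "r \<notin> set u" "r' \<notin> set u" "x \<notin> set u" "y \<notin> set u"
    using dist r uD by auto
  show "bij_betw (face_perm (r # u) \<tau>) ?D ?D"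
    by (rule face_perm_bij) (use fin dist nn uD t in \<open>auto simp: tri_def\<close>)
  show "bij_betw (face_perm (x # y # u) \<tau>') D' D'"
    by (rule face_perm_bij) (use fin dist t' in \<open>auto simp: tri_def\<close>)
  show "bij_betw a' D' D'" using inv by (rule is_inv_bij)
  show "face_perm (r # u) \<tau> r' = x" "face_perm (r # u) \<tau> x = y" "face_perm (r # u) \<tau> y = r'"
    using nn r tx unfolding face_perm_def by auto
  show "face_perm (x # y # u) \<tau>' x = y" unfolding face_perm_def by simp
  have fr: "face_perm (r # u) \<tau> r = hd (u @ [r])" unfolding face_perm_def by simp
  have fy: "face_perm (x # y # u) \<tau>' y = hd (u @ [x])" using dist(1) unfolding face_perm_def by auto
  show "face_perm (r # u) \<tau> r = r \<and> face_perm (x # y # u) \<tau>' y = x \<or>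
    face_perm (r # u) \<tau> r \<in> D' \<and> face_perm (x # y # u) \<tau>' y = face_perm (r # u) \<tau> r"
    unfolding fr fy using uD by (cases u) auto
  fix d assume d: "d \<in> D'" "d \<noteq> x" "d \<noteq> y"
  show "face_perm (r # u) \<tau> d = r \<and> face_perm (x # y # u) \<tau>' d = x \<or>
       face_perm (r # u) \<tau> d \<in> D' \<and> face_perm (x # y # u) \<tau>' d = face_perm (r # u) \<tau> d"
  proof (cases "d \<in> set u")
    case True
    then have e: "face_perm (r # u) \<tau> d = nx u r d" "face_perm (x # y # u) \<tau>' d = nx u x d"
      using d nn r unfolding face_perm_def by auto
    show ?thesis unfolding e using nx_change_end[OF nn(7) True, of r] uD by auto
  next
    case False
    have dd: "d \<in> D' - set (x # y # u)" using False d by auto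
    have "face_perm (r # u) \<tau> d = \<tau>' d" "face_perm (x # y # u) \<tau>' d = \<tau>' d"
      using False d r tt[OF dd] unfolding face_perm_def by auto
    then show ?thesis using triD(1)[OF t' dd] by auto
  qed
qed (use fin r dist a in auto)

text \<open>The triangle r', x, y behind the root edge is opened, and its sides x, y replace r on
  the boundary. The colours at x and at \<open>a' y\<close> are recorded because the inverse
  construction reads the colours of r and r' off them.\<close>

lemma merge_fwd:
  assumes pm: "pmap D (r # u) \<tau> a c" and ar: "a r = r'" and r': "r' \<notin> set (r # u)"
  defines "x \<equiv> \<tau> r'"
  defines "y \<equiv> \<tau> (\<tau> r')"
  defines "D' \<equiv> D - {r, r'}"
  defines "\<tau>' \<equiv> \<lambda>d. if d \<in> {r', x, y} then d else \<tau> d"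
  defines "a' \<equiv> \<lambda>d. if d \<in> {r, r'} then d else a d"
  defines "c' \<equiv> restrict c D'"
  shows "pmap D' (x # y # u) \<tau>' a' c'"
    "c' x = c r" "c' (a' y) = c r'" "step c' a' x \<longleftrightarrow> \<not> step c a r" "step c' a' y \<longleftrightarrow> \<not> step c a r"
    "\<And>d. d \<in> set u \<Longrightarrow> step c' a' d = step c a d"
proof -
  note P = pmapD[OF pm]
  let ?B = "D - set (r # u)"
  have rD: "r \<in> D" "r' \<in> D" "r \<noteq> r'" "a r' = r"
    using P(3) is_invD[OF P(6), of r] ar by auto
  have rB: "r' \<in> ?B" using rD r' by auto
  have xB: "x \<in> ?B" using triD(1)[OF P(5) rB] unfolding x_def .
  have yB: "y \<in> ?B" using triD(1)[OF P(5) xB] unfolding x_def y_def .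
  have ty: "\<tau> y = r'" using triD(3)[OF P(5) rB] unfolding y_def .
  have tx: "\<tau> x = y" "\<tau> r' = x" unfolding x_def y_def by auto
  have ne: "x \<noteq> r'" "y \<noteq> x" "y \<noteq> r'"
    using triD(2)[OF P(5) rB] triD(2)[OF P(5) xB] triD(2)[OF P(5) yB] tx ty by auto
  have D: "D = insert r (insert r' D')" using rD unfolding D'_def by auto
  have fin: "finite D'" using P(1) unfolding D'_def by auto
  have inj: "inj_on \<tau> ?B" using P(5) unfolding tri_def by (auto intro: permutes_inj_on)
  have xyD: "x \<in> D'" "y \<in> D'" using xB yB ne unfolding D'_def by auto
  have uD: "set u \<subseteq> D'" using P(2,3) r' unfolding D'_def by auto
  have D'B: "D' - set (x # y # u) = ?B - {r', x, y}" unfolding D'_def by auto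
  have t': "tri (D' - set (x # y # u)) \<tau>'"
    unfolding D'B
  proof (rule triI)
    fix d assume d: "d \<in> ?B - {r', x, y}"
    have dB: "d \<in> ?B" using d by auto
    have n: "\<tau> d \<noteq> x" "\<tau> d \<noteq> y" "\<tau> d \<noteq> r'"
      using inj_onD[OF inj, of d] dB rB xB yB tx ty d by auto
    have tdB: "\<tau> d \<in> ?B" using triD(1)[OF P(5) dB] .
    have n2: "\<tau> (\<tau> d) \<noteq> x" "\<tau> (\<tau> d) \<noteq> y" "\<tau> (\<tau> d) \<noteq> r'"
      using inj_onD[OF inj, of "\<tau> d"] tdB rB xB yB tx ty n by auto
    have e: "\<tau>' d = \<tau> d" "\<tau>' (\<tau> d) = \<tau> (\<tau> d)" "\<tau>' (\<tau> (\<tau> d)) = \<tau> (\<tau> (\<tau> d))"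
      using d n n2 unfolding \<tau>'_def by auto
    show "\<tau>' d \<in> ?B - {r', x, y} \<and> \<tau>' d \<noteq> d \<and> \<tau>' (\<tau>' (\<tau>' d)) = d"
      unfolding e using tdB n triD(2,3)[OF P(5) dB] by auto
  next
    fix d assume d: "d \<notin> ?B - {r', x, y}"
    then show "\<tau>' d = d" using triD(4)[OF P(5), of d] unfolding \<tau>'_def by auto
  qed
  have aD: "a d \<in> D'" "a' d = a d" if "d \<in> D'" for d
  proof -
    have "d \<in> D" "d \<noteq> r" "d \<noteq> r'" using that unfolding D'_def by auto
    moreover have "a d \<noteq> r" "a d \<noteq> r'"
      using is_invD(3)[OF P(6), of d] calculation ar rD by auto
    ultimately show "a d \<in> D'" "a' d = a d"
      using is_invD(1)[OF P(6), of d] unfolding D'_def a'_def by auto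
  qed
  have inv: "is_inv D' a'"
  proof (rule is_invI)
    fix d assume d: "d \<in> D'"
    then have "d \<in> D" unfolding D'_def by auto
    then show "a' d \<in> D' \<and> a' d \<noteq> d \<and> a' (a' d) = d"
      using aD(1)[OF d] aD(2)[OF d] aD(2)[OF aD(1)[OF d]] is_invD[OF P(6), of d] by auto
  next
    fix d assume "d \<notin> D'"
    then show "a' d = d" using is_invD(4)[OF P(6), of d] unfolding D'_def a'_def by auto
  qed
  have dist: "distinct (x # y # u)" using P(2) xB yB ne by auto
  interpret m: merge D' r r' x y "face_perm (r # u) \<tau>" "face_perm (x # y # u) \<tau>'" a a'
  proof (rule merge_locale[OF fin _ _ rD(3) dist _ _ t' tx(2) tx(1) ty _ inv ar rD(4)])
    show "tri (insert r (insert r' D') - set (r # u)) \<tau>" using P(5) D by simp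
    show "\<tau> d = \<tau>' d" if "d \<in> D' - set (x # y # u)" for d
      using that unfolding \<tau>'_def D'_def by auto
    show "a d = a' d" if "d \<in> D'" for d using aD(2)[OF that] by simp
  qed (use uD xyD in \<open>auto simp: D'_def\<close>)
  let ?f = "face_perm (r # u) \<tau>" and ?f' = "face_perm (x # y # u) \<tau>'"
  note C = colouredD[OF P(9)]
  have cx: "c x = c r" using C(3)[OF rD(2)] m.fr(1) rD(4) by simp
  have cax: "c (a x) = c y" using C(3)[of x] m.fr(2) xyD D by auto
  have cay: "c (a y) = c r'" using C(3)[of y] m.fr(3) xyD D by auto
  have xD: "x \<in> D" "y \<in> D" using xyD D by auto
  have cr: "c r' \<noteq> c r" using C(4)[OF rD(1)] ar by simp
  have cy: "c y \<noteq> c x" "c r' \<noteq> c y" using C(4)[OF xD(1)] C(4)[OF xD(2)] cax cay by auto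
  have col: "coloured D' ?f' a' c'"
    unfolding coloured_def
  proof (intro conjI ballI)
    show "c' \<in> D' \<rightarrow>\<^sub>E {0..<3}" using C(1) D unfolding c'_def by auto
    fix d assume d: "d \<in> D'"
    have dD: "d \<in> D" using d D by auto
    have f'D: "?f' d \<in> D'" using m.f' d by (auto simp: bij_betw_def)
    show "c' (a' d) \<noteq> c' d"
      using C(4)[OF dD] aD[OF d] d unfolding c'_def by simp
    have "c (?f' d) = c (a d)"
    proof -
      consider "d = x" | "d = y" | "d \<noteq> x" "d \<noteq> y" by blast
      then show ?thesis
      proof cases
        case 1
        then show ?thesis using m.fr(4) cax by simp
      next
        case 2
        have "?f r \<noteq> r"
        proof
          assume "?f r = r"
          then show False using C(3)[OF rD(1)] C(4)[OF rD(1)] by simp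
        qed
        then have "?f' y = ?f r" using m.cr by blast
        then show ?thesis using 2 C(3)[OF rD(1)] cay ar by simp
      next
        case 3
        then show ?thesis using m.cd[OF d 3] C(3)[OF dD] cx by auto
      qed
    qed
    then show "c' (?f' d) = c' (a' d)"
      using f'D aD[OF d] unfolding c'_def by simp
  qed
  have cardD: "card D = card D' + 2" using fin m.r D by simp
  show "pmap D' (x # y # u) \<tau>' a' c'"
    unfolding pmap_def
  proof (intro conjI)
    show "conn D' ?f' a'" using m.conn_iff P(7) D by simp
    have "6 * ncyc (?f \<circ> a) D = card D + 2 * length (r # u) + 6" using P(8) rD by auto
    then show "D' = {} \<or> 6 * ncyc (?f' \<circ> a') D' = card D' + 2 * length (x # y # u) + 6"
      using m.ncyc_eq D cardD by simp
  qed (use fin dist uD xyD t' inv col in auto)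
  note tc = three_colours[of "c r" "c r'" "c y"]
  have lt: "c r < 3" "c r' < 3" "c y < 3" using C(2) rD xD by auto
  show "c' x = c r" using xyD cx unfolding c'_def by simp
  show "c' (a' y) = c r'" using aD[OF xyD(2)] cay unfolding c'_def by simp
  show "step c' a' x \<longleftrightarrow> \<not> step c a r"
    using tc(1) lt cr cy cx cax aD[OF xyD(1)] xyD ar unfolding step_def c'_def by simp
  show "step c' a' y \<longleftrightarrow> \<not> step c a r"
    using tc(2) lt cr cy cx cay aD[OF xyD(2)] xyD ar unfolding step_def c'_def by simp
  show "step c' a' d = step c a d" if "d \<in> set u" for d
    using that uD aD[of d] unfolding step_def c'_def by auto
qed

text \<open>The new edge joins the ends of the boundary path x, y; it is properly coloured because
  the two steps along this path agree.\<close>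

lemma merge_bwd:
  assumes pm: "pmap D' (x # y # u) \<tau>' a' c'" and r: "r \<notin> D'" "r' \<notin> D'" "r \<noteq> r'"
    and st: "step c' a' x = step c' a' y"
  defines "D \<equiv> insert r (insert r' D')"
  defines "\<tau> \<equiv> \<tau>'(r' := x, x := y, y := r')"
  defines "a \<equiv> a'(r := r', r' := r)"
  defines "c \<equiv> c'(r := c' x, r' := c' (a' y))"
  shows "pmap D (r # u) \<tau> a c"
proof -
  note P = pmapD[OF pm]
  have xyD: "x \<in> D'" "y \<in> D'" "set u \<subseteq> D'" and dist: "x \<noteq> y" "x \<notin> set u" "y \<notin> set u" "distinct u"
    using P(2,3) by auto
  have ne: "x \<noteq> r" "x \<noteq> r'" "y \<noteq> r" "y \<noteq> r'" using xyD r by auto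
  let ?B' = "D' - set (x # y # u)"
  have DB: "D - set (r # u) = ?B' \<union> {r', x, y}" unfolding D_def using xyD dist ne r by auto
  have t: "tri (D - set (r # u)) \<tau>"
    unfolding DB
  proof (rule triI)
    fix d assume d: "d \<in> ?B' \<union> {r', x, y}"
    show "\<tau> d \<in> ?B' \<union> {r', x, y} \<and> \<tau> d \<noteq> d \<and> \<tau> (\<tau> (\<tau> d)) = d"
    proof (cases "d \<in> ?B'")
      case True
      note T = triD[OF P(5)]
      have e: "\<tau> z = \<tau>' z" if "z \<in> ?B'" for z using that r unfolding \<tau>_def by auto
      have "\<tau>' d \<in> ?B'" "\<tau>' (\<tau>' d) \<in> ?B'" using T(1)[OF True] T(1)[OF T(1)[OF True]] by auto
      then have "\<tau> d = \<tau>' d" "\<tau> (\<tau> d) = \<tau>' (\<tau>' d)" "\<tau> (\<tau> (\<tau> d)) = \<tau>' (\<tau>' (\<tau>' d))"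
        using e True by metis+
      then show ?thesis using T(1-3)[OF True] by auto
    next
      case False
      then show ?thesis using d ne dist unfolding \<tau>_def by auto
    qed
  next
    fix d assume "d \<notin> ?B' \<union> {r', x, y}"
    then show "\<tau> d = d" using triD(4)[OF P(5), of d] unfolding \<tau>_def by auto
  qed
  have aD: "a d = a' d" "a d \<in> D'" if "d \<in> D'" for d
    using that r is_invD(1)[OF P(6) that] unfolding a_def by auto
  have ar: "a r = r'" "a r' = r" using r unfolding a_def by auto
  have inv: "is_inv D a"
  proof (rule is_invI)
    fix d assume "d \<in> D"
    then consider "d = r" | "d = r'" | "d \<in> D'" unfolding D_def by auto
    then show "a d \<in> D \<and> a d \<noteq> d \<and> a (a d) = d"
    proof cases
      case 3
      then show ?thesis using aD[OF 3] aD(1)[of "a' d"] is_invD[OF P(6), of d] unfolding D_def by auto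
    qed (use ar r in \<open>auto simp: D_def\<close>)
  next
    fix d assume "d \<notin> D"
    then show "a d = d" using is_invD(4)[OF P(6), of d] unfolding a_def D_def by auto
  qed
  interpret m: merge D' r r' x y "face_perm (r # u) \<tau>" "face_perm (x # y # u) \<tau>'" a a'
  proof (rule merge_locale[OF P(1) r P(2,3) _ P(5) _ _ _ _ P(6) ar])
    show "tri (insert r (insert r' D') - set (r # u)) \<tau>" using t unfolding D_def .
    show "\<tau> r' = x" "\<tau> x = y" "\<tau> y = r'" using ne dist unfolding \<tau>_def by auto
    show "\<tau> d = \<tau>' d" if "d \<in> ?B'" for d
      using that r unfolding \<tau>_def by auto
    show "a d = a' d" if "d \<in> D'" for d using aD(1)[OF that] .
  qed
  let ?f = "face_perm (r # u) \<tau>" and ?f' = "face_perm (x # y # u) \<tau>'"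
  note C = colouredD[OF P(9)]
  have cD: "c d = c' d" if "d \<in> D'" for d using that r unfolding c_def by auto
  have cr: "c r = c' x" "c r' = c' (a' y)" using r unfolding c_def by auto
  have cax: "c' (a' x) = c' y" using C(3)[OF xyD(1)] m.fr(4) by simp
  have a'y: "a' y \<in> D'" using is_invD(1)[OF P(6) xyD(2)] .
  have crr: "c r \<noteq> c r'"
  proof -
    have "c' x < 3" "c' y < 3" "c' (a' y) < 3" "c' x \<noteq> c' y" "c' (a' y) \<noteq> c' y"
      using C(2)[OF xyD(1)] C(2)[OF xyD(2)] C(2)[OF a'y] C(4)[OF xyD(1)] C(4)[OF xyD(2)] cax by auto
    then show ?thesis
      using st cax three_colours'[of "c' x" "c' (a' y)" "c' y"] unfolding cr step_def by auto
  qed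
  have col: "coloured D ?f a c"
    unfolding coloured_def
  proof (intro conjI ballI)
    show "c \<in> D \<rightarrow>\<^sub>E {0..<3}"
      using C(1) C(2)[OF xyD(1)] C(2)[OF a'y] unfolding c_def D_def by (auto simp: PiE_def extensional_def)
    fix d assume "d \<in> D"
    then consider "d = r" | "d = r'" | "d = x" | "d = y" | "d \<in> D'" "d \<noteq> x" "d \<noteq> y"
      unfolding D_def by auto
    then have "c (?f d) = c (a d) \<and> c (a d) \<noteq> c d"
    proof cases
      case 1
      have "c (?f r) = c r'"
        using m.cr
      proof
        assume "?f r = r \<and> ?f' y = x"
        then show ?thesis using C(3)[OF xyD(2)] cr by simp
      next
        assume "?f r \<in> D' \<and> ?f' y = ?f r"
        then show ?thesis using C(3)[OF xyD(2)] cr cD by simp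
      qed
      then show ?thesis using 1 ar crr by simp
    next
      case 2
      then show ?thesis using m.fr(1) cD[OF xyD(1)] cr ar crr by simp
    next
      case 3
      then show ?thesis
        using m.fr(2) cD[OF xyD(1)] cD[OF xyD(2)] cD[OF aD(2)[OF xyD(1)]] aD[OF xyD(1)] cax C(4)[OF xyD(1)] by simp
    next
      case 4
      then show ?thesis
        using m.fr(3) cD[OF xyD(2)] cD[OF aD(2)[OF xyD(2)]] aD[OF xyD(2)] cr C(4)[OF xyD(2)] by simp
    next
      case 5
      have "c (?f d) = c' (?f' d)" using m.cd[OF 5] cr cD by auto
      then show ?thesis
        using cD[OF 5(1)] cD[OF aD(2)[OF 5(1)]] aD[OF 5(1)] C(3,4)[OF 5(1)] by simp
    qed
    then show "c (?f d) = c (a d)" "c (a d) \<noteq> c d" by auto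
  qed
  have cardD: "card D = card D' + 2" using P(1) m.r unfolding D_def by simp
  show ?thesis
    unfolding pmap_def
  proof (intro conjI)
    show "conn D ?f a" using m.conn_iff P(7) unfolding D_def by simp
    have "6 * ncyc (?f' \<circ> a') D' = card D' + 2 * length (x # y # u) + 6" using P(8) xyD by auto
    then show "D = {} \<or> 6 * ncyc (?f \<circ> a) D = card D + 2 * length (r # u) + 6"
      using m.ncyc_eq cardD unfolding D_def by simp
  qed (use P(1) dist xyD r t inv col in \<open>auto simp: D_def\<close>)
qed

text \<open>F opens the triangle and G closes it. Since labelled structures are compared as
  functions, the inverse laws also have to restore the default values outside the dart set: the
  identity for the permutations, \<open>undefined\<close> for the colouring.\<close>

lemma card_merge:
  assumes D: "finite D" "r \<in> D" "r' \<in> D" "r \<noteq> r'"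
  shows "card {(l, \<tau>, a, c). (l, \<tau>, a, c) \<in> rooted D r (b # v) k \<and> a r = r' \<and> r' \<notin> set l}
       = card (pmaps (D - {r, r'}) ((\<not> b) # (\<not> b) # v) k)" (is "card ?S = card ?T")
proof (rule bij_betw_same_card)
  let ?D' = "D - {r, r'}"
  define F :: "nat list \<times> (nat \<Rightarrow> nat) \<times> (nat \<Rightarrow> nat) \<times> (nat \<Rightarrow> nat) \<Rightarrow> _" where
    "F = (\<lambda>(l, \<tau>, a, c). (\<tau> r' # \<tau> (\<tau> r') # tl l, \<lambda>d. if d \<in> {r', \<tau> r', \<tau> (\<tau> r')} then d else \<tau> d,
        \<lambda>d. if d \<in> {r, r'} then d else a d, restrict c ?D'))"
  define G :: "nat list \<times> (nat \<Rightarrow> nat) \<times> (nat \<Rightarrow> nat) \<times> (nat \<Rightarrow> nat) \<Rightarrow> _" where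
    "G = (\<lambda>(l, \<tau>, a, c). (r # tl (tl l), \<tau>(r' := hd l, hd l := hd (tl l), hd (tl l) := r'),
        a(r := r', r' := r), c(r := c (hd l), r' := c (a (hd (tl l))))))"
  have fwd: "F z \<in> ?T \<and> G (F z) = z" if z: "z \<in> ?S" for z
  proof -
    obtain l \<tau> a c where zz: "z = (l, \<tau>, a, c)" by (cases z)
    have h: "pmap D l \<tau> a c" "map (step c a) l = b # v" "c (hd l) = k" "l \<noteq> []" "hd l = r" "a r = r'" "r' \<notin> set l"
      using z unfolding zz rooted_def pmaps_def by auto
    obtain u where l: "l = r # u" using h(4,5) by (cases l) auto
    have st: "step c a r = b" "map (step c a) u = v" "c r = k" using h(2,3) unfolding l by auto
    let ?x = "\<tau> r'" and ?y = "\<tau> (\<tau> r')"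
    let ?\<tau> = "\<lambda>d. if d \<in> {r', ?x, ?y} then d else \<tau> d" and ?a = "\<lambda>d. if d \<in> {r, r'} then d else a d"
      and ?c = "restrict c ?D'"
    note M = merge_fwd[OF h(1)[unfolded l] h(6) h(7)[unfolded l]]
    have Fz: "F z = (?x # ?y # u, ?\<tau>, ?a, ?c)" unfolding F_def zz l by simp
    have "map (step ?c ?a) u = map (step c a) u" by (rule map_cong[OF refl M(6)])
    then have "map (step ?c ?a) u = v" using st(2) by simp
    then have "F z \<in> ?T"
      unfolding Fz pmaps_def using M(1,2,4,5) st by simp
    moreover have "G (F z) = z"
    proof -
      have rB: "r' \<in> D - set (r # u)" using D h(7) l by auto
      have t: "\<tau>  ?y = r'" using triD(3)[OF pmapD(5)[OF h(1)[unfolded l]] rB] .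
      have tt: "?\<tau>(r' := ?x, ?x := ?y, ?y := r') = \<tau>" using t by auto
      have ar: "a r' = r" using is_invD(3)[OF pmapD(6)[OF h(1)] D(2)] h(6) by simp
      have aa: "?a(r := r', r' := r) = a" using h(6) ar by auto
      have ext: "c \<in> extensional D" using colouredD(1)[OF pmapD(9)[OF h(1)]] by (auto simp: PiE_def)
      have "?c(r := c r, r' := c r') = c"
      proof
        fix d show "(?c(r := c r, r' := c r')) d = c d"
          using ext by (cases "d \<in> D") (auto simp: extensional_def)
      qed
      then show ?thesis
        unfolding Fz unfolding G_def zz l using tt aa M(2,3) by simp
    qed
    ultimately show ?thesis by blast
  qed
  have bwd: "G z \<in> ?S \<and> F (G z) = z" if z: "z \<in> ?T" for z
  proof -
    obtain l \<tau> a c where zz: "z = (l, \<tau>, a, c)" by (cases z)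
    have h: "pmap ?D' l \<tau> a c" "map (step c a) l = (\<not> b) # (\<not> b) # v" "l \<noteq> [] \<longrightarrow> c (hd l) = k"
      using z unfolding zz pmaps_def by auto
    obtain x y u where l: "l = x # y # u" and st: "step c a x = (\<not> b)" "step c a y = (\<not> b)" "map (step c a) u = v"
      using h(2) by (auto simp: map_eq_Cons_conv)
    have ck: "c x = k" using h(3) l by auto
    let ?\<tau> = "\<tau>(r' := x, x := y, y := r')" and ?a = "a(r := r', r' := r)" and ?c = "c(r := c x, r' := c (a y))"
    have Gz: "G z = (r # u, ?\<tau>, ?a, ?c)" unfolding G_def zz l by simp
    note P = pmapD[OF h(1)[unfolded l]]
    have DD: "insert r (insert r' ?D') = D" using D by auto
    have "pmap (insert r (insert r' ?D')) (r # u) ?\<tau> ?a ?c"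
      by (rule merge_bwd[OF h(1)[unfolded l]]) (use D st in auto)
    then have pm: "pmap D (r # u) ?\<tau> ?a ?c" unfolding DD .
    have ar: "?a r = r'" using D by simp
    have ru: "r' \<notin> set (r # u)" using P(3) D by auto
    have xy: "x \<noteq> r" "x \<noteq> r'" "y \<noteq> r" "y \<noteq> r'" "x \<noteq> y" "r \<notin> set u" "r' \<notin> set u" using P(2,3) by auto
    have tx: "?\<tau> r' = x" "?\<tau> x = y" using xy by auto
    note M = merge_fwd[OF pm ar ru, unfolded tx]
    \<comment> \<open>The three overwritten arguments lie outside the inner darts of the smaller
      map, where \<tau> is the identity; resetting them to the identity recovers \<tau>.\<close>
    have e\<tau>: "(\<lambda>d. if d \<in> {r', x, y} then d else ?\<tau> d) = \<tau>"
    proof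
      fix d
      have "d \<in> {r', x, y} \<Longrightarrow> \<tau> d = d" by (rule triD(4)[OF P(5)]) auto
      then show "(if d \<in> {r', x, y} then d else ?\<tau> d) = \<tau> d" by auto
    qed
    have ea: "(\<lambda>d. if d \<in> {r, r'} then d else ?a d) = a"
    proof
      fix d
      have "d \<in> {r, r'} \<Longrightarrow> a d = d" by (rule is_invD(4)[OF P(6)]) auto
      then show "(if d \<in> {r, r'} then d else ?a d) = a d" by auto
    qed
    have ext: "c \<in> extensional ?D'" using colouredD(1)[OF P(9)] by (auto simp: PiE_def)
    have ec: "restrict ?c ?D' = c"
    proof
      fix d show "restrict ?c ?D' d = c d"
        using ext by (cases "d \<in> ?D'") (auto simp: extensional_def)
    qed
    have FG: "F (G z) = z"
      unfolding Gz unfolding F_def zz l prod.case tx ea ec e\<tau> by simp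
    have sr: "step ?c ?a r = b"
      using M(4) st(1) unfolding ea ec by blast
    have "step ?c ?a d = step c a d" if "d \<in> set u" for d
    proof -
      have "d \<in> ?D'" using that P(3) by auto
      then have "a d \<in> ?D'" using is_invD(1)[OF P(6)] by blast
      then show ?thesis using \<open>d \<in> ?D'\<close> unfolding step_def by auto
    qed
    then have "map (step ?c ?a) u = map (step c a) u" by (rule map_cong[OF refl])
    then have "map (step ?c ?a) u = v" using st(3) by simp
    then have "G z \<in> ?S"
      unfolding Gz rooted_def pmaps_def using pm sr ar ru ck D(4) by simp
    then show ?thesis using FG by blast
  qed
  show "bij_betw F ?S ?T"
  proof (rule bij_betw_byWitness[where f' = G])
    show "\<forall>z\<in>?S. G (F z) = z" by (intro ballI fwd[THEN conjunct2])
    show "\<forall>z\<in>?T. F (G z) = z" by (intro ballI bwd[THEN conjunct2])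
    show "F ` ?S \<subseteq> ?T" by (intro image_subsetI fwd[THEN conjunct1])
    show "G ` ?T \<subseteq> ?S" by (intro image_subsetI bwd[THEN conjunct1])
  qed
qed

section \<open>Face counts and pendant darts\<close>

lemma ncyc_tri:
  assumes "finite B" "tri B \<tau>"
  shows "3 * ncyc \<tau> B = card B"
proof -
  note T = triD[OF assms(2)]
  have bij: "bij_betw \<tau> B B" using assms(2) unfolding tri_def by (auto intro: permutes_imp_bij)
  have orb3: "orb \<tau> d = {d, \<tau> d, \<tau> (\<tau> d)}" if d: "d \<in> B" for d
  proof
    show "orb \<tau> d \<subseteq> {d, \<tau> d, \<tau> (\<tau> d)}" using T(3)[OF d] by (intro orb_minimal) auto
    show "{d, \<tau> d, \<tau> (\<tau> d)} \<subseteq> orb \<tau> d" by (simp add: orb_self orb_step)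
  qed
  have c3: "card (orb \<tau> d) = 3" if d: "d \<in> B" for d
  proof -
    have "\<tau> d \<noteq> d" "\<tau> (\<tau> d) \<noteq> \<tau> d" using T(1,2) d by auto
    moreover have "\<tau> (\<tau> d) \<noteq> d" using T(3)[OF d] T(2)[OF d] by auto
    ultimately show ?thesis unfolding orb3[OF d] by auto
  qed
  have U: "\<Union> (cycs \<tau> B) = B"
    using orb_self orb_subset[OF bij] unfolding cycs_def by blast
  have "3 * card (cycs \<tau> B) = card (\<Union> (cycs \<tau> B))"
  proof (rule card_partition)
    fix C1 C2 assume h: "C1 \<in> cycs \<tau> B" "C2 \<in> cycs \<tau> B" "C1 \<noteq> C2"
    show "C1 \<inter> C2 = {}"
    proof (rule ccontr)
      assume "C1 \<inter> C2 \<noteq> {}"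
      then obtain z x y where "z \<in> C1" "z \<in> C2" "x \<in> B" "y \<in> B" "C1 = orb \<tau> x" "C2 = orb \<tau> y"
        using h unfolding cycs_def by auto
      then show False using orb_eq[OF assms(1) bij] h(3) by metis
    qed
  qed (use assms(1) U c3 in \<open>auto simp: cycs_def\<close>)
  then show ?thesis unfolding U ncyc_def .
qed

text \<open>With v vertices, e edges, f faces and outer degree m, the triangles and the outer face
  give 3 f = 2 e - m + 3. Inserted into v - e + f = 2 this yields 6 v = 2 e + 2 m + 6, the form of
  Euler's formula used in \<open>pmap\<close>.\<close>

lemma ncyc_face:
  assumes "finite D" "distinct l" "l \<noteq> []" "set l \<subseteq> D" "tri (D - set l) \<tau>"
  shows "3 * ncyc (face_perm l \<tau>) D + length l = card D + 3"
proof -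
  let ?f = "face_perm l \<tau>"
  have b: "nx l (hd l) ` set l = set l" using nx_bij[OF assms(2)] by (auto simp: bij_betw_def)
  have 1: "ncyc ?f (set l) = ncyc (nx l (hd l)) (set l)"
    by (rule ncyc_cong) (use b in \<open>auto simp: face_perm_def\<close>)
  have "cycs (nx l (hd l)) (set l) = {set l}"
    unfolding cycs_def using orb_nx[OF assms(2)] assms(3) by (cases l) auto
  then have "ncyc (nx l (hd l)) (set l) = 1" unfolding ncyc_def by simp
  have t: "\<tau> ` (D - set l) \<subseteq> D - set l" using triD(1)[OF assms(5)] by blast
  have 2: "ncyc ?f (D - set l) = ncyc \<tau> (D - set l)"
    by (rule ncyc_cong[OF t]) (auto simp: face_perm_def)
  have "ncyc ?f (set l \<union> (D - set l)) = ncyc ?f (set l) + ncyc ?f (D - set l)"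
  proof (rule ncyc_Un)
    show "?f ` set l \<subseteq> set l" using b unfolding face_perm_def by auto
    show "?f ` (D - set l) \<subseteq> D - set l" using t unfolding face_perm_def by auto
  qed (use assms(1) in auto)
  moreover have "set l \<union> (D - set l) = D" using assms(4) by auto
  moreover have "card D = length l + card (D - set l)"
    using assms(1,2,4) by (metis card_Diff_subset card_mono distinct_card finite_set le_add_diff_inverse)
  ultimately show ?thesis
    using 1 2 \<open>ncyc (nx l (hd l)) (set l) = 1\<close> ncyc_tri[OF _ assms(5)] assms(1) by simp
qed

text \<open>A dart fixed by b is attached only through its neighbours in the f-cycle, and these
  become adjacent when it is skipped.\<close>

lemma conn_excise:
  assumes "finite A" "bij_betw f A A" "r \<in> A" "f r \<noteq> r" "b r = r" "b ` (A - {r}) \<subseteq> A - {r}"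
  shows "conn A f b \<longleftrightarrow> conn (A - {r}) (excise f r) b"
proof
  assume c: "conn A f b"
  show "conn (A - {r}) (excise f r) b" unfolding conn_def
  proof (intro allI impI)
    fix X assume h: "X \<subseteq> A - {r}" "X \<noteq> {}" "excise f r ` X \<subseteq> X" "b ` X \<subseteq> X"
    have e: "excise f r d = (if f d = r then f r else f d)" if "d \<in> X" for d
      using that h(1) unfolding excise_def by auto
    show "X = A - {r}"
    proof (cases "\<exists>d\<in>X. f d = r")
      case True
      then have "f r \<in> X" using e h(3) by force
      moreover have "f d \<in> insert r X" if "d \<in> X" for d
        using e[OF that] h(3) that by (cases "f d = r") auto
      ultimately have "f ` insert r X \<subseteq> insert r X" by blast
      moreover have "b ` insert r X \<subseteq> insert r X" using h(4) assms(5) by auto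
      ultimately have "insert r X = A" using c h(1) assms(3) unfolding conn_def
        by (metis insert_not_empty insert_subset subset_Diff_insert Diff_subset subset_trans)
      then show ?thesis using h(1) by auto
    next
      case False
      then have "f ` X \<subseteq> X" using e h(3) by fastforce
      then have "X = A" using c h unfolding conn_def by blast
      then show ?thesis using h(1) assms(3) by auto
    qed
  qed
next
  assume c: "conn (A - {r}) (excise f r) b"
  show "conn A f b" unfolding conn_def
  proof (intro allI impI)
    fix Y assume h: "Y \<subseteq> A" "Y \<noteq> {}" "f ` Y \<subseteq> Y" "b ` Y \<subseteq> Y"
    have "Y \<noteq> {r}" using h(3) assms(4) by auto
    then have ne: "Y - {r} \<noteq> {}" using h(2) by auto
    have fY: "f d \<in> Y" if "d \<in> Y" for d using h(3) that by blast
    have "excise f r ` (Y - {r}) \<subseteq> Y - {r}"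
    proof
      fix z assume "z \<in> excise f r ` (Y - {r})"
      then obtain d where d: "d \<in> Y" "d \<noteq> r" "z = excise f r d" by blast
      show "z \<in> Y - {r}"
        using fY[OF d(1)] fY[of r] assms(4) d unfolding excise_def by (cases "f d = r") auto
    qed
    moreover have "b ` (Y - {r}) \<subseteq> Y - {r}" using h(1,4) assms(6) by blast
    ultimately have "Y - {r} = A - {r}" using c ne h(1) unfolding conn_def by (metis Diff_mono order_refl)
    moreover obtain z where "z \<in> A" "f z = r" using assms(2,3) by (metis bij_betw_def imageE)
    moreover have "z \<noteq> r" using \<open>f z = r\<close> assms(4) by auto
    ultimately have "r \<in> Y" using fY by blast
    then show "Y = A" using \<open>Y - {r} = A - {r}\<close> assms(3) by blast
  qed
qed

lemma conn_cong:
  assumes "\<And>d. d \<in> D \<Longrightarrow> f d = g d" "\<And>d. d \<in> D \<Longrightarrow> a d = b d"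
  shows "conn D f a = conn D g b"
proof -
  have "f ` A = g ` A" "a ` A = b ` A" if "A \<subseteq> D" for A
    using assms that by (auto intro!: image_cong)
  then show ?thesis unfolding conn_def by (metis (no_types, lifting))
qed

text \<open>Cutting a bridge leaves on each side one dart fixed by the involution, a pendant side of
  the outer face. Skipping it preserves connectivity and the number of vertices. For empty u it is a
  face by itself, so connectivity forces D to be empty, and its single vertex is that of the atomic
  map.\<close>

lemma leaf_iff:
  assumes fin: "finite D" and r: "r \<notin> D" and u: "distinct u" "set u \<subseteq> D"
    and t: "tri (D - set u) \<tau>" and inv: "is_inv D b"
  shows "conn (insert r D) (face_perm (r # u) \<tau>) b \<and>
         6 * ncyc (face_perm (r # u) \<tau> \<circ> b) (insert r D) = card D + 2 * length u + 6 \<longleftrightarrow>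
         (D = {} \<or> u \<noteq> []) \<and> conn D (face_perm u \<tau>) b \<and>
         (D = {} \<or> 6 * ncyc (face_perm u \<tau> \<circ> b) D = card D + 2 * length u + 6)"
proof -
  let ?A = "insert r D" and ?f = "face_perm (r # u) \<tau>"
  have br: "b r = r" using is_invD(4)[OF inv r] .
  have ru: "r \<notin> set u" using r u by auto
  have bD: "b ` D \<subseteq> D" using is_invD(1)[OF inv] by blast
  show ?thesis
  proof (cases "u = []")
    case True
    have fr: "?f r = r" unfolding True face_perm_def by simp
    have "conn ?A ?f b \<Longrightarrow> D = {}"
    proof -
      assume "conn ?A ?f b"
      moreover have "?f ` {r} \<subseteq> {r}" "b ` {r} \<subseteq> {r}" using fr br by auto
      ultimately have "{r} = ?A" unfolding conn_def by blast
      then show "D = {}" using r by blast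
    qed
    moreover have "conn ?A ?f b \<and> conn D (face_perm u \<tau>) b" if "D = {}"
      using that unfolding conn_def by auto
    moreover have "ncyc (?f \<circ> b) ?A = 1" if "D = {}"
      using that unfolding ncyc_def cycs_def by simp
    ultimately show ?thesis using True by auto
  next
    case False
    then have D: "D \<noteq> {}" using u by auto
    have bij: "bij_betw ?f ?A ?A"
      by (rule face_perm_bij) (use fin u ru t r in \<open>auto simp: tri_def insert_Diff_if\<close>)
    have fr: "?f r = hd u" "hd u \<in> set u" using False unfolding face_perm_def by auto
    then have frr: "?f r \<noteq> r" using ru by auto
    have AD: "?A - {r} = D" using r by auto
    have e: "excise ?f r d = face_perm u \<tau> d" if d: "d \<in> D" for d
    proof (cases "d \<in> set u")
      case True
      have "?f d = nx u r d" "d \<noteq> r" using True d r unfolding face_perm_def by auto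
      moreover have "face_perm u \<tau> d = nx u (hd u) d" using True unfolding face_perm_def by simp
      ultimately show ?thesis
        using nx_change_end[OF ru True, of "hd u"] fr ru unfolding excise_def by auto
    next
      case F: False
      have "d \<noteq> r" using d r by auto
      then have "?f d = \<tau> d" "face_perm u \<tau> d = \<tau> d" using F unfolding face_perm_def by auto
      moreover have "\<tau> d \<noteq> r" using triD(1)[OF t, of d] d F r by auto
      ultimately show ?thesis using \<open>d \<noteq> r\<close> unfolding excise_def by auto
    qed
    have c: "conn ?A ?f b \<longleftrightarrow> conn D (face_perm u \<tau>) b"
      using conn_excise[of ?A ?f r b, OF _ bij _ frr br] bD AD fin conn_cong[of D "excise ?f r" "face_perm u \<tau>" b b] e by simp
    have fbij: "bij_betw (face_perm u \<tau>) D D"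
      by (rule face_perm_bij) (use fin u t in \<open>auto simp: tri_def\<close>)
    have "bij_betw b ?A ?A"
    proof -
      have "bij_betw b D D" using inv by (rule is_inv_bij)
      then show ?thesis using br r by (metis notIn_Un_bij_betw Un_insert_right sup_bot.right_neutral)
    qed
    then have sb: "bij_betw (?f \<circ> b) ?A ?A" using bij by (rule bij_betw_trans)
    have "ncyc (excise (?f \<circ> b) r) (?A - {r}) = ncyc (?f \<circ> b) ?A"
      by (rule ncyc_excise[OF _ sb]) (use fin frr br in auto)
    moreover have "ncyc (excise (?f \<circ> b) r) D = ncyc (face_perm u \<tau> \<circ> b) D"
    proof (rule ncyc_cong)
      show "(face_perm u \<tau> \<circ> b) ` D \<subseteq> D" using bD fbij by (auto simp: bij_betw_def)
      fix d assume d: "d \<in> D"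
      have bd: "b d \<in> D" "b d \<noteq> r" "d \<noteq> r" using bD d r by auto
      show "excise (?f \<circ> b) r d = (face_perm u \<tau> \<circ> b) d"
        using e[OF bd(1)] bd br unfolding excise_def by auto
    qed
    ultimately show ?thesis using c False D AD by simp
  qed
qed

text \<open>Deletion of an edge r, r' with the outer face on both sides.\<close>

locale bridge =
  fixes D1 D2 :: "nat set" and r r' :: nat and u1 u2 :: "nat list"
    and \<tau> \<tau>1 \<tau>2 a a1 a2 :: "nat \<Rightarrow> nat"
  assumes fin: "finite D1" "finite D2" and disj: "D1 \<inter> D2 = {}"
    and r: "r \<notin> D1" "r \<notin> D2" "r' \<notin> D1" "r' \<notin> D2" "r \<noteq> r'"
    and u: "distinct u1" "distinct u2" "set u1 \<subseteq> D1" "set u2 \<subseteq> D2"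
    and t: "tri (D1 - set u1) \<tau>1" "tri (D2 - set u2) \<tau>2"
    and \<tau>: "\<And>d. d \<in> D1 - set u1 \<Longrightarrow> \<tau> d = \<tau>1 d" "\<And>d. d \<in> D2 - set u2 \<Longrightarrow> \<tau> d = \<tau>2 d"
    and inv: "is_inv D1 a1" "is_inv D2 a2"
    and a: "a r = r'" "a r' = r" "\<And>d. d \<in> D1 \<Longrightarrow> a d = a1 d" "\<And>d. d \<in> D2 \<Longrightarrow> a d = a2 d"
begin

abbreviation "A \<equiv> insert r D2"
abbreviation "B \<equiv> insert r' D1"
abbreviation "\<phi> \<equiv> face_perm (r # u1 @ r' # u2) \<tau>"
abbreviation "fA \<equiv> face_perm (r # u2) \<tau>2"
abbreviation "fB \<equiv> face_perm (r' # u1) \<tau>1"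

lemma phi_r: "\<phi> r = hd (u1 @ [r'])" "\<phi> r' = hd (u2 @ [r])"
proof -
  have "r' \<notin> set u1" using r u by auto
  then show "\<phi> r = hd (u1 @ [r'])" "\<phi> r' = hd (u2 @ [r])"
    using r unfolding face_perm_def by (auto simp: nx_append hd_append)
qed

lemma phi_1:
  assumes "d \<in> D1"
  shows "\<phi> d = fB d"
proof -
  have "d \<noteq> r" "d \<noteq> r'" "d \<notin> set u2" using assms r u disj by auto
  then show ?thesis
    using \<tau>(1)[of d] assms unfolding face_perm_def by (auto simp: nx_append)
qed

lemma phi_2:
  assumes "d \<in> D2"
  shows "\<phi> d = fA d"
proof -
  have "d \<noteq> r" "d \<noteq> r'" "d \<notin> set u1" using assms r u disj by auto
  then show ?thesis
    using \<tau>(2)[of d] assms unfolding face_perm_def by (auto simp: nx_append nx_other)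
qed

lemma fA_r: "fA r = \<phi> r'"
proof -
  have "fA r = hd (u2 @ [r])" unfolding face_perm_def by simp
  then show ?thesis using phi_r(2) by simp
qed

lemma fB_r: "fB r' = \<phi> r"
proof -
  have "fB r' = hd (u1 @ [r'])" unfolding face_perm_def by simp
  then show ?thesis using phi_r(1) by simp
qed

lemma fA_bij: "bij_betw fA A A"
proof (rule face_perm_bij)
  have "insert r D2 - set (r # u2) = D2 - set u2" using r by auto
  then show "\<tau>2 permutes A - set (r # u2)" using t(2) unfolding tri_def by simp
qed (use fin u r in auto)

lemma fB_bij: "bij_betw fB B B"
proof (rule face_perm_bij)
  have "insert r' D1 - set (r' # u1) = D1 - set u1" using r by auto
  then show "\<tau>1 permutes B - set (r' # u1)" using t(1) unfolding tri_def by simp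
qed (use fin u r in auto)

lemma a_fixed: "a2 r = r" "a1 r' = r'" using is_invD(4)[OF inv(2) r(2)] is_invD(4)[OF inv(1) r(3)] .

lemmas a1_in = is_invD(1)[OF inv(1)] and a2_in = is_invD(1)[OF inv(2)]

text \<open>Since a exchanges r and r', the map \<open>\<phi> \<circ> a\<close> sends r to the
  successor of r', which is \<open>fA r\<close>; likewise r' goes to \<open>fB r'\<close>. So the
  vertex rotation is the disjoint union of those of the two pieces with their pendant darts.\<close>

lemma ncyc_sum: "ncyc (\<phi> \<circ> a) (A \<union> B) = ncyc (fA \<circ> a2) A + ncyc (fB \<circ> a1) B"
proof -
  have A: "(fA \<circ> a2) ` A \<subseteq> A"
  proof
    fix z assume "z \<in> (fA \<circ> a2) ` A"
    then obtain d where d: "d \<in> A" "z = fA (a2 d)" by auto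
    have "a2 d \<in> A" using d(1) a_fixed(1) a2_in by auto
    then show "z \<in> A" using d(2) fA_bij by (auto simp: bij_betw_def)
  qed
  have B: "(fB \<circ> a1) ` B \<subseteq> B"
  proof
    fix z assume "z \<in> (fB \<circ> a1) ` B"
    then obtain d where d: "d \<in> B" "z = fB (a1 d)" by auto
    have "a1 d \<in> B" using d(1) a_fixed(2) a1_in by auto
    then show "z \<in> B" using d(2) fB_bij by (auto simp: bij_betw_def)
  qed
  have eA: "(\<phi> \<circ> a) d = (fA \<circ> a2) d" if "d \<in> A" for d
    using that a a_fixed(1) fA_r phi_2 a2_in by (cases "d = r") auto
  have eB: "(\<phi> \<circ> a) d = (fB \<circ> a1) d" if "d \<in> B" for d
    using that a a_fixed(2) fB_r phi_1 a1_in by (cases "d = r'") auto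
  have "ncyc (\<phi> \<circ> a) (A \<union> B) = ncyc (\<phi> \<circ> a) A + ncyc (\<phi> \<circ> a) B"
  proof (rule ncyc_Un)
    show "(\<phi> \<circ> a) ` A \<subseteq> A" using A eA by (metis (no_types, lifting) image_cong)
    show "(\<phi> \<circ> a) ` B \<subseteq> B" using B eB by (metis (no_types, lifting) image_cong)
  qed (use fin r disj in auto)
  also have "ncyc (\<phi> \<circ> a) A = ncyc (fA \<circ> a2) A" by (rule ncyc_cong[OF A eA])
  also have "ncyc (\<phi> \<circ> a) B = ncyc (fB \<circ> a1) B" by (rule ncyc_cong[OF B eB])
  finally show ?thesis .
qed

lemma conn_glue:
  assumes "conn A fA a2" "conn B fB a1"
  shows "conn (A \<union> B) \<phi> a"
  unfolding conn_def
proof (intro allI impI)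
  fix X assume h: "X \<subseteq> A \<union> B" "X \<noteq> {}" "\<phi> ` X \<subseteq> X" "a ` X \<subseteq> X"
  have cl: "\<phi> d \<in> X" "a d \<in> X" if "d \<in> X" for d using h(3,4) that by blast+
  have rr: "r \<in> X \<longleftrightarrow> r' \<in> X" using cl(2)[of r] cl(2)[of r'] a(1,2) by auto
  have XA: "X \<inter> A = {} \<or> X \<inter> A = A"
  proof -
    have "fA d \<in> X \<inter> A" if "d \<in> X \<inter> A" for d
    proof -
      have "fA d \<in> A" using that fA_bij by (auto simp: bij_betw_def)
      moreover have "fA d \<in> X"
        using that cl(1)[of d] cl(1)[of r'] phi_2[of d] fA_r rr by (cases "d = r") auto
      ultimately show ?thesis by blast
    qed
    moreover have "a2 d \<in> X \<inter> A" if "d \<in> X \<inter> A" for d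
      using that cl(2)[of d] a(4)[of d] a_fixed(1) a2_in[of d] by (cases "d = r") auto
    ultimately have "fA ` (X \<inter> A) \<subseteq> X \<inter> A" "a2 ` (X \<inter> A) \<subseteq> X \<inter> A" by blast+
    then show ?thesis using assms(1) unfolding conn_def by (metis inf_le2)
  qed
  have XB: "X \<inter> B = {} \<or> X \<inter> B = B"
  proof -
    have "fB d \<in> X \<inter> B" if "d \<in> X \<inter> B" for d
    proof -
      have "fB d \<in> B" using that fB_bij by (auto simp: bij_betw_def)
      moreover have "fB d \<in> X"
        using that cl(1)[of d] cl(1)[of r] phi_1[of d] fB_r rr by (cases "d = r'") auto
      ultimately show ?thesis by blast
    qed
    moreover have "a1 d \<in> X \<inter> B" if "d \<in> X \<inter> B" for d
      using that cl(2)[of d] a(3)[of d] a_fixed(2) a1_in[of d] by (cases "d = r'") auto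
    ultimately have "fB ` (X \<inter> B) \<subseteq> X \<inter> B" "a1 ` (X \<inter> B) \<subseteq> X \<inter> B" by blast+
    then show ?thesis using assms(2) unfolding conn_def by (metis inf_le2)
  qed
  show "X = A \<union> B" using XA XB rr h(1,2) by blast
qed

lemma face_1:
  assumes "d \<in> D1"
  shows "\<phi> d = r' \<and> face_perm u1 \<tau>1 d = hd u1 \<and> u1 \<noteq> [] \<or> \<phi> d \<in> D1 \<and> \<phi> d = face_perm u1 \<tau>1 d"
proof (cases "d \<in> set u1")
  case True
  have n: "r' \<notin> set u1" using r u by auto
  have "fB d = nx u1 r' d" "face_perm u1 \<tau>1 d = nx u1 (hd u1) d" "u1 \<noteq> []"
    using True n unfolding face_perm_def by auto
  then show ?thesis
    using nx_change_end[OF n True, of "hd u1"] u phi_1[OF assms] by auto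
next
  case False
  have "d \<noteq> r'" using assms r by auto
  then have "fB d = \<tau>1 d" "face_perm u1 \<tau>1 d = \<tau>1 d" using False unfolding face_perm_def by auto
  moreover have "\<tau>1 d \<in> D1" using triD(1)[OF t(1), of d] assms False by auto
  ultimately show ?thesis using phi_1[OF assms] by auto
qed

lemma face_2:
  assumes "d \<in> D2"
  shows "\<phi> d = r \<and> face_perm u2 \<tau>2 d = hd u2 \<and> u2 \<noteq> [] \<or> \<phi> d \<in> D2 \<and> \<phi> d = face_perm u2 \<tau>2 d"
proof (cases "d \<in> set u2")
  case True
  have n: "r \<notin> set u2" using r u by auto
  have "fA d = nx u2 r d" "face_perm u2 \<tau>2 d = nx u2 (hd u2) d" "u2 \<noteq> []"
    using True n unfolding face_perm_def by auto
  then show ?thesis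
    using nx_change_end[OF n True, of "hd u2"] u phi_2[OF assms] by auto
next
  case False
  have "d \<noteq> r" using assms r by auto
  then have "fA d = \<tau>2 d" "face_perm u2 \<tau>2 d = \<tau>2 d" using False unfolding face_perm_def by auto
  moreover have "\<tau>2 d \<in> D2" using triD(1)[OF t(2), of d] assms False by auto
  ultimately show ?thesis using phi_2[OF assms] by auto
qed

end

text \<open>The new edge leads from the root vertex of the second piece, coloured k, to that of the
  first, coloured k'. An empty piece has no dart to carry its colour, so k or k' supplies
  it.\<close>

lemma bridge_bwd:
  assumes p1: "pmap D1 u1 \<tau>1 a1 c1" and p2: "pmap D2 u2 \<tau>2 a2 c2"
    and disj: "D1 \<inter> D2 = {}" and r: "r \<notin> D1" "r \<notin> D2" "r' \<notin> D1" "r' \<notin> D2" "r \<noteq> r'"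
    and k: "k < 3" "k' < 3" "k \<noteq> k'" "u1 \<noteq> [] \<longrightarrow> c1 (hd u1) = k'" "u2 \<noteq> [] \<longrightarrow> c2 (hd u2) = k"
  shows "pmap (insert r D2 \<union> insert r' D1) (r # u1 @ r' # u2) (\<lambda>d. if d \<in> D1 then \<tau>1 d else \<tau>2 d)
    (\<lambda>d. if d = r then r' else if d = r' then r else if d \<in> D1 then a1 d else a2 d)
    (\<lambda>d. if d = r then k else if d = r' then k' else if d \<in> D1 then c1 d else c2 d)"
    (is "pmap ?D ?l ?\<tau> ?a ?c")
proof -
  note P1 = pmapD[OF p1] and P2 = pmapD[OF p2]
  have D1n: "d \<noteq> r" "d \<noteq> r'" "d \<notin> D2" if "d \<in> D1" for d using that r disj by auto
  have D2n: "d \<noteq> r" "d \<noteq> r'" "d \<notin> D1" if "d \<in> D2" for d using that r disj by auto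
  interpret b: bridge D1 D2 r r' u1 u2 ?\<tau> \<tau>1 \<tau>2 ?a a1 a2
    by unfold_locales (use P1 P2 disj r D1n D2n in auto)
  have "conn b.A b.fA a2 \<and> 6 * ncyc (b.fA \<circ> a2) b.A = card D2 + 2 * length u2 + 6"
    using leaf_iff[OF P2(1) r(2) P2(2,3,5,6)] P2(4,7,8) by blast
  moreover have "conn b.B b.fB a1 \<and> 6 * ncyc (b.fB \<circ> a1) b.B = card D1 + 2 * length u1 + 6"
    using leaf_iff[OF P1(1) r(3) P1(2,3,5,6)] P1(4,7,8) by blast
  moreover have "card ?D = card D1 + card D2 + 2"
    using P1(1) P2(1) r disj by (simp add: card_Un_disjoint Un_commute)
  ultimately have cn: "conn ?D b.\<phi> ?a" and euler: "6 * ncyc (b.\<phi> \<circ> ?a) ?D = card ?D + 2 * length ?l + 6"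
    using b.conn_glue b.ncyc_sum by auto
  have t: "tri (?D - set ?l) ?\<tau>"
  proof (rule triI)
    fix d assume "d \<in> ?D - set ?l"
    then consider "d \<in> D1 - set u1" | "d \<in> D2 - set u2" by auto
    then show "?\<tau> d \<in> ?D - set ?l \<and> ?\<tau> d \<noteq> d \<and> ?\<tau> (?\<tau> (?\<tau> d)) = d"
    proof cases
      case 1
      have i: "\<tau>1 d \<in> D1 - set u1" "\<tau>1 (\<tau>1 d) \<in> D1 - set u1"
        using triD(1)[OF P1(5)] 1 by blast+
      have "\<tau>1 d \<notin> set ?l" using i(1) D1n[of "\<tau>1 d"] P2(3) by auto
      then show ?thesis using i 1 triD(2,3)[OF P1(5) 1] by simp
    next
      case 2
      have i: "\<tau>2 d \<in> D2 - set u2" "\<tau>2 (\<tau>2 d) \<in> D2 - set u2"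
        using triD(1)[OF P2(5)] 2 by blast+
      have "d \<notin> D1" "\<tau>2 d \<notin> D1" "\<tau>2 (\<tau>2 d) \<notin> D1" using i 2 D2n by blast+
      moreover have "\<tau>2 d \<notin> set ?l" using i(1) D2n[of "\<tau>2 d"] P1(3) by auto
      ultimately show ?thesis using i triD(2,3)[OF P2(5) 2] by simp
    qed
  next
    fix d assume d: "d \<notin> ?D - set ?l"
    have "d \<notin> D1 - set u1" using d D1n[of d] P2(3) by auto
    moreover have "d \<notin> D2 - set u2" using d D2n[of d] P1(3) by auto
    ultimately show "?\<tau> d = d" using triD(4)[OF P1(5), of d] triD(4)[OF P2(5), of d] by simp
  qed
  have inv: "is_inv ?D ?a"
  proof (rule is_invI)
    fix d assume "d \<in> ?D"
    then consider "d = r" | "d = r'" | "d \<in> D1" | "d \<in> D2" by auto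
    then show "?a d \<in> ?D \<and> ?a d \<noteq> d \<and> ?a (?a d) = d"
    proof cases
      case 3
      then show ?thesis
        using D1n[OF 3] is_invD(1-3)[OF P1(6) 3] D1n[OF is_invD(1)[OF P1(6) 3]] by simp
    next
      case 4
      then show ?thesis
        using D2n[OF 4] is_invD(1-3)[OF P2(6) 4] D2n[OF is_invD(1)[OF P2(6) 4]] by simp
    qed (use r in auto)
  next
    fix d assume "d \<notin> ?D"
    then show "?a d = d" using is_invD(4)[OF P2(6), of d] by simp
  qed
  note C1 = colouredD[OF P1(9)] and C2 = colouredD[OF P2(9)]
  define C where "C = ?c"
  define e where "e = ?a"
  have Cv: "C r = k" "C r' = k'" "\<And>d. d \<in> D1 \<Longrightarrow> C d = c1 d" "\<And>d. d \<in> D2 \<Longrightarrow> C d = c2 d"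
    unfolding C_def using r D1n D2n by auto
  have ev: "e r = r'" "e r' = r" "\<And>d. d \<in> D1 \<Longrightarrow> e d = a1 d" "\<And>d. d \<in> D2 \<Longrightarrow> e d = a2 d"
    unfolding e_def using r D1n D2n by auto
  have col: "coloured ?D b.\<phi> ?a ?c"
    unfolding coloured_def
  proof (intro conjI ballI)
    show "?c \<in> ?D \<rightarrow>\<^sub>E {0..<3}"
    proof (rule PiE_I)
      fix d assume "d \<in> ?D"
      then show "?c d \<in> {0..<3}" using k C1(2)[of d] C2(2)[of d] by auto
    next
      fix d assume "d \<notin> ?D"
      then show "?c d = undefined" using PiE_arb[OF C2(1), of d] by simp
    qed
    fix d assume "d \<in> ?D"
    then consider "d = r" | "d = r'" | "d \<in> D1" | "d \<in> D2" by auto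
    then have "C (b.\<phi> d) = C (e d) \<and> C (e d) \<noteq> C d"
    proof cases
      case 1
      have "C (b.\<phi> r) = k'"
      proof (cases "u1 = []")
        case False
        then have "hd u1 \<in> D1" using P1(3) by auto
        then show ?thesis using False k b.phi_r Cv(3) by (simp add: hd_append)
      qed (use b.phi_r Cv in simp)
      then show ?thesis using 1 Cv(1,2) ev(1) k by simp
    next
      case 2
      have "C (b.\<phi> r') = k"
      proof (cases "u2 = []")
        case False
        then have "hd u2 \<in> D2" using P2(3) by auto
        then show ?thesis using False k b.phi_r Cv(4) by (simp add: hd_append)
      qed (use b.phi_r Cv in simp)
      then show ?thesis using 2 Cv(1,2) ev(2) k by simp
    next
      case 3
      have ad: "a1 d \<in> D1" using is_invD(1)[OF P1(6) 3] .
      have "C (b.\<phi> d) = c1 (face_perm u1 \<tau>1 d)"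
        using b.face_1[OF 3] Cv(2,3) k by metis
      then show ?thesis using C1(3,4)[OF 3] Cv(3)[OF 3] Cv(3)[OF ad] ev(3)[OF 3] by simp
    next
      case 4
      have ad: "a2 d \<in> D2" using is_invD(1)[OF P2(6) 4] .
      have "C (b.\<phi> d) = c2 (face_perm u2 \<tau>2 d)"
        using b.face_2[OF 4] Cv(1,4) k by metis
      then show ?thesis using C2(3,4)[OF 4] Cv(4)[OF 4] Cv(4)[OF ad] ev(4)[OF 4] by simp
    qed
    then show "?c (b.\<phi> d) = ?c (?a d)" "?c (?a d) \<noteq> ?c d" unfolding C_def e_def by blast+
  qed
  have "r \<notin> set u1" "r \<notin> set u2" "r' \<notin> set u1" "r' \<notin> set u2" "set u1 \<inter> set u2 = {}"
    using P1(3) P2(3) r disj by auto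
  then have dist: "distinct ?l" using P1(2) P2(2) r by simp
  show ?thesis
    unfolding pmap_def
  proof (intro conjI)
    show "finite ?D" using P1(1) P2(1) by simp
    show "set ?l \<subseteq> ?D" using P1(3) P2(3) by auto
    show "?D = {} \<or> 6 * ncyc (b.\<phi> \<circ> ?a) ?D = card ?D + 2 * length ?l + 6" using euler by blast
    show "?D = {} \<or> ?l \<noteq> []" by simp
  qed (fact dist t inv cn col)+
qed

text \<open>In a planar map an edge with the same face on both sides is a bridge. Composing both the
  face permutation and the involution with the transposition of r and r' splits the outer face,
  unglues the edge and leaves the vertex rotation unchanged, so the genus inequality can be applied
  to the cut map and then to its two pieces.\<close>

lemma bridge_fwd:
  assumes pm: "pmap D (r # u1 @ r' # u2) \<tau> a c" and ar: "a r = r'"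
  obtains D1 D2 where "D = insert r D2 \<union> insert r' D1" "D1 \<inter> D2 = {}"
    "r \<notin> D1" "r \<notin> D2" "r' \<notin> D1" "r' \<notin> D2"
    "pmap D1 u1 (\<lambda>d. if d \<in> D1 - set u1 then \<tau> d else d) (\<lambda>d. if d \<in> D1 then a d else d) (restrict c D1)"
    "pmap D2 u2 (\<lambda>d. if d \<in> D2 - set u2 then \<tau> d else d) (\<lambda>d. if d \<in> D2 then a d else d) (restrict c D2)"
proof -
  let ?l = "r # u1 @ r' # u2"
  note P = pmapD[OF pm]
  define f where "f = face_perm ?l \<tau>"
  define g where "g = f \<circ> transpose r r'"
  define b where "b = a \<circ> transpose r r'"
  have dist: "r \<noteq> r'" "r \<notin> set u1" "r \<notin> set u2" "r' \<notin> set u1" "r' \<notin> set u2"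
    "distinct u1" "distinct u2" "set u1 \<inter> set u2 = {}" using P(2) by auto
  have lD: "r \<in> D" "r' \<in> D" "set u1 \<subseteq> D" "set u2 \<subseteq> D" using P(3) by auto
  have ar': "a r' = r" using is_invD(3)[OF P(6) lD(1)] ar by simp
  have fb: "bij_betw f D D" using P(10) unfolding f_def .
  have gb: "bij_betw g D D" unfolding g_def by (rule transpose_bij_betw[OF fb lD(1,2)])
  have bb: "bij_betw b D D" unfolding b_def by (rule transpose_bij_betw[OF is_inv_bij[OF P(6)] lD(1,2)])
  have go: "g d = f d" if "d \<noteq> r" "d \<noteq> r'" for d using that unfolding g_def by simp
  have bo: "b d = a d" if "d \<noteq> r" "d \<noteq> r'" for d using that unfolding b_def by simp
  have gr: "g r = f r'" "g r' = f r" unfolding g_def by simp_all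
  have br: "b r = r" "b r' = r'" unfolding b_def using ar ar' by simp_all
  have fr: "f r = hd (u1 @ [r'])" "f r' = hd (u2 @ [r])"
    using dist unfolding f_def face_perm_def by (auto simp: nx_append hd_append)
  have f1: "f d = nx u1 r' d" if "d \<in> set u1" for d
    using that dist unfolding f_def face_perm_def by (auto simp: nx_append)
  have f2: "f d = nx u2 r d" if "d \<in> set u2" for d
    using that dist unfolding f_def face_perm_def by (auto simp: nx_append nx_other)
  have f3: "f d = \<tau> d" if "d \<notin> set ?l" for d
    using that unfolding f_def face_perm_def by simp
  have gA: "g d = nx (r # u2) r d" if "d \<in> set (r # u2)" for d
  proof (cases "d = r")
    case False
    then have "d \<in> set u2" "d \<noteq> r'" using that dist by auto
    then show ?thesis using go f2 False by simp
  qed (use gr fr in simp)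
  have gB: "g d = nx (r' # u1) r' d" if "d \<in> set (r' # u1)" for d
  proof (cases "d = r'")
    case False
    then have "d \<in> set u1" "d \<noteq> r" using that dist by auto
    then show ?thesis using go f1 False by simp
  qed (use gr fr in simp)
  have aD: "a d \<in> D" "a (a d) = d" "a d \<noteq> d" if "d \<in> D" for d using is_invD[OF P(6)] that by blast+
  have an: "a d \<noteq> r" "a d \<noteq> r'" if "d \<in> D" "d \<noteq> r" "d \<noteq> r'" for d
    using aD(2)[OF that(1)] that ar ar' by auto
  have bbd: "b (b d) = d" if "d \<in> D" for d
    using br bo[of d] bo[of "a d"] an[OF that] aD(2)[OF that] by (cases "d = r"; cases "d = r'") auto
  have gbfa: "(g \<circ> b) d = (f \<circ> a) d" if "d \<in> D" for d
  proof -
    consider "d = r" | "d = r'" | "d \<noteq> r" "d \<noteq> r'" by blast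
    then show ?thesis
    proof cases
      case 3
      then show ?thesis using bo[OF 3] go[OF an[OF that 3]] by simp
    qed (use br gr ar ar' in simp_all)
  qed
  have fD: "f ` D \<subseteq> D" using fb by (auto simp: bij_betw_def)
  have faD: "(f \<circ> a) ` D \<subseteq> D" using fD aD(1) by auto
  have cyc: "ncyc (g \<circ> b) D = ncyc (f \<circ> a) D" by (rule ncyc_cong[OF faD gbfa])
  have euler: "6 * ncyc (f \<circ> a) D = card D + 2 * length ?l + 6" using P(8) lD unfolding f_def by blast
  have len: "length ?l = length u1 + length u2 + 2" by simp
  have cg: "conn D g a"
    unfolding conn_def
  proof (intro allI impI)
    fix X assume h: "X \<subseteq> D" "X \<noteq> {}" "g ` X \<subseteq> X" "a ` X \<subseteq> X"
    have cl: "g d \<in> X" "a d \<in> X" if "d \<in> X" for d using h(3,4) that by blast+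
    have "f d \<in> X" if "d \<in> X" for d
    proof -
      consider "d = r" | "d = r'" | "d \<noteq> r" "d \<noteq> r'" by blast
      then show ?thesis
      proof cases
        case 1
        then show ?thesis using cl(1)[of r'] cl(2)[of r] that ar gr by simp
      next
        case 2
        then show ?thesis using cl(1)[of r] cl(2)[of r'] that ar' gr by simp
      next
        case 3
        then show ?thesis using cl(1)[OF that] go by simp
      qed
    qed
    then have "f ` X \<subseteq> X" by blast
    then show "X = D" using P(7) h unfolding conn_def f_def by blast
  qed
  \<comment> \<open>With v + f = e + 2 before the cut, the cut map has v + f + 1 = e + 3 cycles in
    total. If it were connected, the genus inequality with e - 1 edges would allow only e +
    1.\<close>
  have nc: "\<not> conn D g b"
  proof
    assume c: "conn D g b"
    let ?E = "set (r # u2)"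
    have dE: "distinct (r # u2)" "distinct (r' # u1)" using dist by auto
    have ED: "?E \<subseteq> D" using lD by auto
    have gE: "g ` ?E \<subseteq> ?E"
    proof (rule image_subsetI)
      fix d assume d: "d \<in> ?E"
      show "g d \<in> ?E" using nx_in[OF d, of r] gA[OF d] by auto
    qed
    have gF: "g ` (D - ?E) \<subseteq> D - ?E" by (rule inv_set_compl[OF P(1) gb ED gE])
    have "ncyc g (?E \<union> (D - ?E)) = ncyc g ?E + ncyc g (D - ?E)"
      by (rule ncyc_Un) (use P(1) gE gF in auto)
    moreover have "?E \<union> (D - ?E) = D" using ED by blast
    moreover have "ncyc (face_perm (r # u2) id) ?E = ncyc g ?E"
      by (rule ncyc_cong[OF gE]) (use gA in \<open>simp add: face_perm_def\<close>)
    moreover have "3 * ncyc (face_perm (r # u2) id) ?E + length (r # u2) = card ?E + 3"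
      by (rule ncyc_face) (use dE in \<open>auto simp: tri_def permutes_id\<close>)
    moreover have "ncyc (face_perm (r' # u1) \<tau>) (D - ?E) = ncyc g (D - ?E)"
    proof (rule ncyc_cong[OF gF])
      fix d assume d: "d \<in> D - ?E"
      show "face_perm (r' # u1) \<tau> d = g d"
      proof (cases "d \<in> set (r' # u1)")
        case True
        then show ?thesis using gB[OF True] unfolding face_perm_def by simp
      next
        case False
        then have "d \<notin> set ?l" "d \<noteq> r" "d \<noteq> r'" using d by auto
        then show ?thesis using f3 go False unfolding face_perm_def by simp
      qed
    qed
    moreover have "3 * ncyc (face_perm (r' # u1) \<tau>) (D - ?E) + length (r' # u1) = card (D - ?E) + 3"
    proof (rule ncyc_face)
      have "D - ?E - set (r' # u1) = D - set ?l" by auto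
      then show "tri (D - ?E - set (r' # u1)) \<tau>" using P(5) by simp
    qed (use P(1) dE lD dist in auto)
    moreover have cE: "card ?E = length (r # u2)" using dE(1) by (rule distinct_card)
    moreover have "card D = card ?E + card (D - ?E)"
      using card_Un_disjoint[of ?E "D - ?E"] P(1) \<open>?E \<union> (D - ?E) = D\<close> by simp
    moreover have "2 * (ncyc g D + ncyc (g \<circ> b) D) \<le> card {d \<in> D. b d \<noteq> d} + 4"
      by (rule genus_inequality[OF P(1) gb bb bbd c])
    moreover have "card {d \<in> D. b d \<noteq> d} + 2 \<le> card D"
    proof -
      have "{d \<in> D. b d \<noteq> d} \<subseteq> D - {r, r'}" using br by auto
      then have "card {d \<in> D. b d \<noteq> d} \<le> card (D - {r, r'})" using P(1) by (intro card_mono) auto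
      moreover have "card D = card (D - {r, r'}) + card {r, r'}"
        using P(1) lD by (metis card_Diff_subset card_mono empty_subsetI finite.emptyI finite.insertI insert_subset le_add_diff_inverse2)
      moreover have "card {r, r'} = 2" using dist(1) by simp
      ultimately show ?thesis by simp
    qed
    ultimately show False using cyc euler len by simp
  qed
  obtain A B where AB: "A \<union> B = D" "A \<inter> B = {}" "r \<in> A" "r' \<in> B"
    "g ` A \<subseteq> A" "g ` B \<subseteq> B" "b ` A \<subseteq> A" "b ` B \<subseteq> B" "conn A g b" "conn B g b"
    by (rule disconnected_split[OF P(1) gb bb nc cg lD(1,2) ar ar' dist(1)]) (use bo in auto)
  have uA: "set (r # u2) \<subseteq> A"
  proof (rule nx_closed)
    show "hd ((r # u2) @ [r]) \<in> A" using AB(3) by simp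
    show "nx (r # u2) r d \<in> A" if "d \<in> A" "d \<in> set (r # u2)" for d
      using gA[OF that(2)] AB(5) that(1) by (metis image_subset_iff)
  qed (use dist in auto)
  have uB: "set (r' # u1) \<subseteq> B"
  proof (rule nx_closed)
    show "hd ((r' # u1) @ [r']) \<in> B" using AB(4) by simp
    show "nx (r' # u1) r' d \<in> B" if "d \<in> B" "d \<in> set (r' # u1)" for d
      using gB[OF that(2)] AB(6) that(1) by (metis image_subset_iff)
  qed (use dist in auto)
  define D1 D2 where "D1 = B - {r'}" and "D2 = A - {r}"
  have A: "insert r D2 = A" and B: "insert r' D1 = B" using AB(3,4) unfolding D1_def D2_def by auto
  have n: "r \<notin> D1" "r \<notin> D2" "r' \<notin> D1" "r' \<notin> D2" "D1 \<inter> D2 = {}" using AB(2,3,4) unfolding D1_def D2_def by auto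
  have fin: "finite D1" "finite D2" using P(1) AB(1) unfolding D1_def D2_def by (auto intro: finite_subset)
  have uu: "set u1 \<subseteq> D1" "set u2 \<subseteq> D2" using uA uB dist unfolding D1_def D2_def by auto
  have sub: "D1 \<subseteq> D" "D2 \<subseteq> D" using AB(1) unfolding D1_def D2_def by auto
  have trid: "tri (X - {x} - set u) (\<lambda>d. if d \<in> X - {x} - set u then \<tau> d else d)"
    if X: "X \<subseteq> D" "g ` X \<subseteq> X" "X - {x} - set u \<subseteq> D - set ?l" "set (x # u) \<subseteq> set ?l" for X x u
  proof (rule triI)
    fix d assume d: "d \<in> X - {x} - set u"
    have cl: "\<tau> e \<in> X - {x} - set u" if e: "e \<in> X - {x} - set u" for e
    proof -
      have eD: "e \<in> D - set ?l" using e X(3) by blast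
      have "g e = \<tau> e" using eD go f3 by auto
      then have "\<tau> e \<in> X" using e X(2) by (metis DiffD1 image_subset_iff)
      moreover have "\<tau> e \<in> D - set ?l" using triD(1)[OF P(5) eD] .
      ultimately show ?thesis using X(4) by auto
    qed
    have dD: "d \<in> D - set ?l" using d X(3) by blast
    show "(if d \<in> X - {x} - set u then \<tau> d else d) \<in> X - {x} - set u \<and>
      (if d \<in> X - {x} - set u then \<tau> d else d) \<noteq> d \<and>
      (if (if (if d \<in> X - {x} - set u then \<tau> d else d) \<in> X - {x} - set u
              then \<tau> (if d \<in> X - {x} - set u then \<tau> d else d)
              else (if d \<in> X - {x} - set u then \<tau> d else d)) \<in> X - {x} - set u
       then \<tau> (if (if d \<in> X - {x} - set u then \<tau> d else d) \<in> X - {x} - set u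
              then \<tau> (if d \<in> X - {x} - set u then \<tau> d else d)
              else (if d \<in> X - {x} - set u then \<tau> d else d))
       else (if (if d \<in> X - {x} - set u then \<tau> d else d) \<in> X - {x} - set u
              then \<tau> (if d \<in> X - {x} - set u then \<tau> d else d)
              else (if d \<in> X - {x} - set u then \<tau> d else d))) = d"
      using d cl[OF d] cl[OF cl[OF d]] triD(2,3)[OF P(5) dD] by (simp only: if_True simp_thms)
  qed auto
  have l1: "D1 - set u1 \<subseteq> D - set ?l" "D2 - set u2 \<subseteq> D - set ?l"
    using uA uB AB(1,2) unfolding D1_def D2_def by auto
  let ?\<tau>1 = "\<lambda>d. if d \<in> D1 - set u1 then \<tau> d else d" and ?\<tau>2 = "\<lambda>d. if d \<in> D2 - set u2 then \<tau> d else d"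
  let ?a1 = "\<lambda>d. if d \<in> D1 then a d else d" and ?a2 = "\<lambda>d. if d \<in> D2 then a d else d"
  have t1: "tri (D1 - set u1) ?\<tau>1"
    using trid[of B r' u1] AB(1,6) l1(1) unfolding D1_def by auto
  have t2: "tri (D2 - set u2) ?\<tau>2"
    using trid[of A r u2] AB(1,5) l1(2) unfolding D2_def by auto
  have a1D: "a d \<in> D1" if d: "d \<in> D1" for d
  proof -
    have dd: "d \<in> D" "d \<noteq> r" "d \<noteq> r'" using d sub n by auto
    have "a d \<in> B" using bo[OF dd(2,3)] AB(8) d unfolding D1_def by (metis DiffD1 image_subset_iff)
    then show ?thesis using an[OF dd] unfolding D1_def by blast
  qed
  have a2D: "a d \<in> D2" if d: "d \<in> D2" for d
  proof -
    have dd: "d \<in> D" "d \<noteq> r" "d \<noteq> r'" using d sub n by auto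
    have "a d \<in> A" using bo[OF dd(2,3)] AB(7) d unfolding D2_def by (metis DiffD1 image_subset_iff)
    then show ?thesis using an[OF dd] unfolding D2_def by blast
  qed
  have i1: "is_inv D1 ?a1" by (rule is_invI) (use a1D aD sub in auto)
  have i2: "is_inv D2 ?a2" by (rule is_invI) (use a2D aD sub in auto)
  interpret b: bridge D1 D2 r r' u1 u2 \<tau> ?\<tau>1 ?\<tau>2 a ?a1 ?a2
    by unfold_locales (fact fin n dist uu t1 t2 i1 i2 ar ar' | simp)+
  have gfA: "g d = b.fA d" if "d \<in> A" for d
  proof (cases "d = r")
    case True
    then show ?thesis using gr b.fA_r unfolding f_def by simp
  next
    case False
    then have "d \<in> D2" "d \<noteq> r'" using that n A by auto
    then show ?thesis using go[OF False] b.phi_2 unfolding f_def by simp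
  qed
  have gfB: "g d = b.fB d" if "d \<in> B" for d
  proof (cases "d = r'")
    case True
    then show ?thesis using gr b.fB_r unfolding f_def by simp
  next
    case False
    then have "d \<in> D1" "d \<noteq> r" using that n B by auto
    then show ?thesis using go[OF _ False] b.phi_1 unfolding f_def by simp
  qed
  have bA: "b d = ?a2 d" if "d \<in> A" for d
    using that br bo[of d] n A by (cases "d = r") auto
  have bB: "b d = ?a1 d" if "d \<in> B" for d
    using that br bo[of d] n B by (cases "d = r'") auto
  have cA: "conn A b.fA ?a2" using AB(9) conn_cong[OF gfA bA] by simp
  have cB: "conn B b.fB ?a1" using AB(10) conn_cong[OF gfB bB] by simp
  \<comment> \<open>For a piece, Euler's formula is at first only an upper bound on the number of
    vertices. The two bounds add up to the Euler equation of the whole map, so both are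
    attained.\<close>
  have bound: "6 * ncyc (face_perm (x # u) t \<circ> e) (insert x X) \<le> card X + 2 * length u + 6"
    if "finite X" "x \<notin> X" "bij_betw (face_perm (x # u) t) (insert x X) (insert x X)" "is_inv X e"
      "conn (insert x X) (face_perm (x # u) t) e" "distinct u" "set u \<subseteq> X" "tri (X - set u) t" for X x u t e
  proof -
    let ?A = "insert x X" and ?f = "face_perm (x # u) t"
    have ex: "e x = x" using is_invD(4)[OF that(4,2)] .
    have "bij_betw e X X" using that(4) by (rule is_inv_bij)
    then have eb: "bij_betw e ?A ?A"
      using ex that(2) by (metis notIn_Un_bij_betw Un_insert_right sup_bot.right_neutral)
    have ee: "e (e d) = d" if "d \<in> ?A" for d using that ex is_invD(3)[OF \<open>is_inv X e\<close>] by auto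
    have "2 * (ncyc ?f ?A + ncyc (?f \<circ> e) ?A) \<le> card {d \<in> ?A. e d \<noteq> d} + 4"
      by (rule genus_inequality[OF _ that(3) eb ee that(5)]) (use that(1) in auto)
    moreover have "card {d \<in> ?A. e d \<noteq> d} \<le> card X" using ex that(1) by (intro card_mono) auto
    moreover have "3 * ncyc ?f ?A + length (x # u) = card ?A + 3"
    proof (rule ncyc_face)
      have "?A - set (x # u) = X - set u" using that(2) by auto
      then show "tri (?A - set (x # u)) t" using that(8) by simp
    qed (use that in auto)
    moreover have "card ?A = card X + 1" using that(1,2) by simp
    ultimately show ?thesis by simp
  qed
  have bdA: "6 * ncyc (b.fA \<circ> ?a2) A \<le> card D2 + 2 * length u2 + 6"
    using bound[OF fin(2) n(2) b.fA_bij i2 _ dist(7) uu(2) t2] cA unfolding A by simp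
  have bdB: "6 * ncyc (b.fB \<circ> ?a1) B \<le> card D1 + 2 * length u1 + 6"
    using bound[OF fin(1) n(3) b.fB_bij i1 _ dist(6) uu(1) t1] cB unfolding B by simp
  have "card D = card A + card B" using card_Un_disjoint[of A B] P(1) AB(1,2) by (metis finite_Un)
  moreover have "card A = card D2 + 1" "card B = card D1 + 1" using A B fin n by (metis Suc_eq_plus1 card_insert_disjoint)+
  moreover have "ncyc (f \<circ> a) D = ncyc (b.fA \<circ> ?a2) A + ncyc (b.fB \<circ> ?a1) B"
    using b.ncyc_sum unfolding A B AB(1) f_def .
  ultimately have eq: "6 * ncyc (b.fA \<circ> ?a2) A = card D2 + 2 * length u2 + 6"
    "6 * ncyc (b.fB \<circ> ?a1) B = card D1 + 2 * length u1 + 6"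
    using bdA bdB euler len by simp_all
  note L1 = leaf_iff[OF fin(1) n(3) dist(6) uu(1) t1 i1] and L2 = leaf_iff[OF fin(2) n(2) dist(7) uu(2) t2 i2]
  have q1: "(D1 = {} \<or> u1 \<noteq> []) \<and> conn D1 (face_perm u1 ?\<tau>1) ?a1 \<and>
      (D1 = {} \<or> 6 * ncyc (face_perm u1 ?\<tau>1 \<circ> ?a1) D1 = card D1 + 2 * length u1 + 6)"
    using L1 cB eq(2) unfolding B by blast
  have q2: "(D2 = {} \<or> u2 \<noteq> []) \<and> conn D2 (face_perm u2 ?\<tau>2) ?a2 \<and>
      (D2 = {} \<or> 6 * ncyc (face_perm u2 ?\<tau>2 \<circ> ?a2) D2 = card D2 + 2 * length u2 + 6)"
    using L2 cA eq(1) unfolding A by blast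
  note C = colouredD[OF P(9), folded f_def]
  have crest: "restrict c X \<in> X \<rightarrow>\<^sub>E {0..<3}" if "X \<subseteq> D" for X using C(1) that by auto
  have bij1: "bij_betw (face_perm u1 ?\<tau>1) D1 D1"
    by (rule face_perm_bij[OF fin(1) dist(6) uu(1)]) (use t1 in \<open>simp add: tri_def\<close>)
  have bij2: "bij_betw (face_perm u2 ?\<tau>2) D2 D2"
    by (rule face_perm_bij[OF fin(2) dist(7) uu(2)]) (use t2 in \<open>simp add: tri_def\<close>)
  have col1: "coloured D1 (face_perm u1 ?\<tau>1) ?a1 (restrict c D1)"
    unfolding coloured_def
  proof (intro conjI ballI)
    show "restrict c D1 \<in> D1 \<rightarrow>\<^sub>E {0..<3}" using crest sub by blast
    fix d assume d: "d \<in> D1"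
    have dD: "d \<in> D" using d sub by blast
    show "restrict c D1 (?a1 d) \<noteq> restrict c D1 d" using d a1D[OF d] C(4)[OF dD] by simp
    have fd: "face_perm u1 ?\<tau>1 d \<in> D1" using d bij1 by (auto simp: bij_betw_def)
    have "c (face_perm u1 ?\<tau>1 d) = c (f d)"
      using b.face_1[OF d]
    proof
      assume h: "b.\<phi> d = r' \<and> face_perm u1 ?\<tau>1 d = hd u1 \<and> u1 \<noteq> []"
      then have "f r = hd u1" using fr by (simp add: hd_append)
      then have "c (hd u1) = c r'" using C(3)[OF lD(1)] ar by simp
      then show ?thesis using h unfolding f_def by simp
    next
      assume "b.\<phi> d \<in> D1 \<and> b.\<phi> d = face_perm u1 ?\<tau>1 d"
      then show ?thesis unfolding f_def by simp
    qed
    then show "restrict c D1 (face_perm u1 ?\<tau>1 d) = restrict c D1 (?a1 d)"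
      using fd d a1D[OF d] C(3)[OF dD] by simp
  qed
  have col2: "coloured D2 (face_perm u2 ?\<tau>2) ?a2 (restrict c D2)"
    unfolding coloured_def
  proof (intro conjI ballI)
    show "restrict c D2 \<in> D2 \<rightarrow>\<^sub>E {0..<3}" using crest sub by blast
    fix d assume d: "d \<in> D2"
    have dD: "d \<in> D" using d sub by blast
    show "restrict c D2 (?a2 d) \<noteq> restrict c D2 d" using d a2D[OF d] C(4)[OF dD] by simp
    have fd: "face_perm u2 ?\<tau>2 d \<in> D2" using d bij2 by (auto simp: bij_betw_def)
    have "c (face_perm u2 ?\<tau>2 d) = c (f d)"
      using b.face_2[OF d]
    proof
      assume h: "b.\<phi> d = r \<and> face_perm u2 ?\<tau>2 d = hd u2 \<and> u2 \<noteq> []"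
      then have "f r' = hd u2" using fr by (simp add: hd_append)
      then have "c (hd u2) = c r" using C(3)[OF lD(2)] ar' by simp
      then show ?thesis using h unfolding f_def by simp
    next
      assume "b.\<phi> d \<in> D2 \<and> b.\<phi> d = face_perm u2 ?\<tau>2 d"
      then show ?thesis unfolding f_def by simp
    qed
    then show "restrict c D2 (face_perm u2 ?\<tau>2 d) = restrict c D2 (?a2 d)"
      using fd d a2D[OF d] C(3)[OF dD] by simp
  qed
  show thesis
  proof (rule that)
    show "D = insert r D2 \<union> insert r' D1" unfolding A B using AB(1) by simp
    show "pmap D1 u1 ?\<tau>1 ?a1 (restrict c D1)"
      unfolding pmap_def using fin(1) dist(6) uu(1) t1 i1 q1 col1 by blast
    show "pmap D2 u2 ?\<tau>2 ?a2 (restrict c D2)"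
      unfolding pmap_def using fin(2) dist(7) uu(2) t2 i2 q2 col2 by blast
  qed (fact n)+
qed

section \<open>Counting the bridge case\<close>

lemma finite_pmaps:
  assumes "finite D"
  shows "finite (pmaps D w k)"
proof (rule finite_subset)
  show "pmaps D w k \<subseteq> {l. set l \<subseteq> D \<and> distinct l} \<times> {\<tau>. \<tau> permutes D} \<times> {a. a permutes D} \<times> (D \<rightarrow>\<^sub>E {0..<3})"
  proof
    fix z assume z: "z \<in> pmaps D w k"
    obtain l \<tau> a c where zz: "z = (l, \<tau>, a, c)" by (cases z)
    have p: "pmap D l \<tau> a c" using z unfolding zz pmaps_def by blast
    have "\<tau> permutes D - set l" "a permutes D"
      using pmapD(5,6)[OF p] unfolding tri_def is_inv_def by blast+
    then have "\<tau> permutes D" by (meson permutes_subset Diff_subset)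
    then show "z \<in> {l. set l \<subseteq> D \<and> distinct l} \<times> {\<tau>. \<tau> permutes D} \<times> {a. a permutes D} \<times> (D \<rightarrow>\<^sub>E {0..<3})"
      using pmapD(2,3)[OF p] colouredD(1)[OF pmapD(9)[OF p]] \<open>a permutes D\<close> unfolding zz by blast
  qed
  show "finite ({l. set l \<subseteq> D \<and> distinct l} \<times> {\<tau>. \<tau> permutes D} \<times> {a. a permutes D} \<times> (D \<rightarrow>\<^sub>E {0..<3::nat}))"
    using assms by (intro finite_cartesian_product finite_subset_distinct finite_permutations finite_PiE) auto
qed

definition glue :: "nat \<Rightarrow> nat \<Rightarrow> nat \<Rightarrow> nat \<Rightarrow> nat set \<Rightarrow>
    nat list \<times> (nat \<Rightarrow> nat) \<times> (nat \<Rightarrow> nat) \<times> (nat \<Rightarrow> nat) \<Rightarrow>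
    nat list \<times> (nat \<Rightarrow> nat) \<times> (nat \<Rightarrow> nat) \<times> (nat \<Rightarrow> nat) \<Rightarrow>
    nat list \<times> (nat \<Rightarrow> nat) \<times> (nat \<Rightarrow> nat) \<times> (nat \<Rightarrow> nat)" where
  "glue r r' k k' D1 = (\<lambda>(l1, \<tau>1, a1, c1) (l2, \<tau>2, a2, c2).
     (r # l1 @ r' # l2, \<lambda>d. if d \<in> D1 then \<tau>1 d else \<tau>2 d,
      \<lambda>d. if d = r then r' else if d = r' then r else if d \<in> D1 then a1 d else a2 d,
      \<lambda>d. if d = r then k else if d = r' then k' else if d \<in> D1 then c1 d else c2 d))"

definition next_colour :: "bool \<Rightarrow> nat \<Rightarrow> nat" where
  "next_colour b k = (if b then k + 1 else k + 2) mod 3"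

lemma next_colour:
  assumes "k < 3"
  shows "next_colour b k < 3" "next_colour b k \<noteq> k" "next_colour b k = (k + 1) mod 3 \<longleftrightarrow> b"
    "k = (next_colour b k + 1) mod 3 \<longleftrightarrow> \<not> b"
proof -
  have "k = 0 \<or> k = 1 \<or> k = 2" using assms by auto
  then show "next_colour b k < 3" "next_colour b k \<noteq> k" "next_colour b k = (k + 1) mod 3 \<longleftrightarrow> b"
    "k = (next_colour b k + 1) mod 3 \<longleftrightarrow> \<not> b"
    unfolding next_colour_def by (elim disjE; simp)+
qed

lemma next_colour_unique:
  assumes "k < 3" "j < 3" "j \<noteq> k" "j = (k + 1) mod 3 \<longleftrightarrow> b"
  shows "j = next_colour b k"
proof -
  have "k = 0 \<or> k = 1 \<or> k = 2" "j = 0 \<or> j = 1 \<or> j = 2" using assms(1,2) by auto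
  then show ?thesis using assms(3,4) unfolding next_colour_def by (elim disjE; simp)
qed

text \<open>The dart set of a glued piece is determined by its boundary list: two candidates have a
  nonempty intersection that is invariant in both, so connectivity makes it equal to each. This is
  the heart of the injectivity of gluing.\<close>

lemma pmap_part_unique:
  assumes p: "pmap D1 l \<tau>1 a1 c1" and q: "pmap E1 l \<nu>1 e1 b1"
    and eq: "\<And>d. d \<in> D1 \<Longrightarrow> d \<in> E1 \<Longrightarrow> \<tau>1 d = \<nu>1 d" "\<And>d. d \<in> D1 \<Longrightarrow> d \<in> E1 \<Longrightarrow> a1 d = e1 d"
  shows "D1 = E1"
proof (cases "l = []")
  case True
  then show ?thesis using pmapD(4)[OF p] pmapD(4)[OF q] by blast
next
  case False
  have ne: "D1 \<inter> E1 \<noteq> {}" using False pmapD(3)[OF p] pmapD(3)[OF q] by (cases l) auto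
  have fe: "face_perm l \<tau>1 d = face_perm l \<nu>1 d" if "d \<in> D1" "d \<in> E1" for d
    using eq(1)[OF that] unfolding face_perm_def by simp
  have fD: "face_perm l \<tau>1 d \<in> D1" "a1 d \<in> D1" if "d \<in> D1" for d
    using that pmapD(10)[OF p] is_invD(1)[OF pmapD(6)[OF p]] by (auto simp: bij_betw_def)
  have fE: "face_perm l \<nu>1 d \<in> E1" "e1 d \<in> E1" if "d \<in> E1" for d
    using that pmapD(10)[OF q] is_invD(1)[OF pmapD(6)[OF q]] by (auto simp: bij_betw_def)
  have "face_perm l \<tau>1 ` (D1 \<inter> E1) \<subseteq> D1 \<inter> E1" "a1 ` (D1 \<inter> E1) \<subseteq> D1 \<inter> E1"
    using fD fE fe eq(2) by (metis IntD1 IntD2 IntI image_subsetI)+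
  then have "D1 \<inter> E1 = D1" using pmapD(7)[OF p] ne unfolding conn_def by (metis inf_le1)
  have "face_perm l \<nu>1 ` (D1 \<inter> E1) \<subseteq> D1 \<inter> E1" "e1 ` (D1 \<inter> E1) \<subseteq> D1 \<inter> E1"
    using fD fE fe eq(2) by (metis IntD1 IntD2 IntI image_subsetI)+
  then have "D1 \<inter> E1 = E1" using pmapD(7)[OF q] ne unfolding conn_def by (metis inf_le2)
  then show ?thesis using \<open>D1 \<inter> E1 = D1\<close> by simp
qed

text \<open>The index i is the position of r' on the boundary behind r. Its letter is opposite to b
  because the bridge is traversed a second time in the other direction, and it cuts v into the
  boundary words of the two pieces.\<close>

lemma card_bridge:
  assumes D: "finite D" "r \<in> D" "r' \<in> D" "r \<noteq> r'" and k: "k < 3"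
  shows "card {(l, \<tau>, a, c). (l, \<tau>, a, c) \<in> rooted D r (b # v) k \<and> a r = r' \<and> r' \<in> set l} =
    (\<Sum>i | i < length v \<and> v ! i = (\<not> b). \<Sum>D1\<in>Pow (D - {r, r'}).
        card (pmaps D1 (take i v) (next_colour b k)) * card (pmaps (D - {r, r'} - D1) (drop (Suc i) v) k))"
    (is "card ?S = ?R")
proof -
  let ?D' = "D - {r, r'}" and ?I = "{i. i < length v \<and> v ! i = (\<not> b)}" and ?k' = "next_colour b k"
  let ?P1 = "\<lambda>i D1. pmaps D1 (take i v) ?k'" and ?P2 = "\<lambda>i D1. pmaps (?D' - D1) (drop (Suc i) v) k"
  let ?U = "SIGMA i:?I. SIGMA D1:Pow ?D'. ?P1 i D1 \<times> ?P2 i D1"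
  define G where "G = (\<lambda>(i::nat, D1, z1, z2). glue r r' k ?k' D1 z1 z2)"
  note nk = next_colour[OF k, of b]
  have finD: "finite X" if "X \<subseteq> ?D'" for X using that D(1) by (meson Diff_subset finite_subset)
  have cardU: "card ?U = ?R"
  proof -
    have fin1: "finite (?P1 i D1 \<times> ?P2 i D1)" if "D1 \<in> Pow ?D'" for i D1
      using that finD[of D1] D(1) by (auto intro!: finite_pmaps)
    have fin2: "finite (SIGMA D1:Pow ?D'. ?P1 i D1 \<times> ?P2 i D1)" for i
      by (rule finite_SigmaI[OF _ fin1]) (use D(1) in simp)
    have "finite ?I" by simp
    then have "card ?U = (\<Sum>i\<in>?I. card (SIGMA D1:Pow ?D'. ?P1 i D1 \<times> ?P2 i D1))"
      by (rule card_SigmaI) (use fin2 in blast)+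
    also have "\<dots> = (\<Sum>i\<in>?I. \<Sum>D1\<in>Pow ?D'. card (?P1 i D1 \<times> ?P2 i D1))"
    proof (rule sum.cong[OF refl], rule card_SigmaI)
      show "finite (Pow ?D')" using D(1) by simp
      show "\<forall>D1\<in>Pow ?D'. finite (?P1 i D1 \<times> ?P2 i D1)" for i using fin1 by blast
    qed
    finally show ?thesis by (simp only: card_cartesian_product)
  qed
  have elim: thesis if "z \<in> ?U" and "\<And>i D1 l1 \<tau>1 a1 c1 l2 \<tau>2 a2 c2.
       z = (i, D1, (l1, \<tau>1, a1, c1), (l2, \<tau>2, a2, c2)) \<Longrightarrow> i < length v \<Longrightarrow> v ! i = (\<not> b) \<Longrightarrow> D1 \<subseteq> ?D' \<Longrightarrow>
       pmap D1 l1 \<tau>1 a1 c1 \<Longrightarrow> pmap (?D' - D1) l2 \<tau>2 a2 c2 \<Longrightarrow> map (step c1 a1) l1 = take i v \<Longrightarrow>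
       map (step c2 a2) l2 = drop (Suc i) v \<Longrightarrow> (l1 \<noteq> [] \<longrightarrow> c1 (hd l1) = ?k') \<Longrightarrow> (l2 \<noteq> [] \<longrightarrow> c2 (hd l2) = k) \<Longrightarrow> thesis"
    for z thesis
  proof -
    obtain i D1 l1 \<tau>1 a1 c1 l2 \<tau>2 a2 c2 where z: "z = (i, D1, (l1, \<tau>1, a1, c1), (l2, \<tau>2, a2, c2))"
      by (cases z) auto
    show thesis by (rule that(2)[OF z]) (use that(1) in \<open>auto simp: z pmaps_def\<close>)
  qed
  have into: "G z \<in> ?S" if z: "z \<in> ?U" for z
  proof (rule elim[OF z])
    fix i D1 l1 \<tau>1 a1 c1 l2 \<tau>2 a2 c2
    assume zz: "z = (i, D1, (l1, \<tau>1, a1, c1), (l2, \<tau>2, a2, c2))" and i: "i < length v" "v ! i = (\<not> b)"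
      and D1: "D1 \<subseteq> ?D'" and p1: "pmap D1 l1 \<tau>1 a1 c1" and p2: "pmap (?D' - D1) l2 \<tau>2 a2 c2"
      and m1: "map (step c1 a1) l1 = take i v" and m2: "map (step c2 a2) l2 = drop (Suc i) v"
      and h1: "l1 \<noteq> [] \<longrightarrow> c1 (hd l1) = ?k'" and h2: "l2 \<noteq> [] \<longrightarrow> c2 (hd l2) = k"
    let ?D2 = "?D' - D1"
    let ?\<tau> = "\<lambda>d. if d \<in> D1 then \<tau>1 d else \<tau>2 d"
      and ?a = "\<lambda>d. if d = r then r' else if d = r' then r else if d \<in> D1 then a1 d else a2 d"
      and ?c = "\<lambda>d. if d = r then k else if d = r' then ?k' else if d \<in> D1 then c1 d else c2 d"
    have n: "D1 \<inter> ?D2 = {}" "r \<notin> D1" "r \<notin> ?D2" "r' \<notin> D1" "r' \<notin> ?D2" using D1 by auto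
    have DD: "insert r ?D2 \<union> insert r' D1 = D" using D1 D by auto
    have pm: "pmap D (r # l1 @ r' # l2) ?\<tau> ?a ?c"
      using bridge_bwd[OF p1 p2 n D(4) k nk(1) nk(2)[symmetric] h1 h2] unfolding DD .
    have s1: "step ?c ?a d = step c1 a1 d" if "d \<in> D1" for d
    proof -
      have "a1 d \<in> D1" using is_invD(1)[OF pmapD(6)[OF p1] that] .
      moreover have "d \<noteq> r" "d \<noteq> r'" "a1 d \<noteq> r" "a1 d \<noteq> r'" using that calculation n by auto
      ultimately show ?thesis using that unfolding step_def by simp
    qed
    have s2: "step ?c ?a d = step c2 a2 d" if "d \<in> ?D2" for d
    proof -
      have "a2 d \<in> ?D2" using is_invD(1)[OF pmapD(6)[OF p2] that] .
      moreover have "d \<noteq> r" "d \<noteq> r'" "a2 d \<noteq> r" "a2 d \<noteq> r'" "d \<notin> D1" "a2 d \<notin> D1" using that calculation n by auto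
      ultimately show ?thesis using that unfolding step_def by simp
    qed
    have "map (step ?c ?a) l1 = map (step c1 a1) l1"
      by (rule map_cong[OF refl s1]) (use pmapD(3)[OF p1] in blast)
    moreover have "map (step ?c ?a) l2 = map (step c2 a2) l2"
      by (rule map_cong[OF refl s2]) (use pmapD(3)[OF p2] in blast)
    moreover have "step ?c ?a r = b" "step ?c ?a r' = (\<not> b)"
      using D(4) nk unfolding step_def by auto
    moreover have "v = take i v @ (\<not> b) # drop (Suc i) v" using id_take_nth_drop[OF i(1)] i(2) by simp
    ultimately have "map (step ?c ?a) (r # l1 @ r' # l2) = b # v" using m1 m2 by simp
    then have "(r # l1 @ r' # l2, ?\<tau>, ?a, ?c) \<in> ?S"
      using pm unfolding rooted_def pmaps_def by simp
    then show "G z \<in> ?S" unfolding G_def zz glue_def by (simp only: prod.case)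
  qed
  have inj: "inj_on G ?U"
  proof (rule inj_onI)
    fix z y assume z: "z \<in> ?U" and y: "y \<in> ?U" and G: "G z = G y"
    show "z = y"
    proof (rule elim[OF z], rule elim[OF y])
      fix i D1 l1 \<tau>1 a1 c1 l2 \<tau>2 a2 c2 j E1 m1 \<nu>1 e1 b1 m2 \<nu>2 e2 b2
      assume zz: "z = (i, D1, (l1, \<tau>1, a1, c1), (l2, \<tau>2, a2, c2))"
        and yy: "y = (j, E1, (m1, \<nu>1, e1, b1), (m2, \<nu>2, e2, b2))"
        and i: "i < length v" and j: "j < length v" and D1: "D1 \<subseteq> ?D'" and E1: "E1 \<subseteq> ?D'"
        and p1: "pmap D1 l1 \<tau>1 a1 c1" and p2: "pmap (?D' - D1) l2 \<tau>2 a2 c2"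
        and q1: "pmap E1 m1 \<nu>1 e1 b1" and q2: "pmap (?D' - E1) m2 \<nu>2 e2 b2"
        and ml: "map (step c1 a1) l1 = take i v" and mm: "map (step b1 e1) m1 = take j v"
      have "r # l1 @ r' # l2 = r # m1 @ r' # m2" and
        t: "\<And>d. (if d \<in> D1 then \<tau>1 d else \<tau>2 d) = (if d \<in> E1 then \<nu>1 d else \<nu>2 d)" and
        a: "\<And>d. (if d = r then r' else if d = r' then r else if d \<in> D1 then a1 d else a2 d) =
              (if d = r then r' else if d = r' then r else if d \<in> E1 then e1 d else e2 d)" and
        c: "\<And>d. (if d = r then k else if d = r' then ?k' else if d \<in> D1 then c1 d else c2 d) =
              (if d = r then k else if d = r' then ?k' else if d \<in> E1 then b1 d else b2 d)"
        using G unfolding G_def zz yy glue_def prod.case prod.inject fun_eq_iff by blast+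
      moreover have "r' \<notin> set l1" "r' \<notin> set l2"
        using pmapD(3)[OF p1] pmapD(3)[OF p2] D1 by auto
      ultimately have l: "l1 = m1" "l2 = m2" using append_Cons_eq_iff[of r' l1 l2 m1 m2] by auto
      have n: "d \<noteq> r" "d \<noteq> r'" if "d \<in> ?D'" for d using that by simp_all
      have a': "(if d \<in> D1 then a1 d else a2 d) = (if d \<in> E1 then e1 d else e2 d)" if "d \<in> ?D'" for d
        using a[of d] n[OF that] by (simp only: if_False)
      have c': "(if d \<in> D1 then c1 d else c2 d) = (if d \<in> E1 then b1 d else b2 d)" if "d \<in> ?D'" for d
        using c[of d] n[OF that] by (simp only: if_False)
      have D1': "d \<in> ?D'" if "d \<in> D1" for d using that D1 by blast
      have DE: "D1 = E1"
      proof (rule pmap_part_unique[OF p1 q1[folded l(1)]])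
        fix d assume d: "d \<in> D1" "d \<in> E1"
        show "\<tau>1 d = \<nu>1 d" using t[of d] d by (simp only: if_True)
        show "a1 d = e1 d" using a'[OF D1'[OF d(1)]] d by (simp only: if_True)
      qed
      have "i = length l1" "j = length m1" using arg_cong[OF ml, of length] arg_cong[OF mm, of length] i j by auto
      then have ij: "i = j" using l by simp
      have "\<tau>1 d = \<nu>1 d" for d
      proof (cases "d \<in> D1")
        case True
        then show ?thesis using t[of d] DE by simp
      next
        case False
        then show ?thesis
          using triD(4)[OF pmapD(5)[OF p1], of d] triD(4)[OF pmapD(5)[OF q1], of d] DE by simp
      qed
      then have t1: "\<tau>1 = \<nu>1" by (rule ext)
      have "a1 d = e1 d" for d
      proof (cases "d \<in> D1")
        case True
        then show ?thesis using a'[OF D1'[OF True]] DE by (simp only: if_True)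
      next
        case False
        then show ?thesis
          using is_invD(4)[OF pmapD(6)[OF p1], of d] is_invD(4)[OF pmapD(6)[OF q1], of d] DE by simp
      qed
      then have a1: "a1 = e1" by (rule ext)
      have "c1 d = b1 d" for d
      proof (cases "d \<in> D1")
        case True
        then show ?thesis using c'[OF D1'[OF True]] DE by (simp only: if_True)
      next
        case False
        then show ?thesis
          using PiE_arb[OF colouredD(1)[OF pmapD(9)[OF p1]], of d]
            PiE_arb[OF colouredD(1)[OF pmapD(9)[OF q1]], of d] DE by simp
      qed
      then have c1: "c1 = b1" by (rule ext)
      have "\<tau>2 d = \<nu>2 d" for d
      proof (cases "d \<in> ?D' - D1")
        case True
        then show ?thesis using t[of d] DE by simp
      next
        case False
        have "\<tau>2 d = d" by (rule triD(4)[OF pmapD(5)[OF p2]]) (use False in blast)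
        moreover have "\<nu>2 d = d" by (rule triD(4)[OF pmapD(5)[OF q2]]) (use False DE in blast)
        ultimately show ?thesis by simp
      qed
      then have t2: "\<tau>2 = \<nu>2" by (rule ext)
      have "a2 d = e2 d" for d
      proof (cases "d \<in> ?D' - D1")
        case True
        then show ?thesis using a'[of d] DE by simp
      next
        case False
        have "a2 d = d" by (rule is_invD(4)[OF pmapD(6)[OF p2] False])
        moreover have "e2 d = d" by (rule is_invD(4)[OF pmapD(6)[OF q2]]) (use False DE in blast)
        ultimately show ?thesis by simp
      qed
      then have a2: "a2 = e2" by (rule ext)
      have "c2 d = b2 d" for d
      proof (cases "d \<in> ?D' - D1")
        case True
        then show ?thesis using c'[of d] DE by simp
      next
        case False
        have "c2 d = undefined" by (rule PiE_arb[OF colouredD(1)[OF pmapD(9)[OF p2]] False])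
        moreover have "b2 d = undefined"
          by (rule PiE_arb[OF colouredD(1)[OF pmapD(9)[OF q2]]]) (use False DE in blast)
        ultimately show ?thesis by simp
      qed
      then have c2: "c2 = b2" by (rule ext)
      show "z = y" unfolding zz yy ij DE l t1 a1 c1 t2 a2 c2 ..
    qed
  qed
  have onto: "z \<in> G ` ?U" if z: "z \<in> ?S" for z
  proof -
    obtain l \<tau> a c where zz: "z = (l, \<tau>, a, c)" by (cases z)
    have h: "pmap D l \<tau> a c" "map (step c a) l = b # v" "c (hd l) = k" "l \<noteq> []" "hd l = r" "a r = r'" "r' \<in> set l"
      using z unfolding zz rooted_def pmaps_def by auto
    obtain u where u: "l = r # u" using h(4,5) by (cases l) auto
    then have "r' \<in> set u" using h(7) D(4) by simp
    then obtain u1 u2 where u12: "u = u1 @ r' # u2" by (meson split_list)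
    have l: "l = r # u1 @ r' # u2" using u u12 by simp
    note P = pmapD[OF h(1)]
    note C = colouredD[OF P(9)]
    have dist: "distinct (r # u1 @ r' # u2)" using P(2) l by simp
    have ar': "a r' = r" using is_invD(3)[OF P(6) D(2)] h(6) by simp
    have cr: "c r = k" using h(3,5) by simp
    have mv: "map (step c a) u1 @ step c a r' # map (step c a) u2 = v" "step c a r = b"
      using h(2) unfolding l by auto
    have cr': "c r' = ?k'"
      using next_colour_unique[OF k C(2)[OF D(3)]] C(4)[OF D(2)] mv(2) cr h(6) unfolding step_def by simp
    have fr: "face_perm l \<tau> r = hd (u1 @ [r'])" "face_perm l \<tau> r' = hd (u2 @ [r])"
      using dist unfolding l face_perm_def by (auto simp: nx_append hd_append)
    have hu1: "c (hd u1) = ?k'" if "u1 \<noteq> []" using fr(1) C(3)[OF D(2)] h(6) cr' that by (simp add: hd_append)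
    have hu2: "c (hd u2) = k" if "u2 \<noteq> []" using fr(2) C(3)[OF D(3)] ar' cr that by (simp add: hd_append)
    obtain D1 D2 where DD: "D = insert r D2 \<union> insert r' D1" "D1 \<inter> D2 = {}"
      "r \<notin> D1" "r \<notin> D2" "r' \<notin> D1" "r' \<notin> D2"
      and p1: "pmap D1 u1 (\<lambda>d. if d \<in> D1 - set u1 then \<tau> d else d) (\<lambda>d. if d \<in> D1 then a d else d) (restrict c D1)"
      and p2: "pmap D2 u2 (\<lambda>d. if d \<in> D2 - set u2 then \<tau> d else d) (\<lambda>d. if d \<in> D2 then a d else d) (restrict c D2)"
      by (rule bridge_fwd[OF h(1)[unfolded l] h(6)])
    have D2: "D2 = ?D' - D1" using DD by auto
    have D1: "D1 \<subseteq> ?D'" using DD by auto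
    have us: "set u1 \<subseteq> D1" "set u2 \<subseteq> D2" using pmapD(3)[OF p1] pmapD(3)[OF p2] .
    have s: "step (restrict c X) (\<lambda>d. if d \<in> X then a d else d) d = step c a d"
      if "is_inv X (\<lambda>d. if d \<in> X then a d else d)" "d \<in> X" for X d
      using is_invD(1)[OF that] that(2) unfolding step_def by simp
    have m1: "map (step (restrict c D1) (\<lambda>d. if d \<in> D1 then a d else d)) u1 = map (step c a) u1"
      by (rule map_cong[OF refl s[OF pmapD(6)[OF p1]]]) (use us in blast)
    have m2: "map (step (restrict c D2) (\<lambda>d. if d \<in> D2 then a d else d)) u2 = map (step c a) u2"
      by (rule map_cong[OF refl s[OF pmapD(6)[OF p2]]]) (use us in blast)
    have sr': "step c a r' = (\<not> b)" unfolding step_def ar' cr cr' using nk by simp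
    let ?i = "length u1"
    let ?z1 = "(u1, \<lambda>d. if d \<in> D1 - set u1 then \<tau> d else d, \<lambda>d. if d \<in> D1 then a d else d, restrict c D1)"
    let ?z2 = "(u2, \<lambda>d. if d \<in> D2 - set u2 then \<tau> d else d, \<lambda>d. if d \<in> D2 then a d else d, restrict c D2)"
    have i: "?i \<in> ?I" "take ?i v = map (step c a) u1" "drop (Suc ?i) v = map (step c a) u2"
      using mv(1) sr' by (auto simp: nth_append)
    have "?z1 \<in> ?P1 ?i D1"
    proof -
      have "u1 \<noteq> [] \<longrightarrow> restrict c D1 (hd u1) = ?k'" using hu1 us(1) by (metis hd_in_set restrict_apply' subsetD)
      then show ?thesis using p1 m1 i(2) unfolding pmaps_def by simp
    qed
    moreover have "?z2 \<in> ?P2 ?i D1"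
    proof -
      have "u2 \<noteq> [] \<longrightarrow> restrict c D2 (hd u2) = k" using hu2 us(2) by (metis hd_in_set restrict_apply' subsetD)
      then show ?thesis using p2 m2 i(3) unfolding pmaps_def D2[symmetric] by simp
    qed
    ultimately have U: "(?i, D1, ?z1, ?z2) \<in> ?U" using i(1) D1 by blast
    have "G (?i, D1, ?z1, ?z2) = z"
    proof -
      have e1: "(if d \<in> D1 then (if d \<in> D1 - set u1 then \<tau> d else d) else (if d \<in> D2 - set u2 then \<tau> d else d)) = \<tau> d" for d
      proof (cases "d \<in> D - set l")
        case True
        then have "d \<in> D1 - set u1 \<or> d \<in> D2 - set u2 \<and> d \<notin> D1" using DD unfolding l by auto
        then show ?thesis by auto
      next
        case False
        then have "\<tau> d = d" using triD(4)[OF P(5)] by blast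
        then show ?thesis by simp
      qed
      have e2: "(if d = r then r' else if d = r' then r else if d \<in> D1 then (if d \<in> D1 then a d else d)
          else (if d \<in> D2 then a d else d)) = a d" for d
      proof (cases "d \<in> D")
        case True
        then have "d = r \<or> d = r' \<or> d \<in> D1 \<or> d \<in> D2" using DD(1) by auto
        then show ?thesis using h(6) ar' by auto
      next
        case False
        then have "a d = d" using is_invD(4)[OF P(6)] by blast
        then show ?thesis using False D by auto
      qed
      have e3: "(if d = r then k else if d = r' then ?k' else if d \<in> D1 then restrict c D1 d else restrict c D2 d) = c d" for d
      proof (cases "d \<in> D")
        case True
        then have "d = r \<or> d = r' \<or> d \<in> D1 \<or> d \<in> D2" using DD(1) by auto
        then show ?thesis using cr cr' by auto
      next
        case False
        then have "c d = undefined" "d \<notin> D1" "d \<notin> D2" "d \<noteq> r" "d \<noteq> r'" using PiE_arb[OF C(1)] DD(1) D by auto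
        then show ?thesis by simp
      qed
      show ?thesis unfolding G_def glue_def zz prod.case e1 e2 e3 l by (rule refl)
    qed
    then have "z = G (?i, D1, ?z1, ?z2)" by (rule sym)
    then show ?thesis by (rule image_eqI[OF _ U])
  qed
  have "G ` ?U = ?S"
  proof
    show "G ` ?U \<subseteq> ?S" by (rule image_subsetI) (rule into)
    show "?S \<subseteq> G ` ?U" by (rule subsetI) (rule onto)
  qed
  then show ?thesis using card_image[OF inj] cardU by simp
qed

section \<open>Counting by boundary words\<close>

text \<open>The number of near-triangulations with n edges, boundary word w and given root colour, up to
  relabelling the darts.\<close>

function wcount :: "nat \<Rightarrow> bool list \<Rightarrow> nat" where
  "wcount 0 w = (if w = [] then 1 else 0)"
| "wcount (Suc n) [] = 0"
| "wcount (Suc n) (x # u) = wcount n ((\<not> x) # (\<not> x) # u) +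
     (\<Sum>i | i < length u \<and> u ! i = (\<not> x). \<Sum>m\<in>{..n}. wcount m (take i u) * wcount (n - m) (drop (Suc i) u))"
  by pat_completeness auto
termination by (relation "measure fst") auto

lemma sum_Pow_card:
  fixes g :: "nat \<Rightarrow> nat"
  assumes "finite A"
  shows "(\<Sum>X\<in>Pow A. g (card X)) = (\<Sum>j\<le>card A. (card A choose j) * g j)"
proof -
  have "(\<Sum>X\<in>Pow A. g (card X)) = (\<Sum>j\<le>card A. \<Sum>X\<in>{X \<in> Pow A. card X = j}. g (card X))"
    using assms by (intro sum.group[symmetric]) (auto intro: card_mono)
  also have "\<dots> = (\<Sum>j\<le>card A. card {X. X \<subseteq> A \<and> card X = j} * g j)"
    by (intro sum.cong refl) (auto simp: Pow_def)
  finally show ?thesis using n_subsets[OF assms] by simp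
qed

lemma sum_even_indices:
  fixes h :: "nat \<Rightarrow> nat"
  assumes "\<And>j. odd j \<Longrightarrow> h j = 0"
  shows "(\<Sum>j\<le>2 * n. h j) = (\<Sum>m\<le>n. h (2 * m))"
  by (induction n) (simp_all add: assms)

lemma card_rooted_split:
  assumes "finite D" "r \<in> D" "k < 3"
  shows "card (rooted D r (b # v) k) = (\<Sum>r'\<in>D - {r}. card (pmaps (D - {r, r'}) ((\<not> b) # (\<not> b) # v) k) +
    (\<Sum>i | i < length v \<and> v ! i = (\<not> b). \<Sum>D1\<in>Pow (D - {r, r'}).
        card (pmaps D1 (take i v) (next_colour b k)) * card (pmaps (D - {r, r'} - D1) (drop (Suc i) v) k)))"
proof -
  let ?R = "rooted D r (b # v) k"
  let ?S = "\<lambda>r'. {(l, \<tau>, a, c). (l, \<tau>, a, c) \<in> ?R \<and> a r = r'}"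
  let ?M = "\<lambda>r'. {(l, \<tau>, a, c). (l, \<tau>, a, c) \<in> ?R \<and> a r = r' \<and> r' \<notin> set l}"
  let ?B = "\<lambda>r'. {(l, \<tau>, a, c). (l, \<tau>, a, c) \<in> ?R \<and> a r = r' \<and> r' \<in> set l}"
  have fin: "finite ?R"
    by (rule finite_subset[OF _ finite_pmaps[OF assms(1), of "b # v" k]]) (auto simp: rooted_def)
  have U: "?R = (\<Union>r'\<in>D - {r}. ?S r')"
  proof
    show "?R \<subseteq> (\<Union>r'\<in>D - {r}. ?S r')"
    proof
      fix z assume z: "z \<in> ?R"
      obtain l \<tau> a c where zz: "z = (l, \<tau>, a, c)" by (cases z)
      have "pmap D l \<tau> a c" using z unfolding zz rooted_def pmaps_def by auto
      then have "is_inv D a" by (rule pmapD)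
      then have "a r \<in> D - {r}" using is_invD(1,2)[of D a r] assms(2) by auto
      then show "z \<in> (\<Union>r'\<in>D - {r}. ?S r')" using z zz by auto
    qed
  qed auto
  have "card (\<Union>r'\<in>D - {r}. ?S r') = (\<Sum>r'\<in>D - {r}. card (?S r'))"
  proof (rule card_UN_disjoint)
    show "finite (D - {r})" using assms(1) by simp
    show "\<forall>i\<in>D - {r}. finite (?S i)" by (intro ballI finite_subset[OF _ fin]) auto
    show "\<forall>i\<in>D - {r}. \<forall>j\<in>D - {r}. i \<noteq> j \<longrightarrow> ?S i \<inter> ?S j = {}" by blast
  qed
  then have "card ?R = (\<Sum>r'\<in>D - {r}. card (?S r'))" by (subst U)
  also have "\<dots> = (\<Sum>r'\<in>D - {r}. card (?M r') + card (?B r'))"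
  proof (rule sum.cong[OF refl])
    fix r' assume "r' \<in> D - {r}"
    have "?S r' = ?M r' \<union> ?B r'" by auto
    moreover have "card (?M r' \<union> ?B r') = card (?M r') + card (?B r')"
      by (intro card_Un_disjoint finite_subset[OF _ fin]) auto
    ultimately show "card (?S r') = card (?M r') + card (?B r')" by simp
  qed
  also have "\<dots> = (\<Sum>r'\<in>D - {r}. card (pmaps (D - {r, r'}) ((\<not> b) # (\<not> b) # v) k) +
    (\<Sum>i | i < length v \<and> v ! i = (\<not> b). \<Sum>D1\<in>Pow (D - {r, r'}).
        card (pmaps D1 (take i v) (next_colour b k)) * card (pmaps (D - {r, r'} - D1) (drop (Suc i) v) k)))"
  proof (rule sum.cong[OF refl])
    fix r' assume "r' \<in> D - {r}"
    then have r': "r' \<in> D" "r \<noteq> r'" by auto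
    show "card (?M r') + card (?B r') = card (pmaps (D - {r, r'}) ((\<not> b) # (\<not> b) # v) k) +
    (\<Sum>i | i < length v \<and> v ! i = (\<not> b). \<Sum>D1\<in>Pow (D - {r, r'}).
        card (pmaps D1 (take i v) (next_colour b k)) * card (pmaps (D - {r, r'} - D1) (drop (Suc i) v) k))"
      unfolding card_merge[OF assms(1,2) r'] card_bridge[OF assms(1,2) r' assms(3)] ..
  qed
  finally show ?thesis .
qed

lemma card_pmaps_split:
  assumes "finite D" "D \<noteq> {}"
  shows "card (pmaps D w k) = (\<Sum>r\<in>D. card (rooted D r w k))"
proof -
  have "pmaps D w k = (\<Union>r\<in>D. rooted D r w k)"
  proof
    show "pmaps D w k \<subseteq> (\<Union>r\<in>D. rooted D r w k)"
    proof
      fix z assume z: "z \<in> pmaps D w k"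
      obtain l \<tau> a c where zz: "z = (l, \<tau>, a, c)" by (cases z)
      have p: "pmap D l \<tau> a c" using z unfolding zz pmaps_def by auto
      have "l \<noteq> []" using pmapD(4)[OF p] assms(2) by auto
      moreover have "hd l \<in> D" using pmapD(3)[OF p] calculation by auto
      ultimately show "z \<in> (\<Union>r\<in>D. rooted D r w k)" using z unfolding zz rooted_def by auto
    qed
  qed (auto simp: rooted_def)
  moreover have "card (\<Union>r\<in>D. rooted D r w k) = (\<Sum>r\<in>D. card (rooted D r w k))"
  proof (rule card_UN_disjoint)
    show "\<forall>r\<in>D. finite (rooted D r w k)"
      by (intro ballI finite_subset[OF _ finite_pmaps[OF assms(1), of w k]]) (auto simp: rooted_def)
  qed (use assms(1) in \<open>auto simp: rooted_def\<close>)
  ultimately show ?thesis by simp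
qed

lemma pmaps_empty: "card (pmaps {} w k) = (if w = [] then 1 else 0)"
proof -
  have p: "pmap {} l \<tau> a c \<longleftrightarrow> l = [] \<and> \<tau> = id \<and> a = id \<and> c = (\<lambda>_. undefined)" for l \<tau> a c
    unfolding pmap_def tri_def is_inv_def conn_def coloured_def by auto
  have "pmaps {} w k = (if w = [] then {([], id, id, \<lambda>_. undefined)} else {})"
    unfolding pmaps_def p by auto
  then show ?thesis by simp
qed

text \<open>The partner r' can be any of the \<open>card D - 1\<close> other darts, and distributing
  the remaining darts over the two pieces gives a binomial coefficient that cancels their
  factorials. What is left is the recursion of \<open>wcount\<close>.\<close>

lemma card_rooted_step:
  assumes fin: "finite D" and r: "r \<in> D" and k: "k < 3"
    and IH: "\<And>X w k. X \<subset> D \<Longrightarrow> k < 3 \<Longrightarrow>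
      card (pmaps X w k) = (if even (card X) then fact (card X) * wcount (card X div 2) w else 0)"
  shows "card (rooted D r w k) = (if even (card D) then fact (card D - 1) * wcount (card D div 2) w else 0)"
proof (cases w)
  case Nil
  have "rooted D r [] k = {}" unfolding rooted_def pmaps_def by auto
  moreover obtain m where "card D = Suc m" using fin r by (metis card_Suc_Diff1)
  then have "even (card D) \<Longrightarrow> \<exists>m. card D div 2 = Suc m" by (auto elim!: evenE intro: not0_implies_Suc)
  ultimately show ?thesis using Nil by auto
next
  case (Cons b v)
  let ?D' = "\<lambda>r'. D - {r, r'}"
  let ?N = "card D - 2"
  let ?k' = "next_colour b k"
  have k': "?k' < 3" using next_colour(1)[OF k] .
  have D': "card (?D' r') = ?N" "?D' r' \<subset> D" if "r' \<in> D - {r}" for r'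
  proof -
    have "card {r, r'} = 2" using that by auto
    moreover have "card (D - {r, r'}) = card D - card {r, r'}"
      using that r by (intro card_Diff_subset) auto
    ultimately show "card (?D' r') = ?N" by simp
    show "?D' r' \<subset> D" using r by auto
  qed
  let ?T = "\<lambda>r'. card (pmaps (?D' r') ((\<not> b) # (\<not> b) # v) k) +
    (\<Sum>i | i < length v \<and> v ! i = (\<not> b). \<Sum>D1\<in>Pow (?D' r').
        card (pmaps D1 (take i v) ?k') * card (pmaps (?D' r' - D1) (drop (Suc i) v) k))"
  have T: "?T r' = (if even ?N then fact ?N * wcount (Suc (?N div 2)) w else 0)" if r': "r' \<in> D - {r}" for r'
  proof -
    note D = D'[OF r']
    have finD': "finite (?D' r')" using fin by simp
    let ?g = "\<lambda>i j. (if even j then fact j * wcount (j div 2) (take i v) else 0) *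
       (if even (?N - j) then fact (?N - j) * wcount ((?N - j) div 2) (drop (Suc i) v) else 0)"
    have inner: "(\<Sum>D1\<in>Pow (?D' r'). card (pmaps D1 (take i v) ?k') * card (pmaps (?D' r' - D1) (drop (Suc i) v) k))
        = (\<Sum>j\<le>?N. (?N choose j) * ?g i j)" for i
    proof -
      have "(\<Sum>D1\<in>Pow (?D' r'). card (pmaps D1 (take i v) ?k') * card (pmaps (?D' r' - D1) (drop (Suc i) v) k))
        = (\<Sum>D1\<in>Pow (?D' r'). ?g i (card D1))"
      proof (rule sum.cong[OF refl])
        fix D1 assume "D1 \<in> Pow (?D' r')"
        then have s: "D1 \<subseteq> ?D' r'" by simp
        have "card (?D' r' - D1) = ?N - card D1"
          using s finD' D(1) by (metis card_Diff_subset finite_subset)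
        moreover have "D1 \<subset> D" "?D' r' - D1 \<subset> D" using s D(2) by auto
        ultimately show "card (pmaps D1 (take i v) ?k') * card (pmaps (?D' r' - D1) (drop (Suc i) v) k) = ?g i (card D1)"
          using IH[OF _ k', of D1] IH[OF _ k, of "?D' r' - D1"] by simp
      qed
      also have "\<dots> = (\<Sum>j\<le>?N. (?N choose j) * ?g i j)"
        using sum_Pow_card[OF finD', of "?g i"] D(1) by simp
      finally show ?thesis .
    qed
    have first: "card (pmaps (?D' r') ((\<not> b) # (\<not> b) # v) k) =
        (if even ?N then fact ?N * wcount (?N div 2) ((\<not> b) # (\<not> b) # v) else 0)"
      using IH[OF D(2) k] D(1) by simp
    show ?thesis
    proof (cases "even ?N")
      \<comment> \<open>When an odd number of darts is distributed, one of the two pieces gets an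
        odd number and has no fixed-point-free involution.\<close>
      case False
      have "(?N choose j) * ?g i j = 0" if "j \<le> ?N" for i j using that False by (cases "even j") auto
      then have "(\<Sum>j\<le>?N. (?N choose j) * ?g i j) = 0" for i by (intro sum.neutral) auto
      then show ?thesis unfolding inner first using False by simp
    next
      case True
      define n where "n = ?N div 2"
      have N: "?N = 2 * n" using True unfolding n_def by simp
      have "(\<Sum>j\<le>?N. (?N choose j) * ?g i j) =
          fact ?N * (\<Sum>m\<le>n. wcount m (take i v) * wcount (n - m) (drop (Suc i) v))" for i
      proof -
        have "(\<Sum>j\<le>?N. (?N choose j) * ?g i j) = (\<Sum>m\<le>n. (?N choose (2 * m)) * ?g i (2 * m))"
          unfolding N by (rule sum_even_indices) simp
        also have "\<dots> = (\<Sum>m\<le>n. fact ?N * (wcount m (take i v) * wcount (n - m) (drop (Suc i) v)))"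
        proof (rule sum.cong[OF refl])
          fix m assume "m \<in> {..n}"
          then have m: "2 * m \<le> ?N" "?N - 2 * m = 2 * (n - m)" unfolding N by auto
          have "(?N choose (2 * m)) * (fact (2 * m) * fact (?N - 2 * m)) = fact ?N"
            using binomial_fact_lemma[OF m(1)] by (simp add: ac_simps)
          moreover have "(?N choose (2 * m)) * ?g i (2 * m) =
            (?N choose (2 * m)) * (fact (2 * m) * fact (?N - 2 * m)) * (wcount m (take i v) * wcount (n - m) (drop (Suc i) v))"
            unfolding m(2) by simp
          ultimately show "(?N choose (2 * m)) * ?g i (2 * m) = fact ?N * (wcount m (take i v) * wcount (n - m) (drop (Suc i) v))"
            by (simp only:)
        qed
        finally show ?thesis by (simp add: sum_distrib_left)
      qed
      then show ?thesis
        unfolding inner first Cons wcount.simps n_def[symmetric] using True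
        by (simp add: sum_distrib_left distrib_left)
    qed
  qed
  have "card (rooted D r w k) = (\<Sum>r'\<in>D - {r}. ?T r')"
    unfolding Cons by (rule card_rooted_split[OF fin r k])
  also have "\<dots> = (\<Sum>r'\<in>D - {r}. if even ?N then fact ?N * wcount (Suc (?N div 2)) w else 0)"
    by (rule sum.cong[OF refl T])
  also have "\<dots> = (card D - 1) * (if even ?N then fact ?N * wcount (Suc (?N div 2)) w else 0)"
    using fin r by simp
  also have "\<dots> = (if even (card D) then fact (card D - 1) * wcount (card D div 2) w else 0)"
  proof (cases "card D \<ge> 2")
    case True
    then have "card D = Suc (Suc (card D - 2))" by simp
    then obtain N where N: "card D = Suc (Suc N)" by blast
    show ?thesis unfolding N by (simp add: algebra_simps)
  next
    case False
    moreover have "card D > 0" using fin r by (auto simp: card_gt_0_iff)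
    ultimately have "card D = 1" by simp
    then show ?thesis by simp
  qed
  finally show ?thesis .
qed

lemma card_pmaps:
  assumes "finite D" "k < 3"
  shows "card (pmaps D w k) = (if even (card D) then fact (card D) * wcount (card D div 2) w else 0)"
  using assms
proof (induction D arbitrary: w k rule: finite_psubset_induct)
  case (psubset D)
  show ?case
  proof (cases "D = {}")
    case True
    then show ?thesis by (simp add: pmaps_empty)
  next
    case False
    have "card (pmaps D w k) = (\<Sum>r\<in>D. card (rooted D r w k))"
      by (rule card_pmaps_split[OF psubset.hyps(1) False])
    also have "\<dots> = (\<Sum>r\<in>D. if even (card D) then fact (card D - 1) * wcount (card D div 2) w else 0)"
      by (rule sum.cong[OF refl], rule card_rooted_step[OF psubset.hyps(1) _ psubset.prems]) (use psubset.IH in auto)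
    also have "\<dots> = card D * (if even (card D) then fact (card D - 1) * wcount (card D div 2) w else 0)" by simp
    also have "\<dots> = (if even (card D) then fact (card D) * wcount (card D div 2) w else 0)"
      using fact_reduce[of "card D", where 'a = nat] False psubset.hyps(1) by (simp add: card_gt_0_iff)
    finally show ?thesis .
  qed
qed

lemma card_rooted:
  assumes "finite D" "r \<in> D" "k < 3"
  shows "card (rooted D r w k) = (if even (card D) then fact (card D - 1) * wcount (card D div 2) w else 0)"
proof (rule card_rooted_step[OF assms])
  fix X :: "nat set" and w k
  assume "X \<subset> D" "k < (3::nat)"
  then show "card (pmaps X w k) = (if even (card X) then fact (card X) * wcount (card X div 2) w else 0)"
    using assms(1) by (meson card_pmaps finite_subset psubset_imp_subset)
qed

section \<open>Rotation systems and boundary words\<close>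

lemma face_perm_rotate:
  assumes "distinct (r # u)"
  shows "face_perm (u @ [r]) \<tau> = face_perm (r # u) \<tau>"
proof
  fix d
  have "r \<notin> set u" using assms by simp
  then show "face_perm (u @ [r]) \<tau> d = face_perm (r # u) \<tau> d"
    unfolding face_perm_def by (cases u) (auto simp: nx_append hd_append nx_other)
qed

text \<open>The recursion of \<open>wcount\<close> always consumes the first letter and hides the
  cyclic symmetry. It is recovered from the maps by rerooting at the next boundary vertex, whose
  colour is \<open>next_colour x 0\<close> if the old root colour is 0.\<close>

lemma wcount_rotate: "wcount n (x # u) = wcount n (u @ [x])"
proof (cases n)
  case 0
  then show ?thesis by simp
next
  case (Suc m)
  let ?D = "{0..<2 * n}"
  let ?k = "next_colour x 0"
  have D: "finite ?D" "card ?D = 2 * n" by auto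
  define R :: "nat list \<times> (nat \<Rightarrow> nat) \<times> (nat \<Rightarrow> nat) \<times> (nat \<Rightarrow> nat) \<Rightarrow> _"
    where "R = (\<lambda>(l, \<tau>, a, c). (tl l @ [hd l], \<tau>, a, c))"
  define R' :: "nat list \<times> (nat \<Rightarrow> nat) \<times> (nat \<Rightarrow> nat) \<times> (nat \<Rightarrow> nat) \<Rightarrow> _"
    where "R' = (\<lambda>(l, \<tau>, a, c). (last l # butlast l, \<tau>, a, c))"
  have pm: "pmap ?D (r # v) \<tau> a c \<longleftrightarrow> pmap ?D (v @ [r]) \<tau> a c" for r v \<tau> a c
  proof (cases "distinct (r # v)")
    case True
    then show ?thesis unfolding pmap_def face_perm_rotate[OF True] by simp
  next
    case False
    then show ?thesis unfolding pmap_def by auto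
  qed
  have hd1: "c (hd (v @ [r])) = c (a r)" "a r \<in> ?D" "r \<in> ?D" "c r < 3" "c (a r) < 3" "c (a r) \<noteq> c r"
    if p: "pmap ?D (r # v) \<tau> a c" for r v \<tau> a c
  proof -
    note P = pmapD[OF p]
    show r: "r \<in> ?D" using P(3) by simp
    show ar: "a r \<in> ?D" using is_invD(1)[OF P(6) r] .
    have "face_perm (r # v) \<tau> r = hd (v @ [r])" unfolding face_perm_def by simp
    then show "c (hd (v @ [r])) = c (a r)" using colouredD(3)[OF P(9) r] by simp
    show "c r < 3" "c (a r) < 3" "c (a r) \<noteq> c r"
      using colouredD(2)[OF P(9) r] colouredD(2)[OF P(9) ar] colouredD(4)[OF P(9) r] by auto
  qed
  have col: "c r = 0 \<longleftrightarrow> c (a r) = ?k" if "pmap ?D (r # v) \<tau> a c" "step c a r = x" for r v \<tau> a c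
  proof -
    have "c r = 0 \<or> c r = 1 \<or> c r = 2" "c (a r) = 0 \<or> c (a r) = 1 \<or> c (a r) = 2" "c (a r) \<noteq> c r"
      using hd1(4-6)[OF that(1)] by auto
    then show ?thesis using that(2) unfolding step_def next_colour_def by (elim disjE) auto
  qed
  have "bij_betw R (pmaps ?D (x # u) 0) (pmaps ?D (u @ [x]) ?k)"
  proof (rule bij_betw_byWitness[where f' = R'])
    have cons: "\<exists>r v \<tau> a c. z = (r # v, \<tau>, a, c) \<and> pmap ?D (r # v) \<tau> a c \<and> step c a r = x \<and> map (step c a) v = u \<and> c r = 0"
      if "z \<in> pmaps ?D (x # u) 0" for z
      using that unfolding pmaps_def by (auto simp: map_eq_Cons_conv)
    have snoc: "\<exists>r v \<tau> a c. z = (v @ [r], \<tau>, a, c) \<and> pmap ?D (r # v) \<tau> a c \<and> step c a r = x \<and>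
        map (step c a) v = u \<and> c (a r) = ?k"
      if z: "z \<in> pmaps ?D (u @ [x]) ?k" for z
    proof -
      obtain l \<tau> a c where zz: "z = (l, \<tau>, a, c)" by (cases z)
      have h: "pmap ?D l \<tau> a c" "map (step c a) l = u @ [x]" "l \<noteq> [] \<longrightarrow> c (hd l) = ?k"
        using z unfolding zz pmaps_def by auto
      have "l \<noteq> []" using h(2) by auto
      then obtain v r where l: "l = v @ [r]" by (metis rev_exhaust)
      have p: "pmap ?D (r # v) \<tau> a c" using h(1) pm unfolding l by blast
      have "c (a r) = ?k" using h(3) hd1(1)[OF p] unfolding l by simp
      then show ?thesis using zz l p h(2) by auto
    qed
    show "\<forall>z\<in>pmaps ?D (x # u) 0. R' (R z) = z"
    proof
      fix z assume "z \<in> pmaps ?D (x # u) 0"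
      then obtain r v \<tau> a c where "z = (r # v, \<tau>, a, c)" using cons by blast
      then show "R' (R z) = z" unfolding R_def R'_def by simp
    qed
    show "\<forall>z\<in>pmaps ?D (u @ [x]) ?k. R (R' z) = z"
    proof
      fix z assume "z \<in> pmaps ?D (u @ [x]) ?k"
      then obtain r v \<tau> a c where "z = (v @ [r], \<tau>, a, c)" using snoc by blast
      then show "R (R' z) = z" unfolding R_def R'_def by simp
    qed
    show "R ` pmaps ?D (x # u) 0 \<subseteq> pmaps ?D (u @ [x]) ?k"
    proof (rule image_subsetI)
      fix z assume "z \<in> pmaps ?D (x # u) 0"
      then obtain r v \<tau> a c where z: "z = (r # v, \<tau>, a, c)" "pmap ?D (r # v) \<tau> a c" "step c a r = x"
        "map (step c a) v = u" "c r = 0" using cons by blast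
      have "c (hd (v @ [r])) = ?k" using hd1(1)[OF z(2)] col[OF z(2,3)] z(5) by simp
      moreover have "pmap ?D (v @ [r]) \<tau> a c" using z(2) pm by blast
      ultimately show "R z \<in> pmaps ?D (u @ [x]) ?k" unfolding z(1) R_def pmaps_def using z(3,4) by simp
    qed
    show "R' ` pmaps ?D (u @ [x]) ?k \<subseteq> pmaps ?D (x # u) 0"
    proof (rule image_subsetI)
      fix z assume "z \<in> pmaps ?D (u @ [x]) ?k"
      then obtain r v \<tau> a c where z: "z = (v @ [r], \<tau>, a, c)" "pmap ?D (r # v) \<tau> a c" "step c a r = x"
        "map (step c a) v = u" "c (a r) = ?k" using snoc by blast
      have "c r = 0" using col[OF z(2,3)] z(5) by simp
      then show "R' z \<in> pmaps ?D (x # u) 0" unfolding z(1) R'_def pmaps_def using z(2-4) by simp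
    qed
  qed
  then have "card (pmaps ?D (x # u) 0) = card (pmaps ?D (u @ [x]) ?k)" by (rule bij_betw_same_card)
  moreover have "?k < 3" using next_colour(1)[of 0] by simp
  ultimately show ?thesis
    using card_pmaps[OF D(1), of 0 "x # u"] card_pmaps[OF D(1), of ?k "u @ [x]"] D(2) by simp
qed

section \<open>Maps with a listed outer face as rotation systems\<close>

lemma nx_nth:
  "distinct l \<Longrightarrow> j < length l \<Longrightarrow> nx l e (l ! j) = (if Suc j < length l then l ! Suc j else e)"
proof (induction l arbitrary: j)
  case (Cons x l)
  show ?case
  proof (cases j)
    case 0
    then show ?thesis by (cases l) auto
  next
    case (Suc i)
    then have "l ! i \<noteq> x" using Cons.prems by auto
    then show ?thesis using Cons Suc by auto
  qed
qed simp

lemma face_perm_funpow: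
  assumes "distinct l" "j < length l"
  shows "(face_perm l \<tau> ^^ j) (hd l) = l ! j"
  using assms(2)
proof (induction j)
  case 0
  then show ?case by (cases l) auto
next
  case (Suc j)
  then show ?case using nx_nth[OF assms(1), of j "hd l"] unfolding face_perm_def by simp
qed

lemma orb_card_3:
  assumes fin: "finite D" and f: "bij_betw f D D" and d: "d \<in> D" and c: "card (orb f d) = 3"
  shows "f d \<noteq> d" "f (f (f d)) = d"
proof -
  have inj: "inj_on f D" and im: "f ` D = D" using f by (auto simp: bij_betw_def)
  have D: "f d \<in> D" "f (f d) \<in> D" "f (f (f d)) \<in> D" using im d by auto
  show n1: "f d \<noteq> d"
  proof
    assume "f d = d"
    then have "orb f d \<subseteq> {d}" by (intro orb_minimal) auto
    then have "card (orb f d) \<le> card {d}" by (intro card_mono) auto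
    then show False using c by simp
  qed
  have n2: "f (f d) \<noteq> d"
  proof
    assume "f (f d) = d"
    then have "orb f d \<subseteq> {d, f d}" by (intro orb_minimal) auto
    then have "card (orb f d) \<le> card {d, f d}" by (intro card_mono) auto
    then show False using c by (simp add: card_insert_if split: if_splits)
  qed
  have n3: "f (f d) \<noteq> f d" using n1 inj_onD[OF inj, of "f d" d] D d by blast
  have sub: "{d, f d, f (f d)} \<subseteq> orb f d" by (simp add: orb_self orb_step)
  have "finite (orb f d)" using c card.infinite by fastforce
  moreover have "card {d, f d, f (f d)} = 3" using n1 n2 n3 by auto
  ultimately have "orb f d = {d, f d, f (f d)}" using card_subset_eq[OF _ sub] c by simp
  moreover have "f (f (f d)) \<in> orb f d" by (simp add: orb_self orb_step)
  ultimately have "f (f (f d)) \<in> {d, f d, f (f d)}" by blast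
  moreover have "f (f (f d)) \<noteq> f d" using n2 inj_onD[OF inj, of "f (f d)" d] D d by blast
  moreover have "f (f (f d)) \<noteq> f (f d)" using n3 inj_onD[OF inj, of "f (f d)" "f d"] D by blast
  ultimately show "f (f (f d)) = d" by blast
qed

lemma orb_list:
  assumes "f permutes D" "finite D"
  obtains l where "distinct l" "l \<noteq> []" "hd l = x" "set l = orb f x" "\<And>d. d \<in> set l \<Longrightarrow> nx l (hd l) d = f d"
proof -
  have p: "permutation f" using assms permutation_permutes by blast
  let ?l = "support f x"
  let ?n = "least_power f x"
  have n: "(f ^^ ?n) x = x" "?n > 0" using least_power_of_permutation[OF p] .
  have dist: "distinct ?l" using cycle_of_permutation[OF p] .
  have nth: "?l ! j = (f ^^ j) x" if "j < ?n" for j using that by simp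
  have s: "set ?l = orb f x" unfolding support_set[OF p] orb_def by auto
  have hd: "hd ?l = x" using n(2) by (simp add: hd_map)
  have "nx ?l (hd ?l) d = f d" if d: "d \<in> set ?l" for d
  proof -
    obtain j where j: "j < length ?l" "d = ?l ! j" using d by (metis in_set_conv_nth)
    have jn: "j < ?n" using j(1) by simp
    have "nx ?l (hd ?l) d = (if Suc j < length ?l then ?l ! Suc j else hd ?l)"
      unfolding j(2) by (rule nx_nth[OF dist j(1)])
    also have "\<dots> = (f ^^ Suc j) x"
    proof (cases "Suc j < ?n")
      case True
      then show ?thesis by simp
    next
      case False
      then have "Suc j = ?n" using jn by simp
      then show ?thesis using n hd by simp
    qed
    also have "\<dots> = f d" unfolding j(2) nth[OF jn] by simp
    finally show ?thesis .
  qed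
  then show thesis using dist s hd n(2) by (intro that[of ?l]) auto
qed

definition edge_rel :: "nat \<Rightarrow> (nat \<Rightarrow> nat) \<Rightarrow> (nat \<Rightarrow> nat) \<Rightarrow> (nat \<times> nat) set" where
  "edge_rel n a s = {(x, a x) | x. x \<in> darts n} \<union> {(x, s x) | x. x \<in> darts n}"

text \<open>Reachability uses directed edges, but complements of invariant sets are invariant. An
  invariant set missing 0 would leave 0 in its complement, which then contains everything reachable
  from 0, that is, all darts.\<close>

lemma conn_iff_reachable:
  assumes a: "a permutes darts n" "\<And>d. d \<in> darts n \<Longrightarrow> a (a d) = d" and s: "s permutes darts n" and n: "n > 0"
  shows "conn (darts n) (s \<circ> a) a \<longleftrightarrow> (\<forall>d\<in>darts n. (0, d) \<in> (edge_rel n a s)\<^sup>*)"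
proof
  let ?D = "darts n"
  have aD: "a d \<in> ?D \<longleftrightarrow> d \<in> ?D" for d using permutes_in_image[OF a(1)] .
  have sD: "s d \<in> ?D \<longleftrightarrow> d \<in> ?D" for d using permutes_in_image[OF s] .
  have D0: "0 \<in> ?D" using n unfolding darts_def by simp
  assume c: "conn ?D (s \<circ> a) a"
  let ?A = "{d \<in> ?D. (0, d) \<in> (edge_rel n a s)\<^sup>*}"
  have aA: "a d \<in> ?A" if "d \<in> ?A" for d
    using that aD[of d] unfolding edge_rel_def by (auto intro: rtrancl_into_rtrancl)
  have sA: "s d \<in> ?A" if "d \<in> ?A" for d
    using that sD[of d] unfolding edge_rel_def by (auto intro: rtrancl_into_rtrancl)
  have 1: "(s \<circ> a) ` ?A \<subseteq> ?A" by (rule image_subsetI) (unfold comp_apply, rule sA[OF aA])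
  have 2: "a ` ?A \<subseteq> ?A" by (rule image_subsetI) (rule aA)
  have "0 \<in> ?A" using D0 by simp
  then have 3: "?A \<noteq> {}" by blast
  have "?A \<subseteq> ?D" by blast
  then have "?A = ?D" using c[unfolded conn_def, rule_format, of ?A] 1 2 3 by blast
  then show "\<forall>d\<in>?D. (0, d) \<in> (edge_rel n a s)\<^sup>*" by blast
next
  let ?D = "darts n"
  have fin: "finite ?D" unfolding darts_def by simp
  assume r: "\<forall>d\<in>?D. (0, d) \<in> (edge_rel n a s)\<^sup>*"
  have reach: "d \<in> X" if X: "a ` X \<subseteq> X" "s ` X \<subseteq> X" "0 \<in> X" and d: "d \<in> ?D" for X d
  proof -
    have "(0, d) \<in> (edge_rel n a s)\<^sup>*" using r d by blast
    then show ?thesis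
      by (induction rule: rtrancl_induct) (use X in \<open>auto simp: edge_rel_def\<close>)
  qed
  show "conn ?D (s \<circ> a) a" unfolding conn_def
  proof (intro allI impI)
    fix A assume h: "A \<subseteq> ?D" "A \<noteq> {}" "(s \<circ> a) ` A \<subseteq> A" "a ` A \<subseteq> A"
    have ab: "bij_betw a ?D ?D" and sb: "bij_betw s ?D ?D" using permutes_imp_bij a(1) s by blast+
    have sA: "s ` A \<subseteq> A"
    proof (rule image_subsetI)
      fix d assume d: "d \<in> A"
      then have "a d \<in> A" "a (a d) = d" using h(1,4) a(2) by blast+
      then show "s d \<in> A" using h(3) by (metis comp_apply image_subset_iff)
    qed
    have "0 \<in> A"
    proof (rule ccontr)
      assume "0 \<notin> A"
      moreover have "0 \<in> ?D" using n unfolding darts_def by simp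
      ultimately have "0 \<in> ?D - A" by blast
      then have "d \<in> ?D - A" if "d \<in> ?D" for d
        using reach[OF inv_set_compl[OF fin ab h(1,4)] inv_set_compl[OF fin sb h(1) sA]] that by blast
      then show False using h(1,2) by blast
    qed
    then show "A = ?D" using reach[OF h(4) sA] h(1) by blast
  qed
qed

definition proper :: "nat \<Rightarrow> (nat \<Rightarrow> nat) \<Rightarrow> (nat \<Rightarrow> nat) \<Rightarrow> (nat \<Rightarrow> nat) set" where
  "proper n a s = {c \<in> darts n \<rightarrow>\<^sub>E {0..<3}. \<forall>d\<in>darts n. c (s d) = c d \<and> c (a d) \<noteq> c d}"

text \<open>At \<nu> = 0 a colouring contributes a positive power of 0 unless no edge is
  monochromatic, in which case it contributes 0 ^ 0 = 1.\<close>

lemma potts_3_0: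
  assumes a: "a permutes darts n" "\<And>d. d \<in> darts n \<Longrightarrow> a (a d) = d"
  shows "potts 3 0 n a s = of_nat (card (proper n a s))"
proof -
  let ?D = "darts n"
  let ?C = "{c \<in> ?D \<rightarrow>\<^sub>E {0..<3::nat}. \<forall>d\<in>?D. c (s d) = c d}"
  let ?M = "\<lambda>c. {e \<in> cycs a ?D. \<forall>d\<in>e. \<forall>d'\<in>e. c d = (c d' :: nat)}"
  have fin: "finite ?D" unfolding darts_def by simp
  have orb: "orb a d = {d, a d}" if "d \<in> ?D" for d
  proof
    show "orb a d \<subseteq> {d, a d}" using a(2)[OF that] by (intro orb_minimal) auto
    show "{d, a d} \<subseteq> orb a d" by (simp add: orb_self orb_step)
  qed
  have M: "?M c = {} \<longleftrightarrow> (\<forall>d\<in>?D. c (a d) \<noteq> c d)" for c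
  proof
    assume e: "?M c = {}"
    show "\<forall>d\<in>?D. c (a d) \<noteq> c d"
    proof (intro ballI notI)
      fix d assume d: "d \<in> ?D" "c (a d) = c d"
      have "orb a d \<in> cycs a ?D" using d(1) unfolding cycs_def by blast
      moreover have "\<forall>x\<in>orb a d. \<forall>y\<in>orb a d. c x = c y" using d(2) unfolding orb[OF d(1)] by simp
      ultimately show False using e by blast
    qed
  next
    assume h: "\<forall>d\<in>?D. c (a d) \<noteq> c d"
    show "?M c = {}"
    proof (rule ccontr)
      assume "?M c \<noteq> {}"
      then obtain d where d: "d \<in> ?D" "\<forall>x\<in>orb a d. \<forall>y\<in>orb a d. c x = c y" unfolding cycs_def by blast
      then have "c (a d) = c d" unfolding orb[OF d(1)] by blast
      then show False using h d(1) by blast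
    qed
  qed
  have zero_pow: "(0::rat) ^ card X = (if X = {} then 1 else 0)" if "finite X" for X :: "nat set set"
    using that by (simp add: power_0_left)
  have finM: "finite (?M c)" for c unfolding cycs_def using fin by simp
  have finC: "finite ?C" 
    by (rule finite_subset[OF _ finite_PiE[of ?D "\<lambda>_. {0..<3::nat}"]]) (use fin in auto)
  have "potts 3 0 n a s = (\<Sum>c\<in>?C. if \<forall>d\<in>?D. c (a d) \<noteq> c d then 1 else 0)"
    unfolding potts_def
  proof (rule sum.cong[OF refl])
    fix c assume "c \<in> ?C"
    have "(0::rat) ^ card (?M c) = (if ?M c = {} then 1 else 0)" by (rule zero_pow[OF finM])
    then show "(0::rat) ^ card (?M c) = (if \<forall>d\<in>?D. c (a d) \<noteq> c d then 1 else 0)" unfolding M .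
  qed
  also have "\<dots> = of_nat (card {c \<in> ?C. \<forall>d\<in>?D. c (a d) \<noteq> c d})"
    using finC by (simp add: sum.If_cases Int_def)
  also have "{c \<in> ?C. \<forall>d\<in>?D. c (a d) \<noteq> c d} = proper n a s" unfolding proper_def by auto
  finally show ?thesis .
qed

lemma is_inv_darts:
  assumes "is_inv (darts n) a"
  shows "a permutes darts n" "\<And>d. a (a d) = d"
proof -
  show "a permutes darts n" using assms unfolding is_inv_def by blast
  show "a (a d) = d" for d
    using is_invD(3)[OF assms, of d] is_invD(4)[OF assms, of d] by (cases "d \<in> darts n") simp_all
qed

lemma near_tri_of_pmap:
  assumes n: "n > 0" and pm: "pmap (darts n) l \<tau> a c" and l: "l \<noteq> []" "hd l = 0"
  shows "near_tri n a (face_perm l \<tau> \<circ> a)" "root_face_deg a (face_perm l \<tau> \<circ> a) = length l"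
    "c \<in> proper n a (face_perm l \<tau> \<circ> a)"
proof -
  let ?D = "darts n" and ?f = "face_perm l \<tau>"
  note P = pmapD[OF pm]
  note a = is_inv_darts[OF P(6)]
  have sa: "?f \<circ> a \<circ> a = ?f" using a(2) by (simp add: fun_eq_iff)
  have fin: "finite ?D" "card ?D = 2 * n" unfolding darts_def by auto
  have D0: "0 \<in> ?D" "?D \<noteq> {}" using n unfolding darts_def by auto
  have fo: "?f d = d" if "d \<notin> ?D" for d
    using that P(3) triD(4)[OF P(5), of d] unfolding face_perm_def by auto
  have fp: "?f permutes ?D" by (rule bij_imp_permutes[OF P(10) fo])
  have sp: "?f \<circ> a permutes ?D" using permutes_compose[OF a(1) fp] .
  have 0: "0 \<in> set l" using l by (cases l) auto
  have nxl: "nx l (hd l) ` set l \<subseteq> set l" using nx_bij[OF P(2)] by (auto simp: bij_betw_def)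
  have orbl: "orb ?f d = set l" if "d \<in> set l" for d
    using orb_cong[OF that nxl, of ?f] orb_nx[OF P(2) that] unfolding face_perm_def by simp
  have e1: "6 * ncyc (?f \<circ> a) ?D = 2 * n + 2 * length l + 6" using P(8) D0(2) fin(2) by simp
  have e2: "3 * ncyc ?f ?D + length l = 2 * n + 3" using ncyc_face[OF P(1,2) l(1) P(3,5)] fin(2) by simp
  show "root_face_deg a (?f \<circ> a) = length l"
    unfolding root_face_deg_def sa orbl[OF 0] using P(2) by (rule distinct_card)
  have "planar_map n a (?f \<circ> a)"
    unfolding planar_map_def
  proof (intro conjI)
    show "\<forall>d\<in>?D. a d \<noteq> d \<and> a (a d) = d" using is_invD(2,3)[OF P(6)] by blast
    show "\<forall>d\<in>?D. (0, d) \<in> ({(x, a x) |x. x \<in> ?D} \<union> {(x, (?f \<circ> a) x) |x. x \<in> ?D})\<^sup>*"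
      using conn_iff_reachable[OF a(1) _ sp n] a(2) P(7) sa unfolding edge_rel_def by simp
    show "card (cycs (?f \<circ> a) ?D) + card (cycs (?f \<circ> a \<circ> a) ?D) = n + 2"
      using e1 e2 unfolding sa ncyc_def by simp
  qed (fact a sp)+
  moreover have "card (orb ?f d) = 3" if d: "d \<in> ?D" "orb ?f d \<noteq> orb ?f 0" for d
  proof -
    have dl: "d \<in> ?D - set l" using d orbl[OF 0] orbl by auto
    note T = triD[OF P(5)]
    have t: "\<tau> ` (?D - set l) \<subseteq> ?D - set l" using T(1) by blast
    have "orb ?f d = orb \<tau> d" by (rule orb_cong[OF dl t]) (simp add: face_perm_def)
    also have "\<dots> = {d, \<tau> d, \<tau> (\<tau> d)}"
    proof
      show "orb \<tau> d \<subseteq> {d, \<tau> d, \<tau> (\<tau> d)}" using T(3)[OF dl] by (intro orb_minimal) auto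
      show "{d, \<tau> d, \<tau> (\<tau> d)} \<subseteq> orb \<tau> d" by (simp add: orb_self orb_step)
    qed
    also have "card \<dots> = 3"
    proof -
      have "\<tau> d \<noteq> d" "\<tau> (\<tau> d) \<noteq> \<tau> d" using T(2)[OF dl] T(2)[OF T(1)[OF dl]] by auto
      moreover have "\<tau> (\<tau> d) \<noteq> d" using T(3)[OF dl] T(2)[OF dl] by auto
      ultimately show ?thesis by auto
    qed
    finally show ?thesis .
  qed
  ultimately show "near_tri n a (?f \<circ> a)" unfolding near_tri_def sa by blast
  note C = colouredD[OF P(9)]
  show "c \<in> proper n a (?f \<circ> a)"
    unfolding proper_def
  proof (intro CollectI conjI ballI)
    fix d assume d: "d \<in> ?D"
    have "a d \<in> ?D" using is_invD(1)[OF P(6) d] .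
    then show "c ((?f \<circ> a) d) = c d" using C(3) a(2) by simp
    show "c (a d) \<noteq> c d" using C(4)[OF d] .
  qed (fact C(1))
qed

lemma pmap_of_near_tri:
  assumes n: "n > 0" and nt: "near_tri n a s" and c: "c \<in> proper n a s"
  obtains l \<tau> where "pmap (darts n) l \<tau> a c" "l \<noteq> []" "hd l = 0" "s = face_perm l \<tau> \<circ> a"
proof -
  let ?D = "darts n" and ?f = "s \<circ> a"
  have pm: "planar_map n a s" using nt unfolding near_tri_def by blast
  have ap: "a permutes ?D" and sp: "s permutes ?D" and ai: "\<forall>d\<in>?D. a d \<noteq> d \<and> a (a d) = d"
    and re: "\<forall>d\<in>?D. (0, d) \<in> (edge_rel n a s)\<^sup>*" and eu: "ncyc s ?D + ncyc ?f ?D = n + 2"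
    using pm unfolding planar_map_def edge_rel_def ncyc_def by blast+
  have inv: "is_inv ?D a" unfolding is_inv_def using ap ai by blast
  note aa = is_inv_darts(2)[OF inv]
  have fin: "finite ?D" "card ?D = 2 * n" unfolding darts_def by auto
  have D0: "0 \<in> ?D" "?D \<noteq> {}" using n unfolding darts_def by auto
  have fp: "?f permutes ?D" using permutes_compose[OF ap sp] .
  have fb: "bij_betw ?f ?D ?D" using fp by (rule permutes_imp_bij)
  obtain l where l: "distinct l" "l \<noteq> []" "hd l = 0" "set l = orb ?f 0" "\<And>d. d \<in> set l \<Longrightarrow> nx l (hd l) d = ?f d"
    using orb_list[OF fp fin(1), of 0] by blast
  define \<tau> where "\<tau> = (\<lambda>d. if d \<in> set l then d else ?f d)"
  have ff: "face_perm l \<tau> = ?f" unfolding face_perm_def \<tau>_def using l(5) by auto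
  have lD: "set l \<subseteq> ?D" unfolding l(4) by (rule orb_subset[OF fb D0(1)])
  have cl: "?f ` (?D - set l) \<subseteq> ?D - set l"
    by (rule inv_set_compl[OF fin(1) fb lD]) (simp only: l(4) orb_invariant)
  have t: "tri (?D - set l) \<tau>"
  proof (rule triI)
    fix d assume d: "d \<in> ?D - set l"
    have i: "?f d \<in> ?D - set l" "?f (?f d) \<in> ?D - set l" using cl d by blast+
    have e: "\<tau> d = ?f d" "\<tau> (?f d) = ?f (?f d)" "\<tau> (?f (?f d)) = ?f (?f (?f d))"
      using d i unfolding \<tau>_def by simp_all
    have "orb ?f d \<noteq> orb ?f 0" using d orb_self[of d ?f] l(4) by blast
    then have c3: "card (orb ?f d) = 3" using nt d unfolding near_tri_def by blast
    have dD: "d \<in> ?D" using d by blast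
    show "\<tau> d \<in> ?D - set l \<and> \<tau> d \<noteq> d \<and> \<tau> (\<tau> (\<tau> d)) = d"
      unfolding e using i(1) orb_card_3[OF fin(1) fb dD c3] by blast
  next
    fix d assume "d \<notin> ?D - set l"
    then show "\<tau> d = d" using permutes_not_in[OF fp, of d] unfolding \<tau>_def by auto
  qed
  have fa: "?f \<circ> a = s" using aa by (simp add: fun_eq_iff)
  have e2: "3 * ncyc ?f ?D + length l = 2 * n + 3"
    using ncyc_face[OF fin(1) l(1,2) lD t] fin(2) unfolding ff by simp
  have "pmap ?D l \<tau> a c"
    unfolding pmap_def ff fa
  proof (intro conjI)
    show "conn ?D ?f a" using conn_iff_reachable[OF ap _ sp n] ai re by blast
    have "6 * ncyc s ?D = card ?D + 2 * length l + 6" using e2 eu fin(2) by linarith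
    then show "?D = {} \<or> 6 * ncyc s ?D = card ?D + 2 * length l + 6" by blast
    show "coloured ?D ?f a c"
      unfolding coloured_def
    proof (intro conjI ballI)
      show "c \<in> ?D \<rightarrow>\<^sub>E {0..<3}" using c unfolding proper_def by blast
      fix d assume d: "d \<in> ?D"
      have "a d \<in> ?D" using is_invD(1)[OF inv d] .
      then show "c (?f d) = c (a d)" using c unfolding proper_def by simp
      show "c (a d) \<noteq> c d" using c d unfolding proper_def by blast
    qed
    show "?D = {} \<or> l \<noteq> []" using l(2) by blast
  qed (fact fin l lD t inv)+
  then show thesis using that l(2,3) ff fa by metis
qed

definition rpmaps :: "nat \<Rightarrow> nat \<Rightarrow> (nat list \<times> (nat \<Rightarrow> nat) \<times> (nat \<Rightarrow> nat) \<times> (nat \<Rightarrow> nat)) set" where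
  "rpmaps n i = {(l, \<tau>, a, c). pmap (darts n) l \<tau> a c \<and> l \<noteq> [] \<and> hd l = 0 \<and> length l = i}"

text \<open>The count in \<open>card_rooted\<close> does not depend on the root colour; the factor 3
  is the number of root colours.\<close>

lemma card_rpmaps:
  assumes n: "n > 0"
  shows "card (rpmaps n i) = 3 * (fact (2 * n - 1) * (\<Sum>w | length w = i. wcount n w))"
proof -
  let ?D = "darts n" and ?W = "{w :: bool list. length w = i}"
  have fin: "finite ?D" "card ?D = 2 * n" "0 \<in> ?D" using n unfolding darts_def by auto
  have finW: "finite ?W" using finite_lists_length_eq[of "UNIV :: bool set" i] by simp
  have finr: "finite (rooted ?D 0 w k)" for w k
    by (rule finite_subset[OF _ finite_pmaps[OF fin(1), of w k]]) (auto simp: rooted_def)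
  have U: "rpmaps n i = (\<Union>(k, w)\<in>{0..<3} \<times> ?W. rooted ?D 0 w k)"
  proof
    show "rpmaps n i \<subseteq> (\<Union>(k, w)\<in>{0..<3} \<times> ?W. rooted ?D 0 w k)"
    proof
      fix z assume z: "z \<in> rpmaps n i"
      obtain l \<tau> a c where zz: "z = (l, \<tau>, a, c)" by (cases z)
      have h: "pmap ?D l \<tau> a c" "l \<noteq> []" "hd l = 0" "length l = i" using z unfolding zz rpmaps_def by auto
      have "c 0 < 3" using colouredD(2)[OF pmapD(9)[OF h(1)] fin(3)] .
      moreover have "z \<in> rooted ?D 0 (map (step c a) l) (c 0)" unfolding zz rooted_def pmaps_def using h by simp
      ultimately show "z \<in> (\<Union>(k, w)\<in>{0..<3} \<times> ?W. rooted ?D 0 w k)" using h(4) by force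
    qed
    show "(\<Union>(k, w)\<in>{0..<3} \<times> ?W. rooted ?D 0 w k) \<subseteq> rpmaps n i"
      unfolding rooted_def pmaps_def rpmaps_def by auto
  qed
  have "card (\<Union>p\<in>{0..<3} \<times> ?W. (\<lambda>(k, w). rooted ?D 0 w k) p) = (\<Sum>p\<in>{0..<3} \<times> ?W. card ((\<lambda>(k, w). rooted ?D 0 w k) p))"
  proof (rule card_UN_disjoint)
    show "finite ({0..<3::nat} \<times> ?W)" using finW by simp
    show "\<forall>p\<in>{0..<3} \<times> ?W. finite ((\<lambda>(k, w). rooted ?D 0 w k) p)" using finr by auto
    show "\<forall>p\<in>{0..<3} \<times> ?W. \<forall>q\<in>{0..<3} \<times> ?W. p \<noteq> q \<longrightarrow>
        (\<lambda>(k, w). rooted ?D 0 w k) p \<inter> (\<lambda>(k, w). rooted ?D 0 w k) q = {}"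
      unfolding rooted_def pmaps_def by auto
  qed
  also have "\<dots> = (\<Sum>p\<in>{0..<3::nat} \<times> ?W. fact (2 * n - 1) * wcount n (snd p))"
    by (rule sum.cong[OF refl]) (use card_rooted[OF fin(1,3)] fin(2) in auto)
  also have "\<dots> = (\<Sum>k\<in>{0..<3::nat}. \<Sum>w\<in>?W. fact (2 * n - 1) * wcount n w)"
    by (subst sum.cartesian_product) (simp add: case_prod_unfold)
  also have "\<dots> = 3 * (fact (2 * n - 1) * (\<Sum>w\<in>?W. wcount n w))" by (simp add: sum_distrib_left)
  finally show ?thesis unfolding U .
qed

text \<open>The denominator of \<open>nt_coeff\<close>, q (2 n - 1)! with q = 3, is the factor in
  \<open>card_rpmaps\<close>. It remains to match face lists with properly coloured rotation
  systems, which \<Phi> does by forgetting how the face permutation is split into outer list and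
  triangles.\<close>

lemma nt_coeff_wcount: "nt_coeff 3 0 n i = of_nat (\<Sum>w | length w = i. wcount n w)"
proof (cases "n = 0")
  case True
  have "(\<Sum>w | length w = i. wcount 0 w) = (if i = 0 then 1 else 0)"
  proof (cases "i = 0")
    case False
    then have "(\<Sum>w | length w = i. wcount 0 w) = 0" by (intro sum.neutral) auto
    then show ?thesis using False by simp
  qed simp
  then show ?thesis using True unfolding nt_coeff_def by simp
next
  case False
  then have n: "n > 0" by simp
  let ?D = "darts n"
  have fin: "finite ?D" unfolding darts_def by simp
  let ?N = "{(a, s). near_tri n a s \<and> root_face_deg a s = i}"
  let ?Z = "SIGMA p:?N. proper n (fst p) (snd p)"
  have finN: "finite ?N"
  proof (rule finite_subset)
    show "?N \<subseteq> {a. a permutes ?D} \<times> {s. s permutes ?D}" unfolding near_tri_def planar_map_def by auto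
    show "finite ({a. a permutes ?D} \<times> {s. s permutes ?D})" using fin by (intro finite_cartesian_product finite_permutations)
  qed
  have finP: "finite (proper n a s)" for a s
    by (rule finite_subset[OF _ finite_PiE[of ?D "\<lambda>_. {0..<3::nat}"]]) (use fin in \<open>auto simp: proper_def\<close>)
  define \<Phi> :: "nat list \<times> (nat \<Rightarrow> nat) \<times> (nat \<Rightarrow> nat) \<times> (nat \<Rightarrow> nat) \<Rightarrow> _"
    where "\<Phi> = (\<lambda>(l, \<tau>, a, c). ((a, face_perm l \<tau> \<circ> a), c))"
  have inj: "inj_on \<Phi> (rpmaps n i)"
  proof (rule inj_onI)
    fix z y assume z: "z \<in> rpmaps n i" and y: "y \<in> rpmaps n i" and eq: "\<Phi> z = \<Phi> y"
    obtain l \<tau> a c where zz: "z = (l, \<tau>, a, c)" by (cases z)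
    obtain m \<nu> b e where yy: "y = (m, \<nu>, b, e)" by (cases y)
    have h: "pmap ?D l \<tau> a c" "l \<noteq> []" "hd l = 0" "length l = i" using z unfolding zz rpmaps_def by auto
    have g: "pmap ?D m \<nu> b e" "m \<noteq> []" "hd m = 0" "length m = i" using y unfolding yy rpmaps_def by auto
    have ab: "b = a" "e = c" and fa: "face_perm l \<tau> \<circ> a = face_perm m \<nu> \<circ> a"
      using eq unfolding \<Phi>_def zz yy by auto
    note aa = is_inv_darts(2)[OF pmapD(6)[OF h(1)]]
    have ff: "face_perm l \<tau> = face_perm m \<nu>"
    proof
      fix d show "face_perm l \<tau> d = face_perm m \<nu> d" using fun_cong[OF fa, of "a d"] aa by simp
    qed
    \<comment> \<open>The list is recovered by iterating the face permutation from the root dart 0,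
      its known head.\<close>
    have lm: "l = m"
    proof (rule nth_equalityI)
      show "length l = length m" using h(4) g(4) by simp
      fix j assume j: "j < length l"
      then show "l ! j = m ! j"
        using face_perm_funpow[OF pmapD(2)[OF h(1)], of j \<tau>] face_perm_funpow[OF pmapD(2)[OF g(1)], of j \<nu>]
          h(3,4) g(3,4) ff by simp
    qed
    have "\<tau> d = \<nu> d" for d
    proof (cases "d \<in> set l")
      case True
      then show ?thesis
        using triD(4)[OF pmapD(5)[OF h(1)], of d] triD(4)[OF pmapD(5)[OF g(1)], of d] lm by simp
    next
      case False
      then show ?thesis using fun_cong[OF ff, of d] lm unfolding face_perm_def by simp
    qed
    then have "\<tau> = \<nu>" by (rule ext)
    then show "z = y" unfolding zz yy ab lm by simp
  qed
  have im: "\<Phi> ` rpmaps n i = ?Z"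
  proof
    show "\<Phi> ` rpmaps n i \<subseteq> ?Z"
    proof (rule image_subsetI)
      fix z assume z: "z \<in> rpmaps n i"
      obtain l \<tau> a c where zz: "z = (l, \<tau>, a, c)" by (cases z)
      have h: "pmap ?D l \<tau> a c" "l \<noteq> []" "hd l = 0" "length l = i" using z unfolding zz rpmaps_def by auto
      show "\<Phi> z \<in> ?Z" unfolding \<Phi>_def zz using near_tri_of_pmap[OF n h(1-3)] h(4) by simp
    qed
    show "?Z \<subseteq> \<Phi> ` rpmaps n i"
    proof
      fix z assume z: "z \<in> ?Z"
      obtain a s c where zz: "z = ((a, s), c)" by (metis surj_pair)
      have h: "near_tri n a s" "root_face_deg a s = i" "c \<in> proper n a s" using z unfolding zz by auto
      obtain l \<tau> where l: "pmap ?D l \<tau> a c" "l \<noteq> []" "hd l = 0" "s = face_perm l \<tau> \<circ> a"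
        using pmap_of_near_tri[OF n h(1,3)] .
      have "length l = i" using near_tri_of_pmap(2)[OF n l(1-3)] h(2) l(4) by simp
      then have "(l, \<tau>, a, c) \<in> rpmaps n i" unfolding rpmaps_def using l(1-3) by simp
      moreover have "z = \<Phi> (l, \<tau>, a, c)" unfolding zz \<Phi>_def l(4) by simp
      ultimately show "z \<in> \<Phi> ` rpmaps n i" by (rule rev_image_eqI)
    qed
  qed
  have "(\<Sum>(a, s)\<in>?N. potts 3 0 n a s) = (\<Sum>p\<in>?N. of_nat (card (proper n (fst p) (snd p))))"
  proof (rule sum.cong[OF refl])
    fix p assume p: "p \<in> ?N"
    obtain a s where pp: "p = (a, s)" by (cases p)
    have "planar_map n a s" using p unfolding pp near_tri_def by auto
    then have "a permutes ?D" "\<And>d. d \<in> ?D \<Longrightarrow> a (a d) = d" unfolding planar_map_def by blast+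
    then show "(case p of (a, s) \<Rightarrow> potts 3 0 n a s) = of_nat (card (proper n (fst p) (snd p)))"
      unfolding pp using potts_3_0 by simp
  qed
  also have "\<dots> = of_nat (card ?Z)"
    using card_SigmaI[OF finN, of "\<lambda>p. proper n (fst p) (snd p)"] finP by simp
  also have "card ?Z = 3 * (fact (2 * n - 1) * (\<Sum>w | length w = i. wcount n w))"
    using card_image[OF inj] im card_rpmaps[OF n] by simp
  finally have "(\<Sum>(a, s)\<in>?N. potts 3 0 n a s) = 3 * fact (2 * n - 1) * of_nat (\<Sum>w | length w = i. wcount n w)"
    by (simp add: of_nat_fact mult.assoc)
  then show ?thesis using n unfolding nt_coeff_def by simp
qed

section \<open>Linear recursions for the outer series\<close>

definition wser :: "bool list \<Rightarrow> rat fps" where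
  "wser w = Abs_fps (\<lambda>n. of_nat (wcount n w))"

lemma wser_Nil: "wser [] = 1"
proof (rule fps_ext)
  fix n show "wser [] $ n = 1 $ n" by (cases n) (simp_all add: wser_def)
qed

lemma wser_Cons: "wser (x # u) = fps_X * (wser ((\<not> x) # (\<not> x) # u) +
   (\<Sum>i<length u. if u ! i = (\<not> x) then wser (take i u) * wser (drop (Suc i) u) else 0))"
proof (rule fps_ext)
  fix n
  show "wser (x # u) $ n = (fps_X * (wser ((\<not> x) # (\<not> x) # u) +
   (\<Sum>i<length u. if u ! i = (\<not> x) then wser (take i u) * wser (drop (Suc i) u) else 0))) $ n"
  proof (cases n)
    case 0
    then show ?thesis by (simp add: wser_def)
  next
    case (Suc m)
    have I: "{i. i < length u \<and> u ! i = (\<not> x)} = {i \<in> {..<length u}. u ! i = (\<not> x)}" by auto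
    have prod: "(wser v * wser w) $ m = of_nat (\<Sum>j\<le>m. wcount j v * wcount (m - j) w)" for v w
      by (simp add: wser_def fps_mult_nth atLeast0AtMost)
    have "(\<Sum>i<length u. if u ! i = (\<not> x) then wser (take i u) * wser (drop (Suc i) u) else 0) $ m
      = (\<Sum>i<length u. if u ! i = (\<not> x) then (wser (take i u) * wser (drop (Suc i) u)) $ m else 0)"
      unfolding fps_sum_nth by (rule sum.cong) auto
    also have "\<dots> = of_nat (\<Sum>i | i < length u \<and> u ! i = (\<not> x).
        \<Sum>j\<le>m. wcount j (take i u) * wcount (m - j) (drop (Suc i) u))"
      unfolding prod I of_nat_sum[of _ "{i \<in> {..<length u}. u ! i = (\<not> x)}"] by (rule sum.inter_filter[symmetric]) simp
    finally show ?thesis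
      unfolding Suc by (simp add: wser_def)
  qed
qed

lemma wser_rotate: "wser (x # u) = wser (u @ [x])"
  unfolding wser_def wcount_rotate ..

text \<open>Words over the letters X = A + B (False) and Y = A - B (True), where A and B (True and
  False in \<^const>\<open>wser\<close>) are the two kinds of boundary edges.\<close>

fun lin :: "bool list \<Rightarrow> (bool list \<Rightarrow> rat fps) \<Rightarrow> rat fps" where
  "lin [] f = f []"
| "lin (y # v) f = lin v (\<lambda>w. f (True # w)) + (if y then -1 else 1) * lin v (\<lambda>w. f (False # w))"

lemma lin_add: "lin v (\<lambda>w. f w + g w) = lin v f + lin v g"
  by (induction v arbitrary: f g) (simp_all add: algebra_simps)

lemma lin_mult: "lin v (\<lambda>w. c * f w) = c * lin v f"
  by (induction v arbitrary: f) (simp_all add: algebra_simps)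

lemma lin_zero: "lin v (\<lambda>w. 0) = 0"
  by (induction v) simp_all

lemma lin_sum: "finite I \<Longrightarrow> lin v (\<lambda>w. \<Sum>i\<in>I. f i w) = (\<Sum>i\<in>I. lin v (f i))"
  by (induction I rule: finite_induct) (simp_all add: lin_add lin_zero)

lemma lin_cong: "(\<And>w. length w = length v \<Longrightarrow> f w = g w) \<Longrightarrow> lin v f = lin v g"
proof (induction v arbitrary: f g)
  case (Cons y v)
  have "lin v (\<lambda>w. f (x # w)) = lin v (\<lambda>w. g (x # w))" for x by (rule Cons.IH) (use Cons.prems in simp)
  then show ?case by simp
qed simp

lemma lin_append: "lin (u @ [y]) f = lin u (\<lambda>w. f (w @ [True])) + (if y then -1 else 1) * lin u (\<lambda>w. f (w @ [False]))"
  by (induction u arbitrary: f) (simp_all add: algebra_simps)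

text \<open>Fixing the letter at position i keeps only its coefficient in X or Y, which is -1 for B
  in Y and 1 otherwise. The two sides then expand independently.\<close>

lemma lin_split:
  "i < length v \<Longrightarrow> lin v (\<lambda>w. if w ! i = b then f (take i w) * g (drop (Suc i) w) else 0) =
     (if v ! i \<and> \<not> b then -1 else 1) * (lin (take i v) f * lin (drop (Suc i) v) g)"
proof (induction v arbitrary: i f)
  case (Cons y v)
  show ?case
  proof (cases i)
    case 0
    then show ?thesis by (cases b) (simp_all add: lin_mult lin_zero)
  next
    case (Suc j)
    have "lin v (\<lambda>w. if w ! j = b then f (x # take j w) * g (drop (Suc j) w) else 0) =
        (if v ! j \<and> \<not> b then -1 else 1) * (lin (take j v) (\<lambda>w. f (x # w)) * lin (drop (Suc j) v) g)" for x
      using Cons.IH[of j "\<lambda>w. f (x # w)"] Cons.prems Suc by simp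
    then show ?thesis
      unfolding Suc lin.simps nth_Cons_Suc take_Suc_Cons drop_Suc_Cons by (simp add: algebra_simps)
  qed
qed simp

definition xy :: "bool list \<Rightarrow> rat fps" where
  "xy v = lin v wser"

lemma lin_wser_Cons: "lin u (\<lambda>w. wser (x # w)) = fps_X * (lin u (\<lambda>w. wser ((\<not> x) # (\<not> x) # w)) +
    (\<Sum>i<length u. (if u ! i \<and> x then -1 else 1) * (xy (take i u) * xy (drop (Suc i) u))))"
proof -
  have "lin u (\<lambda>w. wser (x # w)) = lin u (\<lambda>w. fps_X * (wser ((\<not> x) # (\<not> x) # w) +
      (\<Sum>i<length u. if w ! i = (\<not> x) then wser (take i w) * wser (drop (Suc i) w) else 0)))"
    by (rule lin_cong, subst wser_Cons) simp
  also have "\<dots> = fps_X * (lin u (\<lambda>w. wser ((\<not> x) # (\<not> x) # w)) +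
      (\<Sum>i<length u. lin u (\<lambda>w. if w ! i = (\<not> x) then wser (take i w) * wser (drop (Suc i) w) else 0)))"
    by (simp add: lin_mult lin_add lin_sum)
  also have "(\<Sum>i<length u. lin u (\<lambda>w. if w ! i = (\<not> x) then wser (take i w) * wser (drop (Suc i) w) else 0)) =
      (\<Sum>i<length u. (if u ! i \<and> x then -1 else 1) * (xy (take i u) * xy (drop (Suc i) u)))"
    unfolding xy_def by (rule sum.cong[OF refl], subst lin_split) simp_all
  finally show ?thesis .
qed

text \<open>The equations for A and B are added, and BB + AA = (XX + YY) / 2. At a letter X of u the
  two cuts agree and double; at a letter Y they have opposite signs and cancel.\<close>

lemma xy_X: "2 * xy (False # u) = fps_X * (xy (False # False # u) + xy (True # True # u)) +
   4 * fps_X * (\<Sum>i<length u. if u ! i then 0 else xy (take i u) * xy (drop (Suc i) u))"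
proof -
  let ?P = "\<lambda>i. xy (take i u) * xy (drop (Suc i) u)"
  have "(\<Sum>i<length u. (if u ! i then -1 else 1) * ?P i) + (\<Sum>i<length u. ?P i)
      = 2 * (\<Sum>i<length u. if u ! i then 0 else ?P i)"
    unfolding sum.distrib[symmetric] sum_distrib_left by (rule sum.cong) auto
  then have *: "fps_X * (\<Sum>i<length u. (if u ! i then -1 else 1) * ?P i) + fps_X * (\<Sum>i<length u. ?P i)
      = 2 * fps_X * (\<Sum>i<length u. if u ! i then 0 else ?P i)"
    by (metis (no_types, lifting) distrib_left mult.assoc mult.left_commute)
  have "xy (False # u) = fps_X * (lin u (\<lambda>w. wser (False # False # w)) + lin u (\<lambda>w. wser (True # True # w)))
     + (fps_X * (\<Sum>i<length u. (if u ! i then -1 else 1) * ?P i) + fps_X * (\<Sum>i<length u. ?P i))"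
    unfolding xy_def[of "False # u"] by (simp add: lin_wser_Cons algebra_simps)
  then show ?thesis
    unfolding * xy_def[of "False # False # u"] xy_def[of "True # True # u"] by (simp add: algebra_simps)
qed

text \<open>Subtracting the equations instead gives BB - AA = -(XY + YX) / 2 and keeps only the cuts
  at letters Y. So a strand starting at Y slides past an X or ends at another Y.\<close>

lemma xy_Y: "2 * xy (True # u) = - (fps_X * (xy (False # True # u) + xy (True # False # u))) -
   4 * fps_X * (\<Sum>i<length u. if u ! i then xy (take i u) * xy (drop (Suc i) u) else 0)"
proof -
  let ?P = "\<lambda>i. xy (take i u) * xy (drop (Suc i) u)"
  have "(\<Sum>i<length u. (if u ! i then -1 else 1) * ?P i) - (\<Sum>i<length u. ?P i)
      = - 2 * (\<Sum>i<length u. if u ! i then ?P i else 0)"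
    unfolding sum_subtractf[symmetric] sum_distrib_left by (rule sum.cong) auto
  then have *: "fps_X * (\<Sum>i<length u. (if u ! i then -1 else 1) * ?P i) - fps_X * (\<Sum>i<length u. ?P i)
      = - 2 * fps_X * (\<Sum>i<length u. if u ! i then ?P i else 0)"
    by (metis (no_types, lifting) right_diff_distrib mult.assoc mult.left_commute)
  have "xy (True # u) = fps_X * (lin u (\<lambda>w. wser (False # False # w)) - lin u (\<lambda>w. wser (True # True # w)))
     + (fps_X * (\<Sum>i<length u. (if u ! i then -1 else 1) * ?P i) - fps_X * (\<Sum>i<length u. ?P i))"
    unfolding xy_def[of "True # u"] by (simp add: lin_wser_Cons algebra_simps)
  then have "2 * xy (True # u) = 2 * (fps_X * (lin u (\<lambda>w. wser (False # False # w)) - lin u (\<lambda>w. wser (True # True # w)))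
     + (- 2 * fps_X * (\<Sum>i<length u. if u ! i then ?P i else 0)))"
    unfolding * by (rule arg_cong)
  then show ?thesis
    unfolding xy_def[of "False # True # u"] xy_def[of "True # False # u"] by (simp add: algebra_simps)
qed

lemma xy_rotate: "xy (y # u) = xy (u @ [y])"
  unfolding xy_def lin_append by (simp add: wser_rotate)

text \<open>The colour returns to its start after one turn around the outer face. In the recursion
  this is x = -2 x mod 3 for an opened triangle, while the two letters of a bridge cancel.\<close>

lemma wcount_eq_0: "(\<Sum>x\<leftarrow>w. if x then 1 else -1 :: int) mod 3 \<noteq> 0 \<Longrightarrow> wcount n w = 0"
proof (induction n w rule: wcount.induct)
  case (3 n x u)
  let ?s = "\<lambda>w. \<Sum>x\<leftarrow>w. if x then 1 else -1 :: int"
  have 1: "wcount n ((\<not> x) # (\<not> x) # u) = 0"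
    by (rule 3(1)) (use 3(4) in \<open>cases x; simp; presburger\<close>)
  have "wcount m (take i u) * wcount (n - m) (drop (Suc i) u) = 0"
    if i: "i < length u" "u ! i = (\<not> x)" and m: "m \<in> {..n}" for i m
  proof -
    have "u = take i u @ (\<not> x) # drop (Suc i) u" using id_take_nth_drop[OF i(1)] i(2) by simp
    then have "?s u = ?s (take i u @ (\<not> x) # drop (Suc i) u)" by simp
    then have "?s u = ?s (take i u) + (if x then -1 else 1) + ?s (drop (Suc i) u)" by simp
    then have "?s (x # u) = ?s (take i u) + ?s (drop (Suc i) u)" by (cases x) simp_all
    then have "?s (take i u) mod 3 \<noteq> 0 \<or> ?s (drop (Suc i) u) mod 3 \<noteq> 0" using 3(4) by presburger
    then show ?thesis using 3(2)[of i m] 3(3)[of i m] i m by auto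
  qed
  then show ?case using 1 by simp
qed auto

section \<open>Outer series and series with one loop strand\<close>

definition outer :: "nat \<Rightarrow> rat fps" where
  "outer k = xy (replicate k False)"

definition loop :: "nat \<Rightarrow> nat \<Rightarrow> rat fps" where
  "loop j k = xy (True # replicate j False @ True # replicate k False)"

lemma lin_replicate_False: "lin (replicate k False) f = (\<Sum>w | length w = k. f w)"
proof (induction k arbitrary: f)
  case (Suc k)
  have fin: "finite {w :: bool list. length w = k}" using finite_lists_length_eq[of "UNIV :: bool set" k] by simp
  have e: "{w :: bool list. length w = Suc k} = (#) True ` {w. length w = k} \<union> (#) False ` {w. length w = k}"
    by (auto simp: length_Suc_conv image_iff)
  have "(\<Sum>w | length w = Suc k. f w) = (\<Sum>w\<in>(#) True ` {w. length w = k}. f w) + (\<Sum>w\<in>(#) False ` {w. length w = k}. f w)"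
    unfolding e by (rule sum.union_disjoint) (use fin in auto)
  also have "\<dots> = (\<Sum>w | length w = k. f (True # w)) + (\<Sum>w | length w = k. f (False # w))"
    by (simp add: sum.reindex)
  finally show ?case using Suc by simp
qed simp

lemma ntgf_outer: "ntgf 3 0 $ k = outer k"
  by (rule fps_ext) (simp add: ntgf_def nt_coeff_wcount outer_def xy_def lin_replicate_False fps_sum_nth wser_def)

lemma outer_0: "outer 0 = 1"
  unfolding outer_def xy_def by (simp add: wser_Nil)

lemma outer_1: "outer 1 = 0"
proof -
  have "wser [b] = 0" for b
    by (rule fps_ext) (cases b; simp add: wser_def wcount_eq_0)
  then show ?thesis unfolding outer_def xy_def by simp
qed

lemma outer_rec: "2 * outer (Suc k) = fps_X * (outer (k + 2) + loop 0 k) +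
    4 * fps_X * (\<Sum>i<k. outer i * outer (k - 1 - i))"
proof -
  have "(\<Sum>i<k. if replicate k False ! i then 0 else xy (take i (replicate k False)) * xy (drop (Suc i) (replicate k False)))
    = (\<Sum>i<k. outer i * outer (k - 1 - i))"
    by (rule sum.cong) (auto simp: outer_def min_def)
  then show ?thesis using xy_X[of "replicate k False"] unfolding outer_def loop_def by simp
qed

text \<open>The front Y finds a single other Y, so one product survives. When the strand slides to
  the other side, the X in front is carried to the end of the word by rotation and increases k
  instead of j.\<close>

lemma loop_rec: "2 * loop j k = - (fps_X * (loop j (Suc k) + loop (Suc j) k)) - 4 * fps_X * (outer j * outer k)"
proof -
  let ?u = "replicate j False @ True # replicate k False"
  have u: "?u ! i = (i = j)" if "i < length ?u" for i
    using that by (auto simp: nth_append nth_Cons')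
  have "(\<Sum>i<length ?u. if ?u ! i then xy (take i ?u) * xy (drop (Suc i) ?u) else 0) =
    (\<Sum>i<length ?u. if i = j then xy (take i ?u) * xy (drop (Suc i) ?u) else 0)"
    by (rule sum.cong[OF refl]) (use u in auto)
  also have "\<dots> = outer j * outer k"
    by (subst sum.delta) (simp_all add: outer_def)
  finally have s: "(\<Sum>i<length ?u. if ?u ! i then xy (take i ?u) * xy (drop (Suc i) ?u) else 0) = outer j * outer k" .
  have "xy (False # True # ?u) = xy ((True # ?u) @ [False])" by (rule xy_rotate)
  also have "\<dots> = loop j (Suc k)" unfolding loop_def by (simp add: replicate_append_same)
  finally have r: "xy (False # True # ?u) = loop j (Suc k)" .
  have "xy (True # False # ?u) = loop (Suc j) k" unfolding loop_def by simp
  then show ?thesis using xy_Y[of ?u] unfolding s r loop_def[of j k] by simp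
qed

lemma loop_sym: "loop j 0 = loop 0 j"
proof -
  have "loop 0 j = xy ((True # replicate j False) @ [True])"
    unfolding loop_def using xy_rotate[of True "True # replicate j False"] by simp
  then show ?thesis unfolding loop_def by simp
qed

section \<open>The cubic equation\<close>

text \<open>A series in t and a is represented with polynomial coefficients in a whenever a has to be
  specialized, and with coefficients in Q[[t]] after swapping.\<close>

definition swap :: "rat poly fps \<Rightarrow> rat fps fps" where
  "swap f = Abs_fps (\<lambda>k. Abs_fps (\<lambda>n. coeff (f $ n) k))"

lemma swap_nth: "swap f $ k $ n = coeff (f $ n) k"
  by (simp add: swap_def)

lemma swap_eqI: "(\<And>k n. f $ k $ n = g $ k $ n) \<Longrightarrow> f = (g :: rat fps fps)"
  by (simp add: fps_eq_iff)

lemma swap_inj: "swap f = swap g \<Longrightarrow> f = g"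
  by (rule fps_ext, rule poly_eqI) (metis swap_nth)

lemma swap_0: "swap 0 = 0" by (rule swap_eqI) (simp add: swap_nth)
lemma swap_1: "swap 1 = 1" by (rule swap_eqI) (simp add: swap_nth fps_one_nth coeff_1)
lemma swap_add: "swap (f + g) = swap f + swap g" by (rule swap_eqI) (simp add: swap_nth)
lemma swap_diff: "swap (f - g) = swap f - swap g" by (rule swap_eqI) (simp add: swap_nth)
lemma swap_uminus: "swap (- f) = - swap f" by (rule swap_eqI) (simp add: swap_nth)

lemma swap_mult: "swap (f * g) = swap f * swap g"
proof (rule swap_eqI)
  fix k n
  have "swap (f * g) $ k $ n = (\<Sum>m=0..n. \<Sum>i\<le>k. coeff (f $ m) i * coeff (g $ (n - m)) (k - i))"
    by (simp add: swap_nth fps_mult_nth coeff_sum coeff_mult)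
  also have "\<dots> = (\<Sum>i\<le>k. \<Sum>m=0..n. coeff (f $ m) i * coeff (g $ (n - m)) (k - i))"
    by (rule sum.swap)
  also have "\<dots> = (swap f * swap g) $ k $ n"
    by (simp add: fps_mult_nth swap_nth fps_sum_nth atLeast0AtMost)
  finally show "swap (f * g) $ k $ n = (swap f * swap g) $ k $ n" .
qed

lemma swap_power: "swap (f ^ n) = swap f ^ n"
  by (induction n) (simp_all add: swap_1 swap_mult)

lemma swap_numeral: "swap (numeral k) = numeral k"
proof -
  have "swap (of_nat m) = of_nat m" for m by (induction m) (simp_all add: swap_0 swap_1 swap_add)
  from this[of "numeral k"] show ?thesis by simp
qed

lemma swap_fps_X: "swap fps_X = fps_const fps_X"
  by (rule swap_eqI) (simp add: swap_nth fps_X_def)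

definition av :: "rat poly fps" where "av = fps_const [:0, 1:]"

lemma swap_av: "swap av = fps_X"
proof (rule swap_eqI)
  fix k n show "swap av $ k $ n = fps_X $ k $ n"
    by (cases n; cases k) (auto simp: swap_nth av_def fps_X_def coeff_pCons split: nat.splits)
qed

definition lift :: "rat fps \<Rightarrow> rat poly fps" where
  "lift s = Abs_fps (\<lambda>n. [:s $ n:])"

lemma swap_lift: "swap (lift s) = fps_const s"
proof (rule swap_eqI)
  fix k n show "swap (lift s) $ k $ n = fps_const s $ k $ n"
    by (cases k) (auto simp: swap_nth lift_def)
qed

lemmas swap_hom = swap_0 swap_1 swap_add swap_diff swap_uminus swap_mult swap_power swap_numeral
  swap_fps_X swap_av swap_lift

definition ev :: "rat \<Rightarrow> rat poly fps \<Rightarrow> rat fps" where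
  "ev x f = Abs_fps (\<lambda>n. poly (f $ n) x)"

lemma ev_nth: "ev x f $ n = poly (f $ n) x" by (simp add: ev_def)
lemma ev_0: "ev x 0 = 0" by (rule fps_ext) (simp add: ev_nth)
lemma ev_1: "ev x 1 = 1" by (rule fps_ext) (simp add: ev_nth fps_one_nth)
lemma ev_add: "ev x (f + g) = ev x f + ev x g" by (rule fps_ext) (simp add: ev_nth)
lemma ev_diff: "ev x (f - g) = ev x f - ev x g" by (rule fps_ext) (simp add: ev_nth)
lemma ev_mult: "ev x (f * g) = ev x f * ev x g"
  by (rule fps_ext) (simp add: ev_nth fps_mult_nth poly_sum)
lemma ev_power: "ev x (f ^ n) = ev x f ^ n"
  by (induction n) (simp_all add: ev_1 ev_mult)
lemma ev_numeral: "ev x (numeral k) = numeral k"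
proof -
  have "ev x (of_nat m) = of_nat m" for m by (induction m) (simp_all add: ev_0 ev_1 ev_add)
  from this[of "numeral k"] show ?thesis by simp
qed
lemma ev_fps_X: "ev x fps_X = fps_X" by (rule fps_ext) (simp add: ev_nth fps_X_def)
lemma ev_av: "ev x av = fps_const x" by (rule fps_ext) (simp add: ev_nth av_def)
lemma ev_lift: "ev x (lift s) = s" by (rule fps_ext) (simp add: ev_nth lift_def)

lemmas ev_hom = ev_0 ev_1 ev_add ev_diff ev_mult ev_power ev_numeral ev_fps_X ev_av ev_lift

text \<open>Cutting off at degree n in a makes each coefficient a polynomial that can be evaluated.
  Nothing is lost when the k-th series is divisible by t^k, which the scaled series below
  satisfy.\<close>

definition pol :: "(nat \<Rightarrow> rat fps) \<Rightarrow> rat poly fps" where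
  "pol s = Abs_fps (\<lambda>n. \<Sum>k\<le>n. monom (s k $ n) k)"

lemma coeff_pol:
  assumes "\<And>k n. n < k \<Longrightarrow> s k $ n = 0"
  shows "coeff (pol s $ n) k = s k $ n"
proof -
  have "coeff (pol s $ n) k = (\<Sum>j\<le>n. if j = k then s j $ n else 0)"
    by (simp add: pol_def coeff_sum)
  also have "\<dots> = s k $ n" using assms[of n k] by (simp add: sum.delta)
  finally show ?thesis .
qed

lemma swap_pol: "(\<And>k n. n < k \<Longrightarrow> s k $ n = 0) \<Longrightarrow> swap (pol s) = Abs_fps s"
  by (rule swap_eqI) (simp add: swap_nth coeff_pol)

lemma ev_pol_nth:
  assumes "\<And>k n. n < k \<Longrightarrow> s k $ n = 0" "m < N"
  shows "ev x (pol s) $ m = (\<Sum>k<N. fps_const (x ^ k) * s k) $ m"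
proof -
  have "ev x (pol s) $ m = (\<Sum>k\<le>m. s k $ m * x ^ k)"
    by (simp add: ev_nth pol_def poly_sum poly_monom)
  also have "\<dots> = (\<Sum>k<N. s k $ m * x ^ k)"
    by (rule sum.mono_neutral_left) (use assms in auto)
  finally show ?thesis by (simp add: fps_sum_nth mult.commute)
qed

text \<open>Scaling the k-th outer series by t^k turns the kernel condition into the involution
  1/a \<mapsto> -2 - 1/a, which does not involve t.\<close>

definition qs :: "nat \<Rightarrow> rat fps" where "qs k = fps_X ^ k * outer k"
definition gs :: "nat \<Rightarrow> nat \<Rightarrow> rat fps" where "gs j k = fps_X ^ (j + k + 2) * loop j k"

lemma qs_small: "n < k \<Longrightarrow> qs k $ n = 0" by (simp add: qs_def fps_X_power_mult_nth)
lemma gs_small: "n < j + k + 2 \<Longrightarrow> gs j k $ n = 0" by (simp only: gs_def fps_X_power_mult_nth if_True)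
lemma qs_0: "qs 0 = 1" by (simp add: qs_def outer_0)
lemma qs_1: "qs 1 = 0" using outer_1 by (simp add: qs_def)
lemma gs_sym: "gs j 0 = gs 0 j" by (simp add: gs_def loop_sym)

lemma qs_rec: "2 * qs (Suc k) = qs (k + 2) + gs 0 k + 4 * fps_X ^ 3 * (\<Sum>i<k. qs i * qs (k - 1 - i))"
proof -
  have p: "(\<Sum>i<k. qs i * qs (k - 1 - i)) = fps_X ^ (k - 1) * (\<Sum>i<k. outer i * outer (k - 1 - i))"
    unfolding sum_distrib_left
  proof (rule sum.cong[OF refl])
    fix i assume "i \<in> {..<k}"
    then have "fps_X ^ (k - 1) = fps_X ^ i * (fps_X ^ (k - 1 - i) :: rat fps)" by (simp flip: power_add)
    then show "qs i * qs (k - 1 - i) = fps_X ^ (k - 1) * (outer i * outer (k - 1 - i))"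
      unfolding qs_def by (simp add: algebra_simps)
  qed
  have x: "fps_X ^ 3 * (fps_X ^ (k - 1) * (\<Sum>i<k. outer i * outer (k - 1 - i))) =
      fps_X ^ Suc k * fps_X * (\<Sum>i<k. outer i * outer (k - 1 - i))"
    by (cases k) (simp_all add: algebra_simps power3_eq_cube)
  have "2 * qs (Suc k) = fps_X ^ Suc k * (2 * outer (Suc k))" unfolding qs_def by (simp only: mult.left_commute)
  also have "\<dots> = fps_X ^ (k + 2) * outer (k + 2) + fps_X ^ (k + 2) * loop 0 k
      + 4 * (fps_X ^ Suc k * fps_X * (\<Sum>i<k. outer i * outer (k - 1 - i)))"
    unfolding outer_rec by (simp add: algebra_simps)
  finally show ?thesis
    unfolding p mult.assoc[of 4] x unfolding qs_def gs_def by simp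
qed

lemma gs_rec: "2 * gs j k + gs j (Suc k) + gs (Suc j) k = - 4 * fps_X ^ 3 * (qs j * qs k)"
proof -
  have "2 * gs j k = fps_X ^ (j + k + 2) * (2 * loop j k)" unfolding gs_def by (simp only: mult.left_commute)
  also have "\<dots> = - (gs j (Suc k) + gs (Suc j) k) - 4 * fps_X ^ 3 * (qs j * qs k)"
    unfolding loop_rec gs_def qs_def by (simp add: algebra_simps power_add power3_eq_cube)
  finally show ?thesis by simp
qed

definition Wser :: "rat poly fps" where "Wser = pol qs"
definition Kser :: "rat poly fps" where "Kser = pol (gs 0)"

lemma swap_Wser: "swap Wser = Abs_fps qs"
  unfolding Wser_def by (rule swap_pol) (rule qs_small)

lemma swap_Kser: "swap Kser = Abs_fps (gs 0)"
  unfolding Kser_def by (rule swap_pol) (simp add: gs_small)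

text \<open>This is \<open>qs_rec\<close> multiplied by a^(k+2) and summed over k. The two lowest
  coefficients are covered by \<open>qs_0\<close> and \<open>qs_1\<close>.\<close>

lemma first_equation:
  "2 * av * (Wser - 1) = (Wser - 1) + av ^ 2 * Kser + 4 * fps_X ^ 3 * av ^ 3 * Wser ^ 2"
proof (rule swap_inj, unfold swap_hom swap_Wser swap_Kser, rule fps_ext)
  fix k
  let ?F = "Abs_fps qs" and ?z = "fps_const fps_X :: rat fps fps"
  have z: "4 * ?z ^ 3 = fps_const (4 * fps_X ^ 3)"
    by (simp add: fps_const_power numeral_fps_const flip: fps_const_mult)
  have l: "(2 * fps_X * (?F - 1)) $ k = (if k = 0 then 0 else 2 * (?F - 1) $ (k - 1))"
    by (simp add: mult.assoc numeral_fps_const)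
  have r: "(4 * ?z ^ 3 * fps_X ^ 3 * ?F ^ 2) $ k = (if k < 3 then 0 else 4 * fps_X ^ 3 * (?F ^ 2) $ (k - 3))"
    unfolding z mult.assoc by (simp add: fps_X_power_mult_nth)
  have F2: "(?F ^ 2) $ n = (\<Sum>i\<le>n. qs i * qs (n - i))" for n
    by (simp add: power2_eq_square fps_mult_nth atLeast0AtMost)
  show "(2 * fps_X * (?F - 1)) $ k = (?F - 1 + fps_X ^ 2 * Abs_fps (gs 0) + 4 * ?z ^ 3 * fps_X ^ 3 * ?F ^ 2) $ k"
  proof (cases "k < 2")
    case True
    then have "k = 0 \<or> k = 1" by auto
    then show ?thesis
      unfolding l fps_add_nth r using qs_0 qs_1 by (auto simp: fps_X_power_mult_nth fps_one_nth)
  next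
    case False
    then obtain m where m: "k = Suc (Suc m)" by (metis add_2_eq_Suc le_Suc_ex not_less)
    have "(\<Sum>i<m. qs i * qs (m - 1 - i)) = (if m = 0 then 0 else (?F ^ 2) $ (m - 1))"
      unfolding F2 by (cases m) (simp_all add: lessThan_Suc_atMost)
    then show ?thesis
      unfolding l fps_add_nth r unfolding m using qs_rec[of m] by (auto simp: fps_X_power_mult_nth fps_one_nth)
  qed
qed

lemma fps_mult_nth_cong:
  assumes "\<And>m. m \<le> n \<Longrightarrow> f $ m = f' $ m" "\<And>m. m \<le> n \<Longrightarrow> g $ m = g' $ m"
  shows "(f * g) $ n = (f' * g') $ n"
  unfolding fps_mult_nth using assms by (intro sum.cong) auto

text \<open>The hypothesis is the vanishing of the kernel 2 + 1/a + 1/b of the recursion for the two-index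
  series.\<close>

lemma kernel_equation:
  assumes ab: "a + b = - 2 * a * b"
  shows "fps_const a * ev a Kser + fps_const b * ev b Kser =
     4 * fps_X ^ 3 * (fps_const a * ev a Wser) * (fps_const b * ev b Wser)"
proof (rule fps_ext)
  fix n
  define N where "N = Suc n"
  define \<alpha> \<beta> where "\<alpha> = fps_const a" and "\<beta> = fps_const b"
  define G where "G j k = \<alpha> ^ j * \<beta> ^ k * gs j k" for j k
  have \<alpha>\<beta>: "\<alpha> + \<beta> = - 2 * \<alpha> * \<beta>"
    unfolding \<alpha>_def \<beta>_def using ab by (simp add: numeral_fps_const)
  have pw: "fps_const (a ^ k) = \<alpha> ^ k" "fps_const (b ^ k) = \<beta> ^ k" for k
    unfolding \<alpha>_def \<beta>_def by (simp_all add: fps_const_power)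
  \<comment> \<open>Where the kernel vanishes, the recursion multiplied by \<alpha>^(j+1)
    \<beta>^(k+1) turns into a sum of two discrete differences, one in each index, so the double sum
    telescopes.\<close>
  have tm: "\<alpha> * (G j (Suc k) - G j k) + \<beta> * (G (Suc j) k - G j k) =
      - (4 * fps_X ^ 3 * (\<alpha> * (\<alpha> ^ j * qs j)) * (\<beta> * (\<beta> ^ k * qs k)))" for j k
  proof -
    have "\<alpha> * (G j (Suc k) - G j k) + \<beta> * (G (Suc j) k - G j k) =
        \<alpha> * G j (Suc k) + \<beta> * G (Suc j) k - (\<alpha> + \<beta>) * G j k" by (simp add: algebra_simps)
    also have "\<dots> = \<alpha> * \<beta> * \<alpha> ^ j * \<beta> ^ k * (2 * gs j k + gs j (Suc k) + gs (Suc j) k)"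
      unfolding \<alpha>\<beta> G_def by (simp add: algebra_simps)
    also have "\<dots> = - (4 * fps_X ^ 3 * (\<alpha> * (\<alpha> ^ j * qs j)) * (\<beta> * (\<beta> ^ k * qs k)))"
      unfolding gs_rec by (simp add: algebra_simps)
    finally show ?thesis .
  qed
  let ?Wa = "\<Sum>k<N. \<alpha> ^ k * qs k" and ?Wb = "\<Sum>k<N. \<beta> ^ k * qs k"
  have s1: "(\<Sum>j<N. \<Sum>k<N. \<alpha> * (G j (Suc k) - G j k) + \<beta> * (G (Suc j) k - G j k)) =
      - (4 * fps_X ^ 3 * (\<alpha> * ?Wa) * (\<beta> * ?Wb))"
  proof -
    have "(\<alpha> * ?Wa) * (\<beta> * ?Wb) = (\<Sum>j<N. \<Sum>k<N. (\<alpha> * (\<alpha> ^ j * qs j)) * (\<beta> * (\<beta> ^ k * qs k)))"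
      unfolding sum_distrib_left[of \<alpha>] sum_distrib_left[of \<beta>] by (rule sum_product)
    then have "(- 4 * fps_X ^ 3) * ((\<alpha> * ?Wa) * (\<beta> * ?Wb)) =
        (\<Sum>j<N. \<Sum>k<N. (- 4 * fps_X ^ 3) * ((\<alpha> * (\<alpha> ^ j * qs j)) * (\<beta> * (\<beta> ^ k * qs k))))"
      by (simp only: sum_distrib_left)
    moreover have "\<alpha> * (G j (Suc k) - G j k) + \<beta> * (G (Suc j) k - G j k) =
        (- 4 * fps_X ^ 3) * ((\<alpha> * (\<alpha> ^ j * qs j)) * (\<beta> * (\<beta> ^ k * qs k)))" for j k
      unfolding tm by (simp add: mult.assoc)
    ultimately show ?thesis by (simp add: mult.assoc)
  qed
  have "(\<Sum>j<N. \<Sum>k<N. \<alpha> * (G j (Suc k) - G j k) + \<beta> * (G (Suc j) k - G j k)) =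
      (\<Sum>j<N. \<alpha> * (\<Sum>k<N. G j (Suc k) - G j k)) + (\<Sum>j<N. \<Sum>k<N. \<beta> * (G (Suc j) k - G j k))"
    by (simp add: sum.distrib sum_distrib_left)
  also have "(\<Sum>j<N. \<Sum>k<N. \<beta> * (G (Suc j) k - G j k)) = (\<Sum>k<N. \<beta> * (\<Sum>j<N. G (Suc j) k - G j k))"
    unfolding sum_distrib_left by (rule sum.swap)
  finally have s2: "(\<Sum>j<N. \<alpha> * (G j N - G j 0)) + (\<Sum>k<N. \<beta> * (G N k - G 0 k)) =
      - (4 * fps_X ^ 3 * (\<alpha> * ?Wa) * (\<beta> * ?Wb))"
    unfolding s1 sum_lessThan_telescope[of "G _"] sum_lessThan_telescope[of "\<lambda>j. G j _"] by simp
  have Gn: "G j k $ n = a ^ j * b ^ k * gs j k $ n" for j k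
    unfolding G_def pw(1)[symmetric] pw(2)[symmetric] by (simp add: mult.assoc)
  \<comment> \<open>As N exceeds n, the far boundary terms of the telescoping sums do not reach
    order n, and the truncated sums are exact at that order.\<close>
  have v: "G j N $ n = 0" "G N j $ n = 0" for j
    unfolding Gn by (simp_all add: gs_small N_def)
  have ka: "ev a Kser $ n = (\<Sum>j<N. G j 0 $ n)"
    unfolding Kser_def Gn gs_sym
    by (subst ev_pol_nth[of _ n N]) (simp_all add: gs_small N_def fps_sum_nth del: sum.lessThan_Suc)
  have kb: "ev b Kser $ n = (\<Sum>k<N. G 0 k $ n)"
    unfolding Kser_def Gn
    by (subst ev_pol_nth[of _ n N]) (simp_all add: gs_small N_def fps_sum_nth del: sum.lessThan_Suc)
  have wa: "ev a Wser $ m = ?Wa $ m" "ev b Wser $ m = ?Wb $ m" if "m \<le> n" for m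
    unfolding Wser_def pw[symmetric] using that
    by (intro ev_pol_nth; simp add: qs_small N_def)+
  have "((\<Sum>j<N. \<alpha> * (G j N - G j 0)) + (\<Sum>k<N. \<beta> * (G N k - G 0 k))) $ n =
      - (a * (\<Sum>j<N. G j 0 $ n) + b * (\<Sum>k<N. G 0 k $ n))"
    unfolding \<alpha>_def \<beta>_def by (simp add: fps_sum_nth v sum_negf sum_distrib_left)
  then have "a * (\<Sum>j<N. G j 0 $ n) + b * (\<Sum>k<N. G 0 k $ n) = (4 * fps_X ^ 3 * (\<alpha> * ?Wa) * (\<beta> * ?Wb)) $ n"
    unfolding s2 by simp
  also have "\<dots> = (4 * fps_X ^ 3 * (\<alpha> * ev a Wser) * (\<beta> * ev b Wser)) $ n"
  proof -
    have e: "(\<alpha> * ?Wa) $ m = (\<alpha> * ev a Wser) $ m" "(\<beta> * ?Wb) $ m = (\<beta> * ev b Wser) $ m" if "m \<le> n" for m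
      unfolding \<alpha>_def \<beta>_def using wa[OF that, unfolded \<alpha>_def \<beta>_def] by (simp_all only: fps_mult_left_const_nth)
    have "(4 * fps_X ^ 3 * (\<alpha> * ?Wa)) $ m = (4 * fps_X ^ 3 * (\<alpha> * ev a Wser)) $ m" if "m \<le> n" for m
      by (rule fps_mult_nth_cong[OF refl e(1)]) (use that in linarith)
    then show ?thesis by (rule fps_mult_nth_cong[OF _ e(2)])
  qed
  finally show "(fps_const a * ev a Kser + fps_const b * ev b Kser) $ n =
     (4 * fps_X ^ 3 * (fps_const a * ev a Wser) * (fps_const b * ev b Wser)) $ n"
    unfolding \<alpha>_def \<beta>_def using ka kb by simp
qed

text \<open>Here p = 1/a, w = a W(a), and w' is the same at -2 - p. The hypothesis is the kernel
  equation with the loop series eliminated. E is built so that its change under the involution is a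
  multiple of that equation, with cofactor proportional to z (w - w') - 2 (p + 1). Its constant term
  is at liberty in this identity and is adjusted to q for \<open>Wser_cubic\<close>.\<close>

lemma kernel_invariant:
  fixes p w w' z q :: "'a :: comm_ring_1"
  assumes "(2 - p) * (p * w - 1) + (4 + p) * ((- 2 - p) * w' - 1) = 4 * z * (w ^ 2 + w' ^ 2) + 4 * z * w * w'"
  defines "E \<equiv> \<lambda>p w. 4 * z ^ 2 * w ^ 3 - z * (8 + 10 * p - p ^ 2) * w ^ 2 +
      (4 * p + 2 * p ^ 2 - 2 * p ^ 3 + 6 * z) * w + 2 * p ^ 2 - 2 * p - 4 + 2 * q - z"
  shows "12 * E p w = 12 * E (- 2 - p) w'"
proof -
  have "12 * E p w - 12 * E (- 2 - p) w' = (12 * z * (w - w') - 24 * (p + 1)) *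
     (4 * z * (w ^ 2 + w' ^ 2) + 4 * z * w * w' - ((2 - p) * (p * w - 1) + (4 + p) * ((- 2 - p) * w' - 1)))"
    unfolding E_def by (simp add: algebra_simps power2_eq_square power3_eq_cube)
  then show ?thesis using assms(1) by simp
qed

text \<open>The polynomial a g(a) is invariant under the Moebius involution a -> -a / (1 + 2 a),
  which sends -1/2 to infinity. A nonconstant polynomial would have to be infinite at -1/2, so it is
  constant, and it vanishes at 0.\<close>

lemma poly_involution:
  fixes g :: "rat poly"
  assumes "\<And>a. a \<noteq> 0 \<Longrightarrow> 1 + 2 * a \<noteq> 0 \<Longrightarrow> a * poly g a = (- a / (1 + 2 * a)) * poly g (- a / (1 + 2 * a))"
  shows "g = 0"
proof (rule ccontr)
  assume g: "g \<noteq> 0"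
  define h where "h = pCons 0 g"
  define m where "m = degree h"
  have hm: "m > 0" "coeff h m \<noteq> 0" unfolding h_def m_def using g by simp_all
  have ph: "poly h x = x * poly g x" for x unfolding h_def by simp
  \<comment> \<open>T is the transformed polynomial with its denominator (1 + 2 a)^m cleared. At a =
    -1/2 only the contribution of the leading coefficient of h remains in T.\<close>
  define T where "T = (\<Sum>i\<le>m. smult (coeff h i) ([:0, -1:] ^ i * [:1, 2:] ^ (m - i)))"
  have T: "poly T a = (1 + 2 * a) ^ m * poly h (- a / (1 + 2 * a))" if a: "1 + 2 * a \<noteq> 0" for a
  proof -
    have "poly T a = (\<Sum>i\<le>m. coeff h i * ((- a) ^ i * (1 + 2 * a) ^ (m - i)))"
      unfolding T_def by (simp add: poly_sum mult.commute)
    also have "\<dots> = (\<Sum>i\<le>m. (1 + 2 * a) ^ m * (coeff h i * (- a / (1 + 2 * a)) ^ i))"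
    proof (rule sum.cong[OF refl])
      fix i assume "i \<in> {..m}"
      then have e1: "(1 + 2 * a) ^ m = (1 + 2 * a) ^ (m - i) * (1 + 2 * a) ^ i" by (simp flip: power_add)
      have e2: "(- a) ^ i = (1 + 2 * a) ^ i * (- a / (1 + 2 * a)) ^ i"
        using a by (simp flip: power_mult_distrib)
      show "coeff h i * ((- a) ^ i * (1 + 2 * a) ^ (m - i)) = (1 + 2 * a) ^ m * (coeff h i * (- a / (1 + 2 * a)) ^ i)"
        unfolding e1 e2 by (simp only: ac_simps)
    qed
    also have "\<dots> = (1 + 2 * a) ^ m * poly h (- a / (1 + 2 * a))"
      unfolding poly_altdef m_def by (simp add: sum_distrib_left)
    finally show ?thesis .
  qed
  have "[:1, 2:] ^ m * h - T = 0"
  proof (rule ccontr)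
    assume "[:1, 2:] ^ m * h - T \<noteq> 0"
    then have "finite {x. poly ([:1, 2:] ^ m * h - T) x = 0}" by (rule poly_roots_finite)
    moreover have "UNIV - {0, - 1 / 2} \<subseteq> {x. poly ([:1, 2:] ^ m * h - T) x = 0}"
    proof
      fix x :: rat assume "x \<in> UNIV - {0, - 1 / 2}"
      then have x: "x \<noteq> 0" "1 + 2 * x \<noteq> 0" by auto
      show "x \<in> {x. poly ([:1, 2:] ^ m * h - T) x = 0}"
        using T[OF x(2)] assms[OF x] by (simp add: ph poly_power mult.commute)
    qed
    ultimately have "finite (UNIV - {0, - 1 / 2 :: rat})" by (rule rev_finite_subset)
    then show False using infinite_UNIV_char_0[where 'a = rat] by simp
  qed
  then have "poly ([:1, 2:] ^ m * h - T) (- 1 / 2) = 0" by simp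
  then have "poly T (- 1 / 2) = 0" using hm(1) by (simp add: poly_power zero_power)
  moreover have "poly T (- 1 / 2) = coeff h m * (1 / 2) ^ m"
  proof -
    have "poly T (- 1 / 2) = (\<Sum>i\<le>m. coeff h i * ((1 / 2) ^ i * 0 ^ (m - i)))"
      unfolding T_def by (simp add: poly_sum mult.commute)
    also have "\<dots> = (\<Sum>i\<le>m. if i = m then coeff h m * (1 / 2) ^ m else 0)"
      by (rule sum.cong) (auto simp: power_0_left)
    finally show ?thesis by simp
  qed
  ultimately show False using hm(2) by simp
qed

text \<open>The invariant E of \<open>kernel_invariant\<close> at p = 1/a, w = a W and z = t^3,
  multiplied by a^2.\<close>

definition cubic :: "rat poly fps \<Rightarrow> rat poly fps \<Rightarrow> rat poly fps" where
  "cubic q W = 4 * (fps_X ^ 3) ^ 2 * av ^ 5 * W ^ 3 - fps_X ^ 3 * (8 * av ^ 2 + 10 * av - 1) * av ^ 2 * W ^ 2 +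
     (4 * av ^ 2 + 2 * av - 2 + 6 * fps_X ^ 3 * av ^ 3) * W + 2 - 2 * av - 4 * av ^ 2 + (2 * q - fps_X ^ 3) * av ^ 2"

text \<open>The coefficients 1, 0 and \<open>qs 2\<close> are split off because they decide whether
  the cubic is divisible by a^3.\<close>

lemma Wser_expand: "\<exists>R. Wser = 1 + lift (qs 2) * av ^ 2 + av ^ 3 * R"
proof
  define R where "R = Abs_fps (\<lambda>n. poly_shift 3 (Wser $ n))"
  have c: "coeff (Wser $ n) k = qs k $ n" for n k
    unfolding Wser_def by (rule coeff_pol) (rule qs_small)
  have m: "av ^ k = fps_const (monom 1 k)" for k
    by (simp add: av_def fps_const_power monom_altdef)
  show "Wser = 1 + lift (qs 2) * av ^ 2 + av ^ 3 * R"
  proof (rule fps_ext, rule poly_eqI)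
    fix n k :: nat
    have "k = 0 \<or> k = 1 \<or> k = 2 \<or> k \<ge> 3" by auto
    then show "coeff (Wser $ n) k = coeff ((1 + lift (qs 2) * av ^ 2 + av ^ 3 * R) $ n) k"
      using qs_0 qs_1
      by (auto simp: c m lift_def R_def coeff_monom_mult coeff_poly_shift fps_one_nth coeff_1 mult.commute[of _ "monom 1 2"])
  qed
qed

lemma involution_identities:
  fixes a :: "'a :: field"
  assumes "a \<noteq> 0" "1 + 2 * a \<noteq> 0"
  shows "- a / (1 + 2 * a) \<noteq> 0" "a + - a / (1 + 2 * a) = - 2 * a * (- a / (1 + 2 * a))"
    "1 / (- a / (1 + 2 * a)) = - 2 - 1 / a"
  using assms by (simp_all add: field_simps)

lemma Wser_cubic: "cubic (lift (qs 2)) Wser = 0"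
proof -
  obtain R where R: "Wser = 1 + lift (qs 2) * av ^ 2 + av ^ 3 * R" using Wser_expand by blast
  define q where "q = lift (qs 2)"
  define S where "S = q + av * R"
  define z :: "rat poly fps" where "z = fps_X ^ 3"
  have W: "Wser = 1 + av ^ 2 * S" unfolding S_def q_def using R by (simp add: algebra_simps power2_eq_square power3_eq_cube)
  \<comment> \<open>The constant 2 q - t^3 of the cubic cancels the term in a^2, so a^3 can be taken
    out and H is the quotient. The invariant thus becomes a H, which vanishes at a = 0 as
    \<open>poly_involution\<close> needs.\<close>
  define H where "H = (4 * av + 2) * q + (4 * av ^ 2 + 2 * av - 2) * R + 6 * z * Wser + 4 * z ^ 2 * av ^ 2 * Wser ^ 3
     + z * av * (2 * S + av ^ 2 * S ^ 2) - z * (10 + 8 * av) * Wser ^ 2"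
  have cH: "cubic q Wser = av ^ 3 * H"
    unfolding cubic_def z_def[symmetric] H_def W S_def by algebra
  have "H $ n = 0" for n
  proof (rule poly_involution)
    fix a :: rat assume a: "a \<noteq> 0" "1 + 2 * a \<noteq> 0"
    define b where "b = - a / (1 + 2 * a)"
    have b: "b \<noteq> 0" "a + b = - 2 * a * b" "1 / b = - 2 - 1 / a"
      unfolding b_def using involution_identities[OF a] by blast+
    define Z :: "rat fps" where "Z = fps_X ^ 3"
    define E where "E = (\<lambda>p w. 4 * Z ^ 2 * w ^ 3 - Z * (8 + 10 * p - p ^ 2) * w ^ 2 +
      (4 * p + 2 * p ^ 2 - 2 * p ^ 3 + 6 * Z) * w + 2 * p ^ 2 - 2 * p - 4 + 2 * qs 2 - Z)"
    \<comment> \<open>The first claim rewrites the cubic in the invariant variables 1/x and x W(x).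
      The second eliminates the loop series through \<open>first_equation\<close>, so that the
      kernel equation relates only the outer series at the two points.\<close>
    have E: "E (fps_const (1 / x)) (fps_const x * ev x Wser) = fps_const x * ev x H" and
      K: "fps_const x * ev x Kser = (2 - fps_const (1 / x)) * (fps_const (1 / x) * (fps_const x * ev x Wser) - 1)
          - 4 * Z * (fps_const x * ev x Wser) ^ 2"
      if x: "x \<noteq> 0" for x
    proof -
      define \<xi> p where "\<xi> = fps_const x" and "p = fps_const (1 / x)"
      have \<xi>p: "\<xi> * p = 1" unfolding \<xi>_def p_def using x by simp
      have \<xi>0: "\<xi> \<noteq> 0" unfolding \<xi>_def using x by simp
      define V where "V = ev x Wser"
      have c: "4 * Z ^ 2 * \<xi> ^ 5 * V ^ 3 - Z * (8 * \<xi> ^ 2 + 10 * \<xi> - 1) * \<xi> ^ 2 * V ^ 2 +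
        (4 * \<xi> ^ 2 + 2 * \<xi> - 2 + 6 * Z * \<xi> ^ 3) * V + 2 - 2 * \<xi> - 4 * \<xi> ^ 2 + (2 * qs 2 - Z) * \<xi> ^ 2 = \<xi> ^ 3 * ev x H"
        using arg_cong[OF cH, of "ev x"] unfolding cubic_def q_def ev_hom \<xi>_def V_def Z_def .
      have "\<xi> ^ 2 * E p (\<xi> * V) = 4 * Z ^ 2 * \<xi> ^ 5 * V ^ 3 - Z * (8 * \<xi> ^ 2 + 10 * \<xi> - 1) * \<xi> ^ 2 * V ^ 2 +
        (4 * \<xi> ^ 2 + 2 * \<xi> - 2 + 6 * Z * \<xi> ^ 3) * V + 2 - 2 * \<xi> - 4 * \<xi> ^ 2 + (2 * qs 2 - Z) * \<xi> ^ 2"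
        unfolding E_def using \<xi>p by algebra
      then have "\<xi> ^ 2 * E p (\<xi> * V) = \<xi> ^ 2 * (\<xi> * ev x H)" unfolding c by (simp add: power2_eq_square power3_eq_cube)
      then show "E (fps_const (1 / x)) (fps_const x * ev x Wser) = fps_const x * ev x H"
        using \<xi>0 unfolding \<xi>_def p_def V_def by simp
      have k: "2 * \<xi> * (V - 1) = (V - 1) + \<xi> ^ 2 * ev x Kser + 4 * Z * \<xi> ^ 3 * V ^ 2"
        using arg_cong[OF first_equation, of "ev x"] unfolding ev_hom \<xi>_def V_def Z_def .
      show "fps_const x * ev x Kser = (2 - fps_const (1 / x)) * (fps_const (1 / x) * (fps_const x * ev x Wser) - 1)
          - 4 * Z * (fps_const x * ev x Wser) ^ 2"
        unfolding \<xi>_def[symmetric] p_def[symmetric] V_def[symmetric] using k \<xi>p by algebra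
    qed
    define p where "p = fps_const (1 / a)"
    have p': "fps_const (1 / b) = - 2 - p" unfolding p_def b(3) by (simp add: numeral_fps_const flip: fps_const_neg fps_const_sub)
    have "fps_const a * ev a Kser + fps_const b * ev b Kser = 4 * Z * (fps_const a * ev a Wser) * (fps_const b * ev b Wser)"
      unfolding Z_def by (rule kernel_equation[OF b(2)])
    then have "(2 - p) * (p * (fps_const a * ev a Wser) - 1) + (4 + p) * ((- 2 - p) * (fps_const b * ev b Wser) - 1) =
        4 * Z * ((fps_const a * ev a Wser) ^ 2 + (fps_const b * ev b Wser) ^ 2) + 4 * Z * (fps_const a * ev a Wser) * (fps_const b * ev b Wser)"
      unfolding K[OF a(1)] K[OF b(1)] p' p_def[symmetric] by (simp add: algebra_simps)
    then have "12 * E p (fps_const a * ev a Wser) = 12 * E (- 2 - p) (fps_const b * ev b Wser)"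
      unfolding E_def by (rule kernel_invariant)
    then have "fps_const a * ev a H = fps_const b * ev b H"
      unfolding p'[symmetric] unfolding p_def E[OF a(1)] E[OF b(1)] by simp
    then have "(fps_const a * ev a H) $ n = (fps_const b * ev b H) $ n" by simp
    then show "a * poly (H $ n) a = (- a / (1 + 2 * a)) * poly (H $ n) (- a / (1 + 2 * a))"
      unfolding b_def[symmetric] by (simp add: ev_nth)
  qed
  then have "H = 0" by (simp add: fps_eq_iff)
  then show ?thesis using cH unfolding q_def by simp
qed

section \<open>Rational parametrization\<close>

definition contractive :: "('a::comm_ring_1 fps \<Rightarrow> 'a fps) \<Rightarrow> bool" where
  "contractive \<Phi> \<longleftrightarrow> (\<forall>f g n. (\<forall>m<n. f $ m = g $ m) \<longrightarrow> \<Phi> f $ n = \<Phi> g $ n)"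

text \<open>The n-th coefficient of the iterates starting at 0 is stable from iterate n + 1 on, and
  the stable values form the fixed point.\<close>

lemma contractive_fixpoint:
  assumes "contractive \<Phi>"
  shows "\<exists>!f. f = \<Phi> f"
proof -
  have c: "\<Phi> f $ n = \<Phi> g $ n" if "\<And>m. m < n \<Longrightarrow> f $ m = g $ m" for f g n
    using assms that unfolding contractive_def by blast
  have uniq: "f = g" if "f = \<Phi> f" "g = \<Phi> g" for f g
  proof (rule fps_ext)
    fix n show "f $ n = g $ n"
    proof (induction n rule: less_induct)
      case (less n)
      then have "\<Phi> f $ n = \<Phi> g $ n" by (rule c)
      then show ?case using that by metis
    qed
  qed
  define s where "s k = (\<Phi> ^^ k) 0" for k
  have ss: "s (Suc k) = \<Phi> (s k)" for k by (simp add: s_def)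
  have stable: "s (Suc k) $ n = s k $ n" if "n < k" for n k
    using that
  proof (induction k arbitrary: n)
    case (Suc k)
    have "\<Phi> (s (Suc k)) $ n = \<Phi> (s k) $ n"
      by (rule c) (use Suc in auto)
    then show ?case by (simp add: ss)
  qed simp
  have st: "s (n + Suc d) $ n = s (Suc n) $ n" for n d
  proof (induction d)
    case (Suc d)
    have "s (n + Suc (Suc d)) $ n = s (n + Suc d) $ n" using stable[of n "n + Suc d"] by simp
    then show ?case using Suc by simp
  qed simp
  define F where "F = Abs_fps (\<lambda>n. s (Suc n) $ n)"
  have "F $ n = \<Phi> F $ n" for n
  proof -
    have "\<Phi> F $ n = \<Phi> (s n) $ n"
    proof (rule c)
      fix m assume "m < n"
      then obtain d where "n = m + Suc d" by (metis add_Suc_right less_imp_Suc_add)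
      then show "F $ m = s n $ m" using st[of m d] by (simp add: F_def)
    qed
    then show ?thesis by (simp add: F_def ss)
  qed
  then have "F = \<Phi> F" by (rule fps_ext)
  then show ?thesis using uniq by blast
qed

text \<open>Causal operators are closed under ring operations, and a factor t in front delays the
  dependence by one order. Contractivity can thus be read off the form of an equation.\<close>

definition causal :: "('a::comm_ring_1 fps \<Rightarrow> 'a fps) \<Rightarrow> bool" where
  "causal \<Phi> \<longleftrightarrow> (\<forall>f g n. (\<forall>m\<le>n. f $ m = g $ m) \<longrightarrow> \<Phi> f $ n = \<Phi> g $ n)"

lemma causal_const: "causal (\<lambda>f. c)" and causal_id: "causal (\<lambda>f. f)"
  unfolding causal_def by auto

lemma causal_add: "causal \<Phi> \<Longrightarrow> causal \<Psi> \<Longrightarrow> causal (\<lambda>f. \<Phi> f + \<Psi> f)"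
  and causal_diff: "causal \<Phi> \<Longrightarrow> causal \<Psi> \<Longrightarrow> causal (\<lambda>f. \<Phi> f - \<Psi> f)"
  unfolding causal_def fps_add_nth fps_sub_nth by metis+

lemma causal_mult: "causal \<Phi> \<Longrightarrow> causal \<Psi> \<Longrightarrow> causal (\<lambda>f. \<Phi> f * \<Psi> f)"
  unfolding causal_def
proof (intro allI impI)
  fix f g :: "'a fps" and n
  assume h: "\<forall>f g n. (\<forall>m\<le>n. f $ m = g $ m) \<longrightarrow> \<Phi> f $ n = \<Phi> g $ n"
    "\<forall>f g n. (\<forall>m\<le>n. f $ m = g $ m) \<longrightarrow> \<Psi> f $ n = \<Psi> g $ n" "\<forall>m\<le>n. f $ m = g $ m"
  then have e: "\<Phi> f $ m = \<Phi> g $ m" "\<Psi> f $ m = \<Psi> g $ m" if "m \<le> n" for m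
    using that by (meson order_trans)+
  show "(\<Phi> f * \<Psi> f) $ n = (\<Phi> g * \<Psi> g) $ n"
    unfolding fps_mult_nth by (rule sum.cong[OF refl]) (simp add: e)
qed

lemma causal_power: "causal \<Phi> \<Longrightarrow> causal (\<lambda>f. \<Phi> f ^ k)"
  by (induction k) (simp_all add: causal_const causal_mult)

lemmas causal_intros = causal_const causal_id causal_add causal_diff causal_mult causal_power

lemma contractive_affine:
  assumes "causal \<Phi>"
  shows "contractive (\<lambda>f. c + fps_X * \<Phi> f)"
  unfolding contractive_def
proof (intro allI impI)
  fix f g :: "'a fps" and n
  assume h: "\<forall>m<n. f $ m = g $ m"
  show "(c + fps_X * \<Phi> f) $ n = (c + fps_X * \<Phi> g) $ n"
  proof (cases n)
    case (Suc k)
    then have "\<forall>m\<le>k. f $ m = g $ m" using h by simp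
    then have "\<Phi> f $ k = \<Phi> g $ k" using assms unfolding causal_def by blast
    then show ?thesis using Suc by simp
  qed simp
qed

lemma S_unique: "\<exists>!S :: rat fps. S = fps_X ^ 3 * (1 + 2 * S)\<^sup>2"
proof -
  have "contractive (\<lambda>S :: rat fps. 0 + fps_X * (fps_X ^ 2 * (1 + 2 * S) ^ 2))"
    by (intro contractive_affine causal_intros)
  moreover have "(\<lambda>S :: rat fps. 0 + fps_X * (fps_X ^ 2 * (1 + 2 * S) ^ 2)) = (\<lambda>S. fps_X ^ 3 * (1 + 2 * S)\<^sup>2)"
    by (simp add: fun_eq_iff power2_eq_square power3_eq_cube mult.assoc)
  ultimately have "contractive (\<lambda>S :: rat fps. fps_X ^ 3 * (1 + 2 * S)\<^sup>2)" by simp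
  then show ?thesis by (rule contractive_fixpoint)
qed

text \<open>At order t^n the difference of two solutions satisfies (4 a^2 + 2 a - 2) D_n + 2 d_n a^2
  = 0 once the lower orders vanish. A root of the first polynomial gives d_n = 0, and then D_n = 0
  follows.\<close>

lemma cubic_unique:
  assumes "cubic (lift q) W = 0" "cubic (lift q') W' = 0"
  shows "q = q'"
proof -
  let ?z = "fps_X ^ 3 :: rat poly fps"
  define D where "D = W - W'"
  define d where "d = q - q'"
  define Y where "Y = 4 * ?z * av ^ 5 * (W ^ 2 + W * W' + W' ^ 2) - (8 * av ^ 2 + 10 * av - 1) * av ^ 2 * (W + W') + 6 * av ^ 3"
  have ld: "lift q - lift q' = lift d" unfolding lift_def d_def by (rule fps_ext) simp
  have "cubic (lift q) W - cubic (lift q') W' =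
      D * (4 * av ^ 2 + 2 * av - 2) + ?z * (D * Y) + 2 * ((lift q - lift q') * av ^ 2)"
    unfolding cubic_def D_def Y_def by algebra
  then have eq: "D * (4 * av ^ 2 + 2 * av - 2) + ?z * (D * Y) + 2 * (lift d * av ^ 2) = 0"
    using assms unfolding ld by simp
  have K: "4 * av ^ 2 + 2 * av - 2 = fps_const [:-2, 2, 4:]"
    unfolding av_def by (simp add: numeral_fps_const power2_eq_square numeral_poly flip: fps_const_add fps_const_sub)
  have A: "2 * (lift d * av ^ 2) $ n = [:0, 0, 2 * d $ n:]" for n
    unfolding av_def by (simp add: lift_def power2_eq_square numeral_poly)
  have "D $ n = 0 \<and> d $ n = 0" for n
  proof (induction n rule: less_induct)
    case (less n)
    have "(?z * (D * Y)) $ n = 0"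
    proof (cases "n < 3")
      case False
      have "(D * Y) $ (n - 3) = 0"
        unfolding fps_mult_nth using less False by (intro sum.neutral) auto
      then show ?thesis using False by (simp add: fps_X_power_mult_nth)
    qed (simp add: fps_X_power_mult_nth)
    moreover have "(D * (4 * av ^ 2 + 2 * av - 2) + ?z * (D * Y) + 2 * (lift d * av ^ 2)) $ n = 0"
      unfolding eq by simp
    ultimately have e: "D $ n * [:-2, 2, 4:] + [:0, 0, 2 * d $ n:] = 0"
      unfolding K using A[of n] by (simp add: numeral_fps_const)
    \<comment> \<open>The value a = -1 is a root of 4 a^2 + 2 a - 2 but not of a^2.\<close>
    from arg_cong[OF e, of "\<lambda>p. poly p (- 1)"] have "d $ n = 0" by simp
    then have "D $ n * [:-2, 2, 4:] = 0" using e by simp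
    moreover have "[:-2, 2, 4:] \<noteq> (0 :: rat poly)" by simp
    ultimately have "D $ n = 0" by (metis mult_eq_0_iff)
    then show ?case using \<open>d $ n = 0\<close> by blast
  qed
  then have "d = 0" by (simp add: fps_eq_iff)
  then show ?thesis unfolding d_def by simp
qed

text \<open>The cubic defines a rational curve; with u = 1 + bV its parametrization reads
  1 + 1/a = u + 2bu/(u^2 - 1), where b = 2S/(1 + 2S).\<close>

lemma parametrized_solution:
  fixes a b g z q V D N M E c h W :: "'a :: idom"
  assumes D: "D = 2 + b * V" and N: "N = D * (1 + b * V ^ 2) + b * V" and M: "M = 4 - 4 * b - b ^ 2 * V ^ 2"
    and g: "g = 1 - b" and aN: "a * N = V * D" and z: "2 * z = b * g" and q: "4 * q * g = b * (4 - 6 * b + b ^ 2)"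
    and W: "2 * D ^ 2 * g * W = N * M" and nz: "a \<noteq> 0" "N \<noteq> 0" "D \<noteq> 0" "g \<noteq> 0" "(2 :: 'a) \<noteq> 0"
  shows "4 * z ^ 2 * a ^ 5 * W ^ 3 - z * (8 * a ^ 2 + 10 * a - 1) * a ^ 2 * W ^ 2 +
     (4 * a ^ 2 + 2 * a - 2 + 6 * z * a ^ 3) * W + 2 - 2 * a - 4 * a ^ 2 + (2 * q - z) * a ^ 2 = 0" (is "?C = 0")
proof -
  \<comment> \<open>On the curve a = A / N and a W = X / T. Multiplication by a N^3 T^3 removes all
    denominators, and the claim becomes a polynomial identity in b and V.\<close>
  define X where "X = V * M"
  define T where "T = 2 * D * g"
  define A where "A = V * D"
  have "D * (T * (a * W)) = a * (2 * D ^ 2 * g * W)" unfolding T_def by algebra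
  also have "\<dots> = D * X" unfolding W X_def using aN by algebra
  finally have TX: "T * (a * W) = X" using nz(3) by simp
  have AN: "a * N = A" unfolding A_def by (rule aN)
  have "a * ?C * N ^ 3 * T ^ 3 =
     4 * z ^ 2 * (a * N) ^ 3 * (T * (a * W)) ^ 3 - z * (8 * (a * N) ^ 3 + 10 * (a * N) ^ 2 * N - (a * N) * N ^ 2) * (T * (a * W)) ^ 2 * T
     + (4 * (a * N) ^ 2 * N + 2 * (a * N) * N ^ 2 - 2 * N ^ 3 + 6 * z * (a * N) ^ 3) * (T * (a * W)) * T ^ 2
     + (2 * (a * N) * N ^ 2 - 2 * (a * N) ^ 2 * N - 4 * (a * N) ^ 3 + (2 * q - z) * (a * N) ^ 3) * T ^ 3"
    by algebra
  also have "\<dots> = 4 * z ^ 2 * A ^ 3 * X ^ 3 - z * (8 * A ^ 3 + 10 * A ^ 2 * N - A * N ^ 2) * X ^ 2 * T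
     + (4 * A ^ 2 * N + 2 * A * N ^ 2 - 2 * N ^ 3 + 6 * z * A ^ 3) * X * T ^ 2
     + (2 * A * N ^ 2 - 2 * A ^ 2 * N - 4 * A ^ 3 + (2 * q - z) * A ^ 3) * T ^ 3"
    unfolding AN TX ..
  also have "\<dots> = (2 * z) ^ 2 * A ^ 3 * X ^ 3 - (2 * z) * (8 * A ^ 3 + 10 * A ^ 2 * N - A * N ^ 2) * X ^ 2 * D * g
     + (4 * A ^ 2 * N + 2 * A * N ^ 2 - 2 * N ^ 3 + 3 * (2 * z) * A ^ 3) * X * T ^ 2
     + (2 * A * N ^ 2 - 2 * A ^ 2 * N - 4 * A ^ 3) * T ^ 3 + 4 * D ^ 3 * A ^ 3 * g ^ 2 * (4 * q * g) - 4 * D ^ 3 * A ^ 3 * g ^ 3 * (2 * z)"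
    unfolding T_def by algebra
  also have "\<dots> = 0"
    unfolding z q unfolding X_def T_def A_def g M N D by algebra
  finally have "a * ?C * N ^ 3 * T ^ 3 = 0" .
  moreover have "T \<noteq> 0" unfolding T_def using nz by simp
  ultimately show ?thesis using nz by simp
qed

lemma lift_hom: "lift (f + g) = lift f + lift g" "lift (f - g) = lift f - lift g" "lift 1 = 1"
  "lift (numeral k) = numeral k"
proof -
  show add: "lift (f + g) = lift f + lift g" for f g by (rule fps_ext) (simp add: lift_def)
  show "lift (f - g) = lift f - lift g" by (rule fps_ext) (simp add: lift_def)
  show one: "lift 1 = 1" by (rule fps_ext) (simp add: lift_def fps_one_nth one_pCons)
  have "lift 0 = 0" by (rule fps_ext) (simp add: lift_def)
  then have "lift (of_nat m) = of_nat m" for m by (induction m) (simp_all add: add one)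
  from this[of "numeral k"] show "lift (numeral k) = numeral k" by simp
qed

lemma lift_mult: "lift (f * g) = lift f * lift g"
proof (rule fps_ext)
  fix n
  have s: "(\<Sum>i\<in>I. [:h i:]) = [:\<Sum>i\<in>I. h i:]" for I :: "nat set" and h :: "nat \<Rightarrow> rat"
    by (rule poly_eqI) (simp add: coeff_sum coeff_pCons split: nat.split)
  show "lift (f * g) $ n = (lift f * lift g) $ n"
    by (simp add: lift_def fps_mult_nth s mult.commute)
qed

lemma lift_power: "lift (f ^ n) = lift f ^ n"
  by (induction n) (simp_all add: lift_hom lift_mult)

lemma lift_fps_X: "lift fps_X = fps_X"
  by (rule fps_ext) (simp add: lift_def fps_X_def one_pCons)

text \<open>To compare with the combinatorial solution by \<open>cubic_unique\<close>, the rational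
  one has to be realised among series with polynomial coefficients in a. Its parameter V and the
  inverse of D are therefore constructed as fixed points.\<close>

lemma qs_2:
  assumes S: "S = fps_X ^ 3 * (1 + 2 * S)\<^sup>2"
  shows "qs 2 = 2 * fps_X ^ 3 * (1 + S - S\<^sup>2)"
proof -
  define q where "q = 2 * fps_X ^ 3 * (1 + S - S\<^sup>2)"
  define c where "c = 1 + 2 * S"
  have S0: "S $ 0 = 0" by (subst S) simp
  have c0: "c $ 0 \<noteq> 0" unfolding c_def using S0 by (simp add: numeral_fps_const)
  have cinv: "c * inverse c = 1" using inverse_mult_eq_1'[OF c0] .
  \<comment> \<open>With this choice 1 - \<beta> = 1 / (1 + 2 S) and 2 t^3 = \<beta> (1 - \<beta>),
    so that S can be replaced by \<beta> throughout.\<close>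
  define \<beta> where "\<beta> = 2 * S * inverse c"
  have \<beta>c: "\<beta> * c = 2 * S" unfolding \<beta>_def using cinv by algebra
  have gc: "(1 - \<beta>) * c = 1" unfolding left_diff_distrib \<beta>c by (simp add: c_def)
  have cne: "c \<noteq> 0" using c0 by auto
  have zc: "fps_X ^ 3 * c ^ 2 = S" using S unfolding c_def by simp
  have "2 * fps_X ^ 3 * c ^ 2 = (\<beta> * c) * ((1 - \<beta>) * c)" unfolding \<beta>c gc using zc by (simp add: mult.assoc)
  then have "2 * fps_X ^ 3 * c ^ 2 = \<beta> * (1 - \<beta>) * c ^ 2" by (simp add: power2_eq_square ac_simps)
  then have z2: "2 * fps_X ^ 3 = \<beta> * (1 - \<beta>)" using cne by simp
  have q2: "4 * q * (1 - \<beta>) = \<beta> * (4 - 6 * \<beta> + \<beta> ^ 2)"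
  proof -
    have "4 * q * (1 - \<beta>) * c ^ 3 = \<beta> * (4 - 6 * \<beta> + \<beta> ^ 2) * c ^ 3"
    proof -
      have "4 * q * (1 - \<beta>) * c ^ 3 = 8 * (fps_X ^ 3 * c ^ 2) * ((1 - \<beta>) * c) * (1 + S - S\<^sup>2)"
        unfolding q_def by algebra
      also have "\<dots> = 8 * S * (1 + S - S\<^sup>2)" unfolding zc gc by simp
      also have "\<dots> = 2 * S * (4 * c ^ 2 - 6 * (2 * S) * c + (2 * S) ^ 2)" unfolding c_def by algebra
      also have "\<dots> = \<beta> * (4 - 6 * \<beta> + \<beta> ^ 2) * c ^ 3" unfolding \<beta>c[symmetric] by algebra
      finally show ?thesis .
    qed
    then show ?thesis using cne by simp
  qed
  have \<beta>0: "\<beta> $ 0 = 0" unfolding \<beta>_def using S0 by (simp add: numeral_fps_const)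
  \<comment> \<open>The series \<beta> has no constant term. Its factor t makes the next two
    equations contractive.\<close>
  define \<gamma> where "\<gamma> = fps_shift 1 \<beta>"
  have \<gamma>: "\<beta> = fps_X * \<gamma>"
  proof (rule fps_ext)
    fix n show "\<beta> $ n = (fps_X * \<gamma>) $ n" using \<beta>0 by (cases n) (simp_all add: \<gamma>_def)
  qed
  define b where "b = lift \<beta>"
  have bX: "b = fps_X * lift \<gamma>" unfolding b_def \<gamma> lift_mult lift_fps_X ..
  define h where "h = (fps_const [:1 / 2:] :: rat poly fps)"
  have h: "2 * h = 1" unfolding h_def by (simp add: numeral_fps_const numeral_poly one_pCons flip: fps_const_1_eq_1)
  \<comment> \<open>This is the curve equation a N = V D, divided by 2 and solved for the term V
    that carries no factor b.\<close>
  have "contractive (\<lambda>V. av + fps_X * (lift \<gamma> * (h * (av * (2 * V + 2 * V ^ 2 + b * V ^ 3) - V ^ 2))))"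
    by (intro contractive_affine causal_intros)
  then obtain V where "V = av + fps_X * (lift \<gamma> * (h * (av * (2 * V + 2 * V ^ 2 + b * V ^ 3) - V ^ 2)))"
    using contractive_fixpoint by blast
  then have V: "V = av + b * h * (av * (2 * V + 2 * V ^ 2 + b * V ^ 3) - V ^ 2)"
    unfolding bX by (simp add: mult.assoc)
  \<comment> \<open>E is to be the inverse of D = 2 + b V. The coefficients are polynomials in a, so
    it is obtained as the fixed point of E = (1 - b V E) / 2.\<close>
  have "contractive (\<lambda>E. h + fps_X * (lift \<gamma> * (- h * V * E)))"
    by (intro contractive_affine causal_intros)
  then obtain E where "E = h + fps_X * (lift \<gamma> * (- h * V * E))"
    using contractive_fixpoint by blast
  then have E: "E = h - b * h * V * E" unfolding bX by (simp add: mult.assoc)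
  define D where "D = 2 + b * V"
  define N where "N = D * (1 + b * V ^ 2) + b * V"
  define M where "M = 4 - 4 * b - b ^ 2 * V ^ 2"
  have DE: "D * E = 1" unfolding D_def using E h by algebra
  have aN: "av * N = V * D" unfolding N_def D_def using V h by algebra
  define W where "W = h * N * M * E ^ 2 * lift c"
  have gcl: "(1 - b) * lift c = 1" using arg_cong[OF gc, of lift] unfolding lift_mult lift_hom b_def .
  have W: "2 * D ^ 2 * (1 - b) * W = N * M" unfolding W_def using h DE gcl by algebra
  have z: "2 * fps_X ^ 3 = b * (1 - b)"
    using arg_cong[OF z2, of lift] unfolding lift_mult lift_hom lift_power lift_fps_X b_def .
  have ql: "4 * lift q * (1 - b) = b * (4 - 6 * b + b ^ 2)"
    using arg_cong[OF q2, of lift] unfolding lift_mult lift_hom lift_power b_def .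
  have ne: "av \<noteq> 0" "D \<noteq> 0" "1 - b \<noteq> 0" "(2 :: rat poly fps) \<noteq> 0"
  proof -
    show "av \<noteq> 0" unfolding av_def by simp
    show "D \<noteq> 0" using DE by auto
    show "1 - b \<noteq> 0" using gcl by auto
    show "(2 :: rat poly fps) \<noteq> 0" using h by auto
  qed
  have "N \<noteq> 0"
  proof
    assume "N = 0"
    then have "V = 0" using aN ne by simp
    then have "N = 2" unfolding N_def D_def by simp
    then show False using \<open>N = 0\<close> ne by simp
  qed
  have "cubic (lift q) W = 0"
    unfolding cubic_def
    by (rule parametrized_solution[OF D_def N_def M_def refl aN z ql W ne(1) \<open>N \<noteq> 0\<close> ne(2-4)])
  then have "qs 2 = q" by (rule cubic_unique[OF Wser_cubic])
  then show ?thesis unfolding q_def .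
qed

text \<open>Setting a = 0 in H, the cubic divided by a^3, expresses the coefficient of a^3 through
  \<open>qs 2\<close>.\<close>

lemma cubic_qs_3: "2 * qs 3 = 2 * qs 2 - 4 * fps_X ^ 3"
proof -
  obtain R where R: "Wser = 1 + lift (qs 2) * av ^ 2 + av ^ 3 * R" using Wser_expand by blast
  define q where "q = lift (qs 2)"
  define T where "T = q + av * R"
  define z :: "rat poly fps" where "z = fps_X ^ 3"
  define H where "H = (4 * av + 2) * q + (4 * av ^ 2 + 2 * av - 2) * R + 6 * z * Wser + 4 * z ^ 2 * av ^ 2 * Wser ^ 3
     + z * av * (2 * T + av ^ 2 * T ^ 2) - z * (10 + 8 * av) * Wser ^ 2"
  have W: "Wser = 1 + av ^ 2 * T" unfolding T_def q_def using R by (simp add: algebra_simps power2_eq_square power3_eq_cube)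
  have "cubic q Wser = av ^ 3 * H"
    unfolding cubic_def z_def[symmetric] H_def W T_def by algebra
  moreover have "av \<noteq> 0" unfolding av_def by simp
  ultimately have "H = 0" using Wser_cubic unfolding q_def by simp
  have W0: "ev 0 Wser = 1" unfolding W ev_hom by simp
  have "ev 0 R = qs 3"
  proof -
    have "swap Wser $ 3 = qs 3" unfolding swap_Wser by simp
    moreover have "swap Wser $ 3 = swap R $ 0"
    proof -
      have "swap Wser = 1 + fps_const (qs 2) * fps_X ^ 2 + fps_X ^ 3 * swap R" unfolding R swap_hom ..
      then show ?thesis by (simp add: fps_X_power_mult_nth fps_one_nth fps_X_power_mult_right_nth mult.commute)
    qed
    moreover have "swap R $ 0 = ev 0 R" by (rule fps_ext) (simp add: swap_nth ev_nth poly_0_coeff_0)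
    ultimately show ?thesis by simp
  qed
  have "ev 0 H = 0" unfolding \<open>H = 0\<close> ev_0 ..
  then show ?thesis unfolding H_def q_def z_def ev_hom W0 \<open>ev 0 R = qs 3\<close> by (simp add: algebra_simps)
qed

section \<open>Coefficients of the outer series\<close>

text \<open>The substitution y -> t y. It takes the original series to the scaled one, and its
  injectivity brings identities back.\<close>

definition scale :: "rat fps fps \<Rightarrow> rat fps fps" where
  "scale f = Abs_fps (\<lambda>k. fps_X ^ k * f $ k)"

lemma scale_inj: "scale f = scale g \<Longrightarrow> f = g"
  by (rule fps_ext) (simp add: scale_def fps_eq_iff[of "Abs_fps _"])

lemma scale_add: "scale (f + g) = scale f + scale g" by (rule fps_ext) (simp add: scale_def algebra_simps)
lemma scale_diff: "scale (f - g) = scale f - scale g" by (rule fps_ext) (simp add: scale_def algebra_simps)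
lemma scale_const: "scale (fps_const c) = fps_const c" by (rule fps_ext) (simp add: scale_def)
lemma scale_mult: "scale (f * g) = scale f * scale g"
proof (rule fps_ext)
  fix k
  have "fps_X ^ k * (f $ i * g $ (k - i)) = (fps_X ^ i * f $ i) * (fps_X ^ (k - i) * g $ (k - i))" if "i \<in> {0..k}" for i
  proof -
    have "(fps_X :: rat fps) ^ k = fps_X ^ i * fps_X ^ (k - i)" using that by (simp flip: power_add)
    then show ?thesis by (simp add: ac_simps)
  qed
  then have "(\<Sum>i=0..k. fps_X ^ k * (f $ i * g $ (k - i))) = (\<Sum>i=0..k. (fps_X ^ i * f $ i) * (fps_X ^ (k - i) * g $ (k - i)))"
    by (rule sum.cong[OF refl])
  then show "scale (f * g) $ k = (scale f * scale g) $ k"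
    by (simp only: scale_def fps_mult_nth sum_distrib_left fps_nth_Abs_fps)
qed
lemma scale_1: "scale 1 = 1" using scale_const[of 1] by simp
lemma scale_power: "scale (f ^ n) = scale f ^ n" by (induction n) (simp_all add: scale_1 scale_mult)
lemma scale_numeral: "scale (numeral k) = numeral k" using scale_const[of "numeral k"] by (simp add: numeral_fps_const)
lemma scale_fps_X: "scale fps_X = fps_const fps_X * fps_X"
proof (rule fps_ext)
  fix k show "scale fps_X $ k = (fps_const fps_X * fps_X) $ k"
    by (cases "k = 1") (auto simp: scale_def fps_X_def)
qed
lemmas scale_hom = scale_add scale_diff scale_1 scale_mult scale_power scale_numeral scale_fps_X scale_const

lemma scale_ntgf: "scale (ntgf 3 0) = Abs_fps qs"
  by (rule fps_ext) (simp add: scale_def ntgf_outer qs_def)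

text \<open>This is the cubic at a = y / t multiplied by t^2, with the term containing
  \<open>qs 2\<close> moved to the right.\<close>

lemma ntgf_cubic:
  fixes F y t :: "rat fps fps"
  assumes F: "F = ntgf 3 0" and t: "t = fps_const fps_X" and y: "y = fps_X"
  shows "4 * t ^ 3 * y ^ 5 * F ^ 3 - t * y ^ 2 * (8 * y ^ 2 + 10 * t * y - t ^ 2) * F ^ 2 +
     (2 * t * y + 4 * y ^ 2 + 6 * t ^ 2 * y ^ 3 - 2 * t ^ 2) * F + 2 * t ^ 2 - 2 * t * y - 4 * y ^ 2 - t ^ 3 * y ^ 2
     = - 2 * y ^ 2 * fps_const (qs 2)" (is "?L = ?R")
proof -
  define G where "G = Abs_fps qs"
  have "swap (cubic (lift (qs 2)) Wser) = 0" unfolding Wser_cubic swap_0 ..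
  then have c: "4 * (t ^ 3) ^ 2 * y ^ 5 * G ^ 3 - t ^ 3 * (8 * y ^ 2 + 10 * y - 1) * y ^ 2 * G ^ 2 +
     (4 * y ^ 2 + 2 * y - 2 + 6 * t ^ 3 * y ^ 3) * G + 2 - 2 * y - 4 * y ^ 2 + (2 * fps_const (qs 2) - t ^ 3) * y ^ 2 = 0"
    unfolding cubic_def swap_hom swap_Wser t y G_def .
  have "scale (?L + 2 * y ^ 2 * fps_const (qs 2)) = 0"
  proof -
    have sF: "scale F = G" unfolding F G_def by (rule scale_ntgf)
    have st: "scale t = t" unfolding t by (rule scale_const)
    have sy: "scale y = t * y" unfolding t y by (rule scale_fps_X)
    show ?thesis
      unfolding scale_hom sF st sy using c by algebra
  qed
  moreover have "scale 0 = 0" using scale_const[of 0] by simp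
  ultimately have "scale (?L + 2 * y ^ 2 * fps_const (qs 2)) = scale 0" by (simp only:)
  then have "?L + 2 * y ^ 2 * fps_const (qs 2) = 0" by (rule scale_inj)
  then show ?thesis by algebra
qed

lemma qs_2_linear:
  fixes S q z :: "'a :: idom"
  assumes "S = z * (1 + 2 * S)\<^sup>2" "q = 2 * z * (1 + S - S\<^sup>2)"
  shows "2 * q = 5 * z + (8 * z - 1) * S"
  using assms by algebra

text \<open>By \<open>qs_2_linear\<close> the series \<open>qs 2\<close> is affine in S over Q(t),
  so the quadratic equation of S carries over to it. The norm of the cubic is formed with this
  equation.\<close>

lemma qs_2_quadratic: "8 * fps_X ^ 3 * qs 2 ^ 2 - (8 * (fps_X ^ 3) ^ 2 + 12 * fps_X ^ 3 - 1) * qs 2 +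
    2 * fps_X ^ 3 * ((fps_X ^ 3) ^ 2 + 11 * fps_X ^ 3 - 1) = 0"
proof -
  obtain S :: "rat fps" where S: "S = fps_X ^ 3 * (1 + 2 * S)\<^sup>2" using S_unique by blast
  define z :: "rat fps" where "z = fps_X ^ 3"
  have r: "4 * z * S\<^sup>2 + (4 * z - 1) * S + z = 0" using S unfolding z_def[symmetric] by algebra
  have l: "2 * qs 2 = 5 * z + (8 * z - 1) * S"
    by (rule qs_2_linear) (use S qs_2[OF S] in \<open>simp_all add: z_def\<close>)
  define X where "X = 8 * z * qs 2 ^ 2 - (8 * z ^ 2 + 12 * z - 1) * qs 2 + 2 * z * (z ^ 2 + 11 * z - 1)"
  have "2 * X = 4 * z * (2 * qs 2) ^ 2 - (8 * z ^ 2 + 12 * z - 1) * (2 * qs 2) + 4 * z * (z ^ 2 + 11 * z - 1)"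
    unfolding X_def by algebra
  also have "\<dots> = 0" unfolding l using r by algebra
  finally have "X = 0" by simp
  then show ?thesis unfolding X_def z_def .
qed

section \<open>Coefficients generated by t^3 and the degree-2 series\<close>

definition coeffs_in :: "rat fps set \<Rightarrow> nat \<Rightarrow> rat fps fps \<Rightarrow> bool" where
  "coeffs_in K n f \<longleftrightarrow> (\<forall>j<n. f $ j \<in> K)"

definition subring :: "rat fps set \<Rightarrow> bool" where
  "subring K \<longleftrightarrow> (\<forall>c. fps_const c \<in> K) \<and> (\<forall>f\<in>K. \<forall>g\<in>K. f + g \<in> K \<and> f * g \<in> K)"

lemma subring_const: "subring K \<Longrightarrow> fps_const c \<in> K" and subring_add: "subring K \<Longrightarrow> f \<in> K \<Longrightarrow> g \<in> K \<Longrightarrow> f + g \<in> K"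
  and subring_mult: "subring K \<Longrightarrow> f \<in> K \<Longrightarrow> g \<in> K \<Longrightarrow> f * g \<in> K"
  unfolding subring_def by blast+

lemma subring_0: "subring K \<Longrightarrow> 0 \<in> K" using subring_const[of K 0] by simp

lemma subring_sum: "subring K \<Longrightarrow> (\<And>i. i \<in> I \<Longrightarrow> f i \<in> K) \<Longrightarrow> (\<Sum>i\<in>I. f i) \<in> K"
  by (induction I rule: infinite_finite_induct) (auto simp: subring_0 subring_add)

lemma coeffs_in_mult:
  assumes "subring K" "coeffs_in K n f" "coeffs_in K n g"
  shows "coeffs_in K n (f * g)"
  unfolding coeffs_in_def fps_mult_nth
  using assms unfolding coeffs_in_def by (auto intro!: subring_sum subring_mult)

lemma coeffs_in_add: "subring K \<Longrightarrow> coeffs_in K n f \<Longrightarrow> coeffs_in K n g \<Longrightarrow> coeffs_in K n (f + g)"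
  unfolding coeffs_in_def by (auto intro: subring_add)

lemma coeffs_in_const: "subring K \<Longrightarrow> c \<in> K \<Longrightarrow> coeffs_in K n (fps_const c)"
  unfolding coeffs_in_def by (auto simp: subring_0)

lemma coeffs_in_fps_X: "subring K \<Longrightarrow> coeffs_in K n fps_X"
  using subring_const[of K 1] by (auto simp: coeffs_in_def fps_X_def subring_0)

lemma coeffs_in_shift: "subring K \<Longrightarrow> coeffs_in K n f \<Longrightarrow> coeffs_in K (Suc n) (fps_X * f)"
  unfolding coeffs_in_def by (auto simp: subring_0)

text \<open>The cubic has linear part -2 W at a = 0, so it can be solved as G = 1 + y \<Psi> with
  \<Psi> a polynomial in G, y, t^3 and \<open>qs 2\<close>. Each coefficient is therefore a
  polynomial in earlier ones.\<close>

lemma qs_in_subring: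
  assumes K: "subring K" and z: "fps_X ^ 3 \<in> K" and q: "qs 2 \<in> K"
  shows "qs k \<in> K"
proof -
  define G where "G = Abs_fps qs"
  define t y :: "rat fps fps" where "t = fps_const fps_X" and "y = fps_X"
  define h :: "rat fps fps" where "h = fps_const (fps_const (1 / 2))"
  define u :: "rat fps fps" where "u = fps_const (fps_const (- 1))"
  define Z where "Z = fps_const (fps_X ^ 3 :: rat fps)"
  define Q where "Q = fps_const (qs 2)"
  have h2: "2 * h = 1" unfolding h_def by (simp add: numeral_fps_const)
  have u: "u = - 1" unfolding u_def by (simp flip: fps_const_neg)
  have tZ: "t ^ 3 = Z" unfolding t_def Z_def by (simp add: fps_const_power)
  have "swap (cubic (lift (qs 2)) Wser) = 0" unfolding Wser_cubic swap_0 ..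
  then have c: "4 * (t ^ 3) ^ 2 * y ^ 5 * G ^ 3 - t ^ 3 * (8 * y ^ 2 + 10 * y - 1) * y ^ 2 * G ^ 2 +
     (4 * y ^ 2 + 2 * y - 2 + 6 * t ^ 3 * y ^ 3) * G + 2 - 2 * y - 4 * y ^ 2 + (2 * fps_const (qs 2) - t ^ 3) * y ^ 2 = 0"
    unfolding cubic_def swap_hom swap_Wser t_def y_def G_def .
  have num: "1 + 1 = (2 :: rat fps fps)" by simp
  \<comment> \<open>Numerals are written as sums of 1, and u, h stand for -1 and 1/2, so that the
    expression is visibly composed of members of the subring by addition and multiplication.\<close>
  define \<Psi> where "\<Psi> = (1 + 1) * (Z * Z) * (y * y * y * y) * (G * G * G) +
      u * h * Z * ((1+1)*(1+1)*(1+1) * (y * y) + (1+1)*((1+1)*(1+1) + 1) * y + u) * y * (G * G) +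
      ((1 + 1) * y + 1 + (1 + 1 + 1) * Z * (y * y)) * G + u + u * (1 + 1) * y + (Q + u * h * Z) * y"
  have G: "G = 1 + y * \<Psi>"
  proof -
    define X where "X = G - (1 + y * \<Psi>)"
    have "2 * X = 0"
      unfolding X_def \<Psi>_def u using c h2 unfolding tZ Q_def[symmetric] by algebra
    moreover have "(2 :: rat fps fps) \<noteq> 0" using h2 by auto
    ultimately have "X = 0" by (metis mult_eq_0_iff)
    then show ?thesis unfolding X_def by simp
  qed
  have good: "coeffs_in K n G" for n
  proof (induction n)
    case 0
    then show ?case by (simp add: coeffs_in_def)
  next
    case (Suc n)
    have 1: "coeffs_in K m 1" for m using coeffs_in_const[OF K subring_const[OF K, of 1]] by simp
    have hu: "coeffs_in K m h" "coeffs_in K m u" "coeffs_in K m Z" "coeffs_in K m Q" "coeffs_in K m y" for m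
      unfolding h_def u_def Z_def Q_def y_def
      by (intro coeffs_in_const coeffs_in_fps_X K z q subring_const)+
    have "coeffs_in K n \<Psi>" unfolding \<Psi>_def
      by (intro coeffs_in_add[OF K] coeffs_in_mult[OF K] 1 hu Suc)
    then have "coeffs_in K (Suc n) (1 + y * \<Psi>)"
      unfolding y_def by (intro coeffs_in_add[OF K] 1 coeffs_in_shift[OF K])
    then show ?case using G by simp
  qed
  then have "G $ k \<in> K" using good[of "Suc k"] unfolding coeffs_in_def by blast
  then show ?thesis unfolding G_def by simp
qed

lemma fps_of_poly_numeral: "fps_of_poly (numeral k) = numeral k"
  by (simp add: numeral_poly numeral_fps_const fps_of_poly_const)

lemma rat_fun_subring: "subring {g. rat_fun_of g S}"
proof -
  define e where "e p = poly (map_poly fps_const p) S" for p :: "rat poly"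
  have e_add: "e (p + q) = e p + e q" for p q
  proof -
    have "map_poly fps_const (p + q) = map_poly fps_const p + map_poly fps_const q"
      by (rule poly_eqI) (simp add: coeff_map_poly flip: fps_const_add)
    then show ?thesis unfolding e_def by simp
  qed
  have e_mult: "e (p * q) = e p * e q" for p q
  proof -
    have "map_poly fps_const (p * q) = map_poly fps_const p * map_poly fps_const q"
    proof (rule poly_eqI)
      have s: "fps_const (sum h I) = (\<Sum>i\<in>I. fps_const (h i))" for h :: "nat \<Rightarrow> rat" and I
        by (induction I rule: infinite_finite_induct) (simp_all flip: fps_const_add)
      fix n show "coeff (map_poly fps_const (p * q)) n = coeff (map_poly fps_const p * map_poly fps_const q) n"
        by (simp add: coeff_map_poly coeff_mult s flip: fps_const_mult)
    qed
    then show ?thesis unfolding e_def by simp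
  qed
  have e_const: "e [:c:] = fps_const c" for c unfolding e_def by (simp add: map_poly_pCons)
  have r: "rat_fun_of g S \<longleftrightarrow> (\<exists>A B. B \<noteq> 0 \<and> g * e B = e A)" for g unfolding rat_fun_of_def e_def ..
  have const: "rat_fun_of (fps_const c) S" for c
    unfolding r by (rule exI[of _ "[:c:]"], rule exI[of _ "[:1:]"]) (simp add: e_const)
  have add_mult: "rat_fun_of (f + g) S \<and> rat_fun_of (f * g) S" if fg: "rat_fun_of f S" "rat_fun_of g S" for f g
  proof -
    obtain A B A' B' where h: "B \<noteq> 0" "f * e B = e A" "B' \<noteq> 0" "g * e B' = e A'" using fg unfolding r by blast
    have "(f + g) * e (B * B') = e (A * B' + A' * B)" unfolding e_mult e_add h(2,4)[symmetric] by algebra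
    moreover have "(f * g) * e (B * B') = e (A * A')" unfolding e_mult h(2,4)[symmetric] by algebra
    moreover have "B * B' \<noteq> 0" using h by simp
    ultimately show ?thesis unfolding r by blast
  qed
  show ?thesis unfolding subring_def using const add_mult by simp
qed

text \<open>The two generators are rational in S: t^3 = S / (1 + 2 S)^2 by the equation of S, and
  \<open>qs 2\<close> by its explicit form. The polynomial [:1, 4, 4:] is the denominator (1 + 2
  S)^2.\<close>

lemma rat_fun_qs:
  assumes S: "S = fps_X ^ 3 * (1 + 2 * S)\<^sup>2"
  shows "rat_fun_of (qs k) S"
proof -
  let ?K = "{g. rat_fun_of g S}"
  have K: "subring ?K" by (rule rat_fun_subring)
  have SK: "S \<in> ?K"
  proof -
    have "S * poly (map_poly fps_const [:1:]) S = poly (map_poly fps_const [:0, 1:]) S" by (simp add: map_poly_pCons)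
    moreover have "[:1:] \<noteq> (0 :: rat poly)" by simp
    ultimately show ?thesis unfolding rat_fun_of_def by blast
  qed
  have zK: "fps_X ^ 3 \<in> ?K"
  proof -
    have "fps_X ^ 3 * poly (map_poly fps_const [:1, 4, 4:]) S = poly (map_poly fps_const [:0, 1:]) S"
    proof -
      have "fps_X ^ 3 * poly (map_poly fps_const [:1, 4, 4:]) S = fps_X ^ 3 * (1 + 2 * S)\<^sup>2"
      proof -
        have e: "fps_const 4 = (4 :: rat fps)" by (simp add: numeral_fps_const)
        have "poly (map_poly fps_const [:1, 4, 4:]) S = 1 + S * (fps_const 4 + S * fps_const 4)"
          by (simp add: map_poly_pCons)
        also have "\<dots> = (1 + 2 * S)\<^sup>2" unfolding e by algebra
        finally have "poly (map_poly fps_const [:1, 4, 4:]) S = (1 + 2 * S)\<^sup>2" .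
        then show ?thesis by simp
      qed
      also have "\<dots> = S" by (rule S[symmetric])
      finally show ?thesis by (simp add: map_poly_pCons)
    qed
    moreover have "[:1, 4, 4:] \<noteq> (0 :: rat poly)" by simp
    ultimately show ?thesis unfolding rat_fun_of_def by blast
  qed
  have "qs 2 = fps_const 2 * fps_X ^ 3 * (fps_const 1 + S + fps_const (- 1) * (S * S))"
    unfolding qs_2[OF S] by (simp add: numeral_fps_const power2_eq_square flip: fps_const_neg)
  moreover have "fps_const 2 * fps_X ^ 3 * (fps_const 1 + S + fps_const (- 1) * (S * S)) \<in> ?K"
    by (intro subring_mult[OF K] subring_add[OF K] subring_const[OF K] SK zK)
  ultimately have "qs 2 \<in> ?K" by simp
  then have "qs k \<in> ?K" by (rule qs_in_subring[OF K zK])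
  then show ?thesis by simp
qed

section \<open>The quadratic extension generated by S\<close>

definition in_quad :: "rat fps \<Rightarrow> rat fps \<Rightarrow> bool" where
  "in_quad S f \<longleftrightarrow> (\<exists>D M N :: rat poly. D \<noteq> 0 \<and> fps_of_poly D * f = fps_of_poly M + fps_of_poly N * S)"

lemma quad_relation:
  assumes S: "S = fps_X ^ 3 * (1 + 2 * S)\<^sup>2"
  shows "4 * fps_X ^ 3 * S\<^sup>2 = (1 - 4 * fps_X ^ 3) * S - (fps_X ^ 3 :: rat fps)"
proof -
  define z :: "rat fps" where "z = fps_X ^ 3"
  show ?thesis using S unfolding z_def[symmetric] by algebra
qed

lemma in_quad_subring:
  assumes S: "S = fps_X ^ 3 * (1 + 2 * S)\<^sup>2"
  shows "subring {f. in_quad S f}"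
proof -
  define x :: "rat poly" where "x = monom 1 3"
  have x: "fps_of_poly x = fps_X ^ 3" "x \<noteq> 0" unfolding x_def by (simp_all add: fps_of_poly_monom')
  note hom = fps_of_poly_add fps_of_poly_diff fps_of_poly_mult fps_of_poly_numeral fps_of_poly_1 x(1)
  note r = quad_relation[OF S]
  have const: "in_quad S (fps_const c)" for c
    unfolding in_quad_def
    by (rule exI[of _ 1], rule exI[of _ "[:c:]"], rule exI[of _ 0]) (simp add: fps_of_poly_const)
  have am: "in_quad S (f + g) \<and> in_quad S (f * g)" if fg: "in_quad S f" "in_quad S g" for f g
  proof -
    obtain D M N D' M' N' where h: "D \<noteq> 0" "fps_of_poly D * f = fps_of_poly M + fps_of_poly N * S"
      "D' \<noteq> 0" "fps_of_poly D' * g = fps_of_poly M' + fps_of_poly N' * S" using fg unfolding in_quad_def by blast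
    have "fps_of_poly (D * D') * (f + g) = fps_of_poly (D' * M + D * M') + fps_of_poly (D' * N + D * N') * S"
      unfolding hom using h(2,4) by algebra
    moreover have "D * D' \<noteq> 0" using h by simp
    ultimately have 1: "in_quad S (f + g)" unfolding in_quad_def by blast
    \<comment> \<open>The factor 4 t^3 is the leading coefficient of the quadratic equation of S;
      with it in the denominator, the S^2 of a product can be reduced.\<close>
    have "fps_of_poly (4 * x * D * D') * (f * g) = 4 * fps_X ^ 3 * ((fps_of_poly D * f) * (fps_of_poly D' * g))"
      unfolding hom by algebra
    also have "\<dots> = 4 * fps_X ^ 3 * (fps_of_poly M * fps_of_poly M')
        + 4 * fps_X ^ 3 * (fps_of_poly M * fps_of_poly N' + fps_of_poly M' * fps_of_poly N) * S
        + fps_of_poly N * fps_of_poly N' * (4 * fps_X ^ 3 * S\<^sup>2)" unfolding h(2,4) by algebra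
    also have "\<dots> = fps_of_poly (4 * x * M * M' - N * N' * x) +
        fps_of_poly (4 * x * (M * N' + M' * N) + N * N' * (1 - 4 * x)) * S"
      unfolding hom r by algebra
    finally have "fps_of_poly (4 * x * D * D') * (f * g) = fps_of_poly (4 * x * M * M' - N * N' * x) +
        fps_of_poly (4 * x * (M * N' + M' * N) + N * N' * (1 - 4 * x)) * S" .
    moreover have "4 * x * D * D' \<noteq> 0" using h x by simp
    ultimately have "in_quad S (f * g)" unfolding in_quad_def by blast
    then show ?thesis using 1 by simp
  qed
  show ?thesis unfolding subring_def using const am by simp
qed

lemma alg_deg_le_outer: "alg_deg_le (outer k) 2"
proof -
  obtain S :: "rat fps" where S: "S = fps_X ^ 3 * (1 + 2 * S)\<^sup>2" using S_unique by blast
  let ?K = "{f. in_quad S f}"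
  define x :: "rat poly" where "x = monom 1 3"
  have x: "fps_of_poly x = fps_X ^ 3" "x \<noteq> 0" unfolding x_def by (simp_all add: fps_of_poly_monom')
  note hom = fps_of_poly_add fps_of_poly_diff fps_of_poly_mult fps_of_poly_numeral fps_of_poly_1 x(1)
  have K: "subring ?K" by (rule in_quad_subring[OF S])
  have zK: "fps_X ^ 3 \<in> ?K"
    unfolding in_quad_def mem_Collect_eq
    by (rule exI[of _ 1], rule exI[of _ x], rule exI[of _ 0]) (simp add: x)
  have SK: "S \<in> ?K"
    unfolding in_quad_def mem_Collect_eq
    by (rule exI[of _ 1], rule exI[of _ 0], rule exI[of _ 1]) simp
  have "qs 2 = fps_const 2 * fps_X ^ 3 * (fps_const 1 + S + fps_const (- 1) * (S * S))"
    unfolding qs_2[OF S] by (simp add: numeral_fps_const power2_eq_square flip: fps_const_neg)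
  moreover have "fps_const 2 * fps_X ^ 3 * (fps_const 1 + S + fps_const (- 1) * (S * S)) \<in> ?K"
    by (intro subring_mult[OF K] subring_add[OF K] subring_const[OF K] SK zK)
  ultimately have "qs 2 \<in> ?K" by simp
  then have "qs k \<in> ?K" by (rule qs_in_subring[OF K zK])
  then obtain D M N where h: "D \<noteq> 0" "fps_of_poly D * qs k = fps_of_poly M + fps_of_poly N * S"
    unfolding in_quad_def by blast
  define E where "E = D * monom 1 k"
  have E0: "E \<noteq> 0" unfolding E_def using h(1) by simp
  have E: "fps_of_poly E * outer k = fps_of_poly M + fps_of_poly N * S"
    using h(2) unfolding E_def qs_def fps_of_poly_mult by (simp add: fps_of_poly_monom' ac_simps)
  \<comment> \<open>Let f be the outer series. Substituting N S = E f - M into N^2 times the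
    quadratic 4 t^3 S^2 - (1 - 4 t^3) S + t^3 = 0 gives a polynomial in f with coefficients
    \<open>a0\<close>, \<open>- a1\<close>, \<open>a2\<close>.\<close>
  define a0 where "a0 = 4 * x * M * M + (1 - 4 * x) * N * M + x * N * N"
  define a1 where "a1 = 8 * x * E * M + (1 - 4 * x) * N * E"
  define a2 where "a2 = 4 * x * E * E"
  define P where "P = [:a0, - a1, a2:]"
  have "poly (map_poly fps_of_poly P) (outer k) =
      fps_of_poly a0 - fps_of_poly a1 * outer k + fps_of_poly a2 * (outer k * outer k)"
    unfolding P_def by (simp add: map_poly_pCons fps_of_poly_uminus algebra_simps)
  also have "\<dots> = 0"
    unfolding a0_def a1_def a2_def hom using E quad_relation[OF S] by algebra
  finally have "poly (map_poly fps_of_poly P) (outer k) = 0" .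
  moreover have "P \<noteq> 0" unfolding P_def a2_def using E0 x by simp
  moreover have "degree P \<le> 2" unfolding P_def by simp
  ultimately show ?thesis unfolding alg_deg_le_def by blast
qed

section \<open>Degree six\<close>

locale ring_map =
  fixes h :: "'a :: comm_ring_1 \<Rightarrow> 'b :: comm_ring_1"
  assumes add: "h (x + y) = h x + h y" and mult: "h (x * y) = h x * h y" and one: "h 1 = 1"
begin

lemma zero: "h 0 = 0" using add[of 0 0] by simp
lemma uminus: "h (- x) = - h x" using add[of x "- x"] zero by (simp add: eq_neg_iff_add_eq_0 add.commute)
lemma diff: "h (x - y) = h x - h y" using add[of x "- y"] uminus by simp
lemma power: "h (x ^ n) = h x ^ n" by (induction n) (simp_all add: one mult)
lemma numeral: "h (numeral k) = numeral k"
proof -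
  have "h (of_nat n) = of_nat n" for n by (induction n) (simp_all add: zero one add)
  from this[of "numeral k"] show ?thesis by simp
qed
lemma sum: "h (\<Sum>i\<in>I. f i) = (\<Sum>i\<in>I. h (f i))"
  by (induction I rule: infinite_finite_induct) (simp_all add: zero add)

lemmas hom = add diff mult one uminus power numeral

lemma coeff_map: "coeff (map_poly h p) n = h (coeff p n)"
  by (simp add: coeff_map_poly zero)

lemma map_add: "map_poly h (p + q) = map_poly h p + map_poly h q"
  by (rule poly_eqI) (simp add: coeff_map add)

lemma map_mult: "map_poly h (p * q) = map_poly h p * map_poly h q"
  by (rule poly_eqI) (simp add: coeff_map coeff_mult sum mult)

lemma map_1: "map_poly h 1 = 1"
  by (simp add: one_pCons map_poly_pCons one zero)

lemma ring_map_map_poly: "ring_map (map_poly h)"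
  by unfold_locales (simp_all add: map_add map_mult map_1)

lemma ring_map_eval: "ring_map (\<lambda>p. poly (map_poly h p) x)"
  by unfold_locales (simp_all add: map_add map_mult map_1)

end

lemma ring_map_pcompose: "ring_map (\<lambda>p. pcompose p q)"
  by unfold_locales (simp_all add: pcompose_add pcompose_mult one_pCons pcompose_pCons)

lemma ring_map_comp: "ring_map f \<Longrightarrow> ring_map g \<Longrightarrow> ring_map (\<lambda>x. f (g x))"
  by (simp add: ring_map_def)

text \<open>One slope of a Newton polygon: if all roots of M have valuation r/s, then a factor of
  degree d has constant term of valuation rd/s, which must be an integer.\<close>

lemma newton_slope:
  fixes A B M :: "'a :: idom poly poly"
  assumes M: "M = A * B" and s: "s > 0"
    and low: "\<And>i k. s * k + r * i < r * degree M \<Longrightarrow> coeff (coeff M i) k = 0"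
    and top: "coeff (coeff M (degree M)) 0 \<noteq> 0" and bot: "coeff (coeff M 0) K \<noteq> 0" "s * K = r * degree M"
  shows "s dvd r * degree A"
proof -
  let ?n = "degree M"
  have M0: "M \<noteq> 0" using top by auto
  then have A0: "A \<noteq> 0" and B0: "B \<noteq> 0" unfolding M by auto
  have deg: "?n = degree A + degree B" unfolding M using A0 B0 by (rule degree_mult_eq)
  \<comment> \<open>The minimal weight of a monomial, where the inner variable has weight s and the
    outer one weight r. The hypotheses place both ends of M on the line of weight r n, with nothing
    of M below it.\<close>
  define w where "w P = (LEAST m. \<exists>i k. coeff (coeff P i) k \<noteq> 0 \<and> m = s * k + r * i)" for P :: "'a poly poly"
  have ex: "\<exists>m i k. coeff (coeff P i) k \<noteq> 0 \<and> m = s * k + r * i" if "P \<noteq> 0" for P :: "'a poly poly"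
  proof -
    have "coeff (coeff P (degree P)) (degree (coeff P (degree P))) \<noteq> 0" using that by simp
    then show ?thesis by blast
  qed
  have wle: "w P \<le> s * k + r * i" if "coeff (coeff P i) k \<noteq> 0" for P i k
    unfolding w_def by (rule Least_le) (use that in blast)
  have wex: "\<exists>i k. coeff (coeff P i) k \<noteq> 0 \<and> w P = s * k + r * i" if "P \<noteq> 0" for P
    unfolding w_def by (rule LeastI_ex) (use ex[OF that] in blast)
  \<comment> \<open>Among the monomials of minimal weight the one with least outer exponent is
    chosen. The product of the two chosen monomials arises in A B in a single way, so it cannot
    cancel, and the minimal weights add up to at least r n.\<close>
  define f where "f P = (LEAST i. \<exists>k. coeff (coeff P i) k \<noteq> 0 \<and> w P = s * k + r * i)" for P :: "'a poly poly"
  have fex: "\<exists>k. coeff (coeff P (f P)) k \<noteq> 0 \<and> w P = s * k + r * f P" if "P \<noteq> 0" for P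
    unfolding f_def by (rule LeastI_ex) (use wex[OF that] in blast)
  have fle: "f P \<le> i" if "coeff (coeff P i) k \<noteq> 0" "w P = s * k + r * i" for P i k
    unfolding f_def by (rule Least_le) (use that in blast)
  obtain k where k: "coeff (coeff A (f A)) k \<noteq> 0" "w A = s * k + r * f A" using fex[OF A0] by blast
  obtain l where l: "coeff (coeff B (f B)) l \<noteq> 0" "w B = s * l + r * f B" using fex[OF B0] by blast
  have cM: "coeff (coeff M i) m = (\<Sum>j\<le>i. \<Sum>p\<le>m. coeff (coeff A j) p * coeff (coeff B (i - j)) (m - p))" for i m
    unfolding M by (simp add: coeff_mult coeff_sum)
  have zero: "coeff (coeff A j) p * coeff (coeff B (f A + f B - j)) (k + l - p) = 0"
    if j: "j \<le> f A + f B" and p: "p \<le> k + l" and ne: "\<not> (j = f A \<and> p = k)" for j p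
  proof (rule ccontr)
    assume "coeff (coeff A j) p * coeff (coeff B (f A + f B - j)) (k + l - p) \<noteq> 0"
    then have a: "coeff (coeff A j) p \<noteq> 0" and b: "coeff (coeff B (f A + f B - j)) (k + l - p) \<noteq> 0" by auto
    have "s * (k + l - p) + s * p = s * (k + l)" using p by (simp flip: distrib_left)
    moreover have "r * (f A + f B - j) + r * j = r * (f A + f B)" using j by (simp flip: distrib_left)
    ultimately have tot: "(s * p + r * j) + (s * (k + l - p) + r * (f A + f B - j)) = w A + w B"
      unfolding k(2) l(2) by (simp add: algebra_simps)
    have e: "w A = s * p + r * j" "w B = s * (k + l - p) + r * (f A + f B - j)"
      using wle[OF a] wle[OF b] tot by linarith+
    have "f A \<le> j" "f B \<le> f A + f B - j" using fle[OF a e(1)] fle[OF b e(2)] .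
    then have "j = f A" using j by linarith
    then have "s * p + r * f A = s * k + r * f A" using e(1) k(2) by metis
    then have "p = k" using s by simp
    then show False using ne \<open>j = f A\<close> by blast
  qed
  have "coeff (coeff M (f A + f B)) (k + l) = (\<Sum>j\<le>f A + f B. \<Sum>p\<le>k + l.
      if j = f A \<and> p = k then coeff (coeff A (f A)) k * coeff (coeff B (f B)) l else 0)"
    unfolding cM
  proof (intro sum.cong refl)
    fix j p assume "j \<in> {..f A + f B}" "p \<in> {..k + l}"
    then show "coeff (coeff A j) p * coeff (coeff B (f A + f B - j)) (k + l - p) =
      (if j = f A \<and> p = k then coeff (coeff A (f A)) k * coeff (coeff B (f B)) l else 0)"
      using zero[of j p] by auto
  qed
  also have "\<dots> = (\<Sum>j\<le>f A + f B. if j = f A then (\<Sum>p\<le>k + l. if p = k then coeff (coeff A (f A)) k * coeff (coeff B (f B)) l else 0) else 0)"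
    by (intro sum.cong refl) auto
  also have "\<dots> = coeff (coeff A (f A)) k * coeff (coeff B (f B)) l" by simp
  finally have "coeff (coeff M (f A + f B)) (k + l) \<noteq> 0" using k(1) l(1) by simp
  then have "\<not> s * (k + l) + r * (f A + f B) < r * ?n" using low by blast
  then have wAB: "w A + w B \<ge> r * ?n" unfolding k(2) l(2) by (simp add: algebra_simps)
  \<comment> \<open>The monomial of order K in the constant term of M comes from constant terms of A
    and B of weights s p and s (K - p). Their sum is s K = r n, so both weights are minimal.\<close>
  have "coeff (coeff M 0) K = (\<Sum>p\<le>K. coeff (coeff A 0) p * coeff (coeff B 0) (K - p))" unfolding cM by simp
  then have "\<exists>p\<in>{..K}. coeff (coeff A 0) p * coeff (coeff B 0) (K - p) \<noteq> 0"
    using bot(1) sum.not_neutral_contains_not_neutral by (metis (lifting))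
  then obtain p where p: "p \<le> K" "coeff (coeff A 0) p \<noteq> 0" "coeff (coeff B 0) (K - p) \<noteq> 0" by auto
  have "s * p + s * (K - p) = s * K" using p(1) by (simp flip: distrib_left)
  moreover have "w A \<le> s * p" "w B \<le> s * (K - p)" using wle[OF p(2)] wle[OF p(3)] by simp_all
  ultimately have wA: "w A = s * p" using wAB bot(2) by linarith
  have "coeff (coeff M ?n) 0 = coeff (lead_coeff A * lead_coeff B) 0"
    unfolding deg unfolding M coeff_mult_degree_sum ..
  then have "coeff (lead_coeff A) 0 \<noteq> 0" "coeff (lead_coeff B) 0 \<noteq> 0"
    using top by (auto simp: coeff_mult)
  \<comment> \<open>The leading coefficients of A and B have order 0 because that of M has. This
    bounds each weight by r times the degree, and the lower bound on the sum forces
    equality.\<close>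
  then have "w A \<le> r * degree A" "w B \<le> r * degree B" using wle[of A "degree A" 0] wle[of B "degree B" 0] by simp_all
  moreover have "r * ?n = r * degree A + r * degree B" unfolding deg by (simp add: distrib_left)
  ultimately have "w A = r * degree A" using wAB by linarith
  then show ?thesis using wA by (metis dvd_triv_left)
qed

section \<open>The annihilating sextic\<close>

definition poly_t :: "rat poly poly" where "poly_t = [:[:0, 1:]:]"
definition poly_y :: "rat poly poly" where "poly_y = [:0, 1:]"

text \<open>The left side of \<open>ntgf_cubic\<close> as a polynomial in the series; its value at
  the series is -2 y^2 \<open>qs 2\<close>.\<close>

definition cubic_poly :: "rat poly poly poly" where
  "cubic_poly = [:2 * poly_t ^ 2 - 2 * poly_t * poly_y - 4 * poly_y ^ 2 - poly_t ^ 3 * poly_y ^ 2,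
     2 * poly_t * poly_y + 4 * poly_y ^ 2 + 6 * poly_t ^ 2 * poly_y ^ 3 - 2 * poly_t ^ 2,
     - (poly_t * poly_y ^ 2 * (8 * poly_y ^ 2 + 10 * poly_t * poly_y - poly_t ^ 2)),
     4 * poly_t ^ 3 * poly_y ^ 5:]"

text \<open>The norm of the cubic over the quadratic extension generated by the degree-2 coefficient.\<close>

definition sextic :: "rat poly poly poly" where
  "sextic = smult (4 * poly_t ^ 3) (cubic_poly ^ 2) + smult (poly_y ^ 2 * (8 * poly_t ^ 6 + 12 * poly_t ^ 3 - 1)) cubic_poly +
     [:4 * poly_t ^ 3 * poly_y ^ 4 * (poly_t ^ 6 + 11 * poly_t ^ 3 - 1):]"

lemma degree_sextic: "degree sextic = 6"
proof -
  have t: "poly_t \<noteq> 0" "poly_y \<noteq> 0" unfolding poly_t_def poly_y_def by simp_all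
  then have "4 * poly_t ^ 3 * poly_y ^ 5 \<noteq> 0" by simp
  then have C: "degree cubic_poly = 3" "cubic_poly \<noteq> 0" unfolding cubic_poly_def by simp_all
  have 1: "degree (smult (4 * poly_t ^ 3) (cubic_poly ^ 2)) = 6" using C t by (simp add: degree_power_eq)
  have "degree (smult (poly_y ^ 2 * (8 * poly_t ^ 6 + 12 * poly_t ^ 3 - 1)) cubic_poly) \<le> 3"
    using degree_smult_le[of _ cubic_poly] C(1) by simp
  then have "degree (smult (4 * poly_t ^ 3) (cubic_poly ^ 2) + smult (poly_y ^ 2 * (8 * poly_t ^ 6 + 12 * poly_t ^ 3 - 1)) cubic_poly) = 6"
    using 1 by (subst degree_add_eq_left) simp_all
  then show ?thesis unfolding sextic_def by (subst degree_add_eq_left) simp_all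
qed

lemma ring_map_fps_of_poly: "ring_map (fps_of_poly :: rat poly \<Rightarrow> rat fps)"
  by unfold_locales (simp_all add: fps_of_poly_add fps_of_poly_mult)

lemma biv_of_nth: "biv_of p $ k = fps_of_poly (coeff p k)"
  by (simp add: biv_of_def coeff_map_poly)

lemma ring_map_biv_of: "ring_map biv_of"
proof
  interpret f: ring_map "fps_of_poly :: rat poly \<Rightarrow> rat fps" by (rule ring_map_fps_of_poly)
  show "biv_of (p + q) = biv_of p + biv_of q" for p q by (rule fps_ext) (simp add: biv_of_nth f.add)
  show "biv_of (p * q) = biv_of p * biv_of q" for p q
    by (rule fps_ext) (simp add: biv_of_nth fps_mult_nth coeff_mult f.sum f.mult atLeast0AtMost)
  show "biv_of 1 = 1" by (rule fps_ext) (simp add: biv_of_nth fps_one_nth coeff_1)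
qed

lemma biv_of_eq_0: "biv_of p = 0 \<longleftrightarrow> p = 0"
proof
  assume "biv_of p = 0"
  then have "fps_of_poly (coeff p k) = 0" for k using biv_of_nth[of p k] by simp
  then show "p = 0" by (simp add: poly_eq_iff)
qed (simp add: fps_eq_iff biv_of_nth)

lemma biv_of_poly_t: "biv_of poly_t = fps_const fps_X"
  by (rule fps_ext) (simp add: biv_of_nth poly_t_def coeff_pCons fps_of_poly_pCons split: nat.split)

lemma biv_of_poly_y: "biv_of poly_y = fps_X"
  by (rule fps_ext) (simp add: biv_of_nth poly_y_def fps_X_def coeff_pCons split: nat.split)

definition evF :: "rat poly poly poly \<Rightarrow> rat fps fps" where
  "evF P = poly (map_poly biv_of P) (ntgf 3 0)"

lemma ring_map_evF: "ring_map evF"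
  unfolding evF_def by (rule ring_map.ring_map_eval[OF ring_map_biv_of])

lemma evF_const: "evF [:c:] = biv_of c"
proof -
  interpret b: ring_map biv_of by (rule ring_map_biv_of)
  show ?thesis unfolding evF_def by (simp add: map_poly_pCons b.zero)
qed

lemma evF_smult: "evF (smult c P) = biv_of c * evF P"
proof -
  interpret e: ring_map evF by (rule ring_map_evF)
  have "smult c P = [:c:] * P" by simp
  then show ?thesis using e.mult[of "[:c:]" P] evF_const[of c] by simp
qed

text \<open>If C is the value of \<open>cubic_poly\<close>, then \<open>qs 2\<close> = -C / (2 y^2).
  Inserting this into \<open>qs_2_quadratic\<close> and multiplying by 2 y^4 gives the
  sextic.\<close>

lemma evF_sextic: "evF sextic = 0"
proof -
  interpret e: ring_map evF by (rule ring_map_evF)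
  interpret b: ring_map biv_of by (rule ring_map_biv_of)
  define F where "F = ntgf 3 0"
  define t y :: "rat fps fps" where "t = fps_const fps_X" and "y = fps_X"
  define Q where "Q = fps_const (qs 2)"
  have ty: "biv_of poly_t = t" "biv_of poly_y = y" unfolding t_def y_def by (rule biv_of_poly_t biv_of_poly_y)+
  have "evF cubic_poly = 4 * t ^ 3 * y ^ 5 * F ^ 3 - t * y ^ 2 * (8 * y ^ 2 + 10 * t * y - t ^ 2) * F ^ 2 +
     (2 * t * y + 4 * y ^ 2 + 6 * t ^ 2 * y ^ 3 - 2 * t ^ 2) * F + 2 * t ^ 2 - 2 * t * y - 4 * y ^ 2 - t ^ 3 * y ^ 2"
  proof -
    have e: "evF cubic_poly = biv_of (coeff cubic_poly 0) + F * (biv_of (coeff cubic_poly 1) + F * (biv_of (coeff cubic_poly 2) + F * biv_of (coeff cubic_poly 3)))"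
      unfolding evF_def cubic_poly_def F_def[symmetric] by (simp add: map_poly_pCons b.zero numeral_2_eq_2 numeral_3_eq_3)
    have e0: "biv_of (coeff cubic_poly 0) = 2 * t ^ 2 - 2 * t * y - 4 * y ^ 2 - t ^ 3 * y ^ 2"
      unfolding cubic_poly_def coeff_pCons_0 by (simp only: b.hom ty)
    have e1: "biv_of (coeff cubic_poly 1) = 2 * t * y + 4 * y ^ 2 + 6 * t ^ 2 * y ^ 3 - 2 * t ^ 2"
      unfolding cubic_poly_def One_nat_def coeff_pCons_Suc coeff_pCons_0 by (simp only: b.hom ty)
    have e2: "biv_of (coeff cubic_poly 2) = - (t * y ^ 2 * (8 * y ^ 2 + 10 * t * y - t ^ 2))"
      unfolding cubic_poly_def numeral_2_eq_2 coeff_pCons_Suc coeff_pCons_0 by (simp only: b.hom ty flip: numeral_2_eq_2)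
    have e3: "biv_of (coeff cubic_poly 3) = 4 * t ^ 3 * y ^ 5"
      unfolding cubic_poly_def numeral_3_eq_3 coeff_pCons_Suc coeff_pCons_0 by (simp only: b.hom ty flip: numeral_3_eq_3)
    show ?thesis unfolding e e0 e1 e2 e3 by algebra
  qed
  then have C: "evF cubic_poly = - 2 * y ^ 2 * Q" unfolding Q_def using ntgf_cubic[OF F_def t_def y_def] by simp
  have q: "8 * t ^ 3 * Q ^ 2 - (8 * (t ^ 3) ^ 2 + 12 * t ^ 3 - 1) * Q + 2 * t ^ 3 * ((t ^ 3) ^ 2 + 11 * t ^ 3 - 1) = 0"
  proof -
    have fc: "fps_const (f + g) = fps_const f + fps_const g" "fps_const (f - g) = fps_const f - fps_const g"
      "fps_const (f * g) = fps_const f * fps_const g" "fps_const (f ^ n) = fps_const f ^ n"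
      "fps_const (numeral k) = (numeral k :: rat fps fps)" "fps_const (1 :: rat fps) = 1" "fps_const (0 :: rat fps) = 0"
      for f g :: "rat fps" and n k by (simp_all add: fps_const_power numeral_fps_const)
    show ?thesis
      using arg_cong[OF qs_2_quadratic, of fps_const] unfolding fc t_def Q_def .
  qed
  have "evF sextic = 4 * t ^ 3 * evF cubic_poly ^ 2 + y ^ 2 * (8 * t ^ 6 + 12 * t ^ 3 - 1) * evF cubic_poly + 4 * t ^ 3 * y ^ 4 * (t ^ 6 + 11 * t ^ 3 - 1)"
    unfolding sextic_def e.add evF_smult e.power evF_const by (simp only: b.hom ty)
  also have "\<dots> = 2 * y ^ 4 * (8 * t ^ 3 * Q ^ 2 - (8 * (t ^ 3) ^ 2 + 12 * t ^ 3 - 1) * Q + 2 * t ^ 3 * ((t ^ 3) ^ 2 + 11 * t ^ 3 - 1))"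
    unfolding C by algebra
  finally show ?thesis unfolding q by simp
qed

text \<open>T and Y are polynomials in a curve parameter, so a polynomial in t and y is restricted
  to the curve t = T, y = Y.\<close>

definition spec_base :: "rat poly \<Rightarrow> rat poly \<Rightarrow> rat poly poly \<Rightarrow> rat poly" where
  "spec_base T Y p = poly (map_poly (\<lambda>r. pcompose r T) p) Y"

text \<open>All six roots of the sextic equal 2 at t = 1/2, y = -1/2; the Newton polygons along the
  curves y = -1/2 and t = 1/2 through this point have the single slopes 1/2 and 2/3.\<close>

definition spec :: "rat poly \<Rightarrow> rat poly \<Rightarrow> rat poly poly poly \<Rightarrow> rat poly poly" where
  "spec T Y P = pcompose (map_poly (spec_base T Y) P) [:2, 1:]"

lemma ring_map_spec_base: "ring_map (spec_base T Y)"
  unfolding spec_base_def by (rule ring_map.ring_map_eval[OF ring_map_pcompose])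

lemma ring_map_spec: "ring_map (spec T Y)"
  unfolding spec_def
  by (rule ring_map_comp[OF ring_map_pcompose ring_map.ring_map_map_poly[OF ring_map_spec_base]])

lemma spec_base_poly_t: "spec_base T Y poly_t = T" and spec_base_poly_y: "spec_base T Y poly_y = Y"
  unfolding spec_base_def poly_t_def poly_y_def by (simp_all add: map_poly_pCons one_pCons pcompose_pCons)

lemma degree_spec: "degree (spec T Y P) \<le> degree P"
proof -
  have "degree (spec T Y P) \<le> degree (map_poly (spec_base T Y) P) * degree [:2, 1 :: rat poly:]"
    unfolding spec_def by (rule degree_pcompose_le)
  also have "\<dots> = degree (map_poly (spec_base T Y) P)" by simp
  also have "\<dots> \<le> degree P"
  proof (rule degree_le, intro allI impI)
    interpret b: ring_map "spec_base T Y" by (rule ring_map_spec_base)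
    fix i assume "degree P < i"
    then show "coeff (map_poly (spec_base T Y) P) i = 0" by (simp add: b.coeff_map coeff_eq_0 b.zero)
  qed
  finally show ?thesis .
qed

lemma spec_smult: "spec T Y (smult c P) = smult (spec_base T Y c) (spec T Y P)"
proof -
  interpret s: ring_map "spec T Y" by (rule ring_map_spec)
  interpret b: ring_map "spec_base T Y" by (rule ring_map_spec_base)
  have "spec T Y [:c:] = [:spec_base T Y c:]" unfolding spec_def by (simp add: map_poly_pCons b.zero)
  moreover have "smult c P = [:c:] * P" by simp
  ultimately show ?thesis using s.mult[of "[:c:]" P] by simp
qed

lemma spec_cubic_poly: "spec T Y cubic_poly = pcompose [:2 * T ^ 2 - 2 * T * Y - 4 * Y ^ 2 - T ^ 3 * Y ^ 2,
     2 * T * Y + 4 * Y ^ 2 + 6 * T ^ 2 * Y ^ 3 - 2 * T ^ 2,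
     - (T * Y ^ 2 * (8 * Y ^ 2 + 10 * T * Y - T ^ 2)),
     4 * T ^ 3 * Y ^ 5:] [:2, 1:]"
proof -
  interpret b: ring_map "spec_base T Y" by (rule ring_map_spec_base)
  have m: "map_poly (spec_base T Y) [:a, b, c, d:] = [:spec_base T Y a, spec_base T Y b, spec_base T Y c, spec_base T Y d:]" for a b c d
    by (rule poly_eqI) (simp add: b.coeff_map coeff_pCons b.zero split: nat.split)
  show ?thesis unfolding spec_def cubic_poly_def m b.hom spec_base_poly_t spec_base_poly_y ..
qed

lemma spec_sextic: "spec T Y sextic = smult (4 * T ^ 3) (spec T Y cubic_poly ^ 2) +
   smult (Y ^ 2 * (8 * T ^ 6 + 12 * T ^ 3 - 1)) (spec T Y cubic_poly) + [:4 * T ^ 3 * Y ^ 4 * (T ^ 6 + 11 * T ^ 3 - 1):]"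
proof -
  interpret s: ring_map "spec T Y" by (rule ring_map_spec)
  interpret b: ring_map "spec_base T Y" by (rule ring_map_spec_base)
  have c: "spec T Y [:c:] = [:spec_base T Y c:]" for c unfolding spec_def by (simp add: map_poly_pCons b.zero)
  show ?thesis unfolding sextic_def s.add spec_smult s.power c b.hom spec_base_poly_t spec_base_poly_y ..
qed

text \<open>The coefficients of degree 0 to 6 have orders 3, 3, 2, 2, 1, 1, 0 in the parameter, none
  below the segment of slope 1/2 that joins the two ends.\<close>

lemma spec_1: "spec [:1 / 2, 1:] [:- 1 / 2:] sextic =
  [:[:0, 0, 0, 27/4, 81/8, -9/4, -5/2, 9:], [:0, 0, 0, 81/16, 9/8, -15, -1, 15, -6:], [:0, 0, 81/128, 27/64, -183/32, -77/16, 107/8, 33/4, -21/2, 1:], [:0, 0, -45/128, -2, -81/32, 7/2, 51/8, -9/2, -13/2, 2:], [:0, 9/512, 33/128, 89/64, 109/32, 25/8, -13/8, -17/4, -1/2, 3/2:], [:0, -3/512, -5/64, -7/16, -21/16, -35/16, -7/4, 0, 1, 1/2:], [:1/8192, 9/4096, 9/512, 21/256, 63/256, 63/128, 21/32, 9/16, 9/32, 1/16:]:]"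
proof -
  have C: "spec [:1 / 2, 1:] [:- 1 / 2:] cubic_poly = [:[:-5/32, -27/16, 9/8, -1/4:], [:0, -9/8, 3/2, -1/2:], [:0, 3/8, 1/2, -1/2:], [:-1/64, -3/32, -3/16, -1/8:]:]"
    unfolding spec_cubic_poly by (simp add: pcompose_pCons power2_eq_square power3_eq_cube eval_nat_numeral numeral_poly)
  show ?thesis
    unfolding spec_sextic C by (simp add: power2_eq_square power3_eq_cube eval_nat_numeral numeral_poly one_pCons)
qed

text \<open>Here the orders are 4, 4, 3, 2, 2, 1, 0, none below the segment of slope 2/3 that joins
  the two ends.\<close>

lemma spec_2: "spec [:1 / 2:] [:- 1 / 2, 1:] sextic =
  [:[:0, 0, 0, 0, 729/8, -945/2, 1927/2, -964, 478, -104, 8:], [:0, 0, 0, 0, 1539/8, -2037/2, 4273/2, -2224, 1170, -280, 24:], [:0, 0, 0, -405/32, 6837/32, -7633/8, 15597/8, -4167/2, 2335/2, -310, 30:], [:0, 0, 27/128, -1025/64, 1073/8, -3867/8, 7437/8, -4037/4, 605, -180, 20:], [:0, 0, 339/512, -1067/128, 5741/128, -4287/32, 1929/8, -2119/8, 1365/8, -115/2, 15/2:], [:0, -15/1024, 61/256, -437/256, 903/128, -1183/64, 1015/32, -567/16, 197/8, -19/2, 3/2:], [:1/8192, -5/2048, 45/2048, -15/128, 105/256, -63/64, 105/64, -15/8, 45/32, -5/8, 1/8:]:]"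
proof -
  have C: "spec [:1 / 2:] [:- 1 / 2, 1:] cubic_poly = [:[:-5/32, 5/8, -113/8, 35, -26, 4:], [:0, 0, -57/4, 77/2, -31, 6:], [:0, 15/16, -47/8, 13, -23/2, 3:], [:-1/64, 5/32, -5/8, 5/4, -5/4, 1/2:]:]"
    unfolding spec_cubic_poly by (simp add: pcompose_pCons power2_eq_square power3_eq_cube eval_nat_numeral numeral_poly)
  show ?thesis
    unfolding spec_sextic C by (simp add: power2_eq_square power3_eq_cube eval_nat_numeral numeral_poly one_pCons)
qed

lemma sextic_factor_degree:
  assumes "sextic = A * B"
  shows "6 dvd degree A"
proof -
  have A0: "A \<noteq> 0" "B \<noteq> 0" using assms degree_sextic by auto
  have sum: "degree A + degree B = 6" using degree_mult_eq[OF A0] degree_sextic assms by simp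
  have deg: "degree (spec T Y A) = degree A" "spec T Y sextic = spec T Y A * spec T Y B"
    if six: "degree (spec T Y sextic) = 6" for T Y
  proof -
    interpret s: ring_map "spec T Y" by (rule ring_map_spec)
    show m: "spec T Y sextic = spec T Y A * spec T Y B" unfolding assms by (rule s.mult)
    then have "spec T Y A \<noteq> 0" "spec T Y B \<noteq> 0" using six by auto
    \<comment> \<open>Specialization can only lower the degrees of A and B. Since their sum is still
      6, neither drops.\<close>
    then have "degree (spec T Y A) + degree (spec T Y B) = 6" using degree_mult_eq m six by metis
    then show "degree (spec T Y A) = degree A"
      using degree_spec[of T Y A] degree_spec[of T Y B] sum by linarith
  qed
  have enum: "i = 0 \<or> i = 1 \<or> i = 2 \<or> i = 3 \<or> i = 4 \<or> i = 5" if "i < 6" for i :: nat using that by auto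
  have "2 dvd degree A"
  proof -
    let ?M = "spec [:1 / 2, 1:] [:- 1 / 2:] sextic"
    have d: "degree ?M = 6" unfolding spec_1 by simp
    have "2 dvd 1 * degree (spec [:1 / 2, 1:] [:- 1 / 2:] A)"
    proof (rule newton_slope[OF deg(2)[OF d], where K = 3])
      fix i k :: nat assume h: "2 * k + 1 * i < 1 * degree ?M"
      then have "i < 6" "k < 3" unfolding d by auto
      then have "k = 0 \<or> k = 1 \<or> k = 2" by auto
      then show "coeff (coeff ?M i) k = 0"
        using enum[OF \<open>i < 6\<close>] h unfolding d unfolding spec_1 by (elim disjE) (simp_all add: eval_nat_numeral)
    qed (unfold d, simp_all only: spec_1, simp_all add: eval_nat_numeral)
    then show ?thesis using deg(1)[OF d] by simp
  qed
  moreover have "3 dvd degree A"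
  proof -
    let ?M = "spec [:1 / 2:] [:- 1 / 2, 1:] sextic"
    have d: "degree ?M = 6" unfolding spec_2 by simp
    have "3 dvd 2 * degree (spec [:1 / 2:] [:- 1 / 2, 1:] A)"
    proof (rule newton_slope[OF deg(2)[OF d], where K = 4])
      fix i k :: nat assume h: "3 * k + 2 * i < 2 * degree ?M"
      then have "i < 6" "k < 4" unfolding d by auto
      then have "k = 0 \<or> k = 1 \<or> k = 2 \<or> k = 3" by auto
      then show "coeff (coeff ?M i) k = 0"
        using enum[OF \<open>i < 6\<close>] h unfolding d unfolding spec_2 by (elim disjE) (simp_all add: eval_nat_numeral)
    qed (unfold d, simp_all only: spec_2, simp_all add: eval_nat_numeral)
    then show ?thesis using deg(1)[OF d] by presburger
  qed
  ultimately show ?thesis by presburger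
qed

text \<open>Evaluation is a ring homomorphism into a domain, so one of the prime factors of a
  polynomial annihilating the series annihilates it too.\<close>

lemma evF_factor:
  assumes "P \<noteq> 0" "evF P = 0"
  obtains N where "prime_elem N" "N dvd P" "evF N = 0"
proof -
  interpret e: ring_map evF by (rule ring_map_evF)
  have "P dvd prod_mset (prime_factorization P)"
    using prod_mset_prime_factorization_weak[OF assms(1)] by (metis associated_iff_dvd)
  then obtain R where "prod_mset (prime_factorization P) = P * R" by (elim dvdE)
  then have z: "evF (prod_mset (prime_factorization P)) = 0" using assms(2) by (simp add: e.mult)
  have "evF (prod_mset X) = 0 \<Longrightarrow> \<exists>N\<in>#X. evF N = 0" for X
  proof (induction X)
    case empty
    then show ?case by (simp add: e.one)
  next
    case (add x X)
    then show ?case by (auto simp: e.mult)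
  qed
  then obtain N where N: "N \<in># prime_factorization P" "evF N = 0" using z by blast
  then have "prime N" "N dvd P" by (auto intro: in_prime_factors_imp_prime in_prime_factors_imp_dvd)
  then show thesis using that[of N] N(2) unfolding prime_def by blast
qed

lemma evF_const_eq_0:
  assumes "evF P = 0" "P \<noteq> 0"
  shows "degree P > 0"
proof (rule ccontr)
  assume "\<not> degree P > 0"
  then obtain c where "P = [:c:]" by (metis degree_eq_zeroE neq0_conv)
  then show False using assms by (simp add: evF_const biv_of_eq_0)
qed

text \<open>The argument stays in the factorial ring of polynomials in t, y and one further
  variable. Some prime factor N of the sextic annihilates the series, and its degree, a positive
  multiple of 6, is 6. An annihilator Q of least degree, if below 6, would split a multiple of N
  into two nonzero factors of degree below 6, one of which the prime N would divide.\<close>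

lemma evF_degree_ge:
  assumes "P \<noteq> 0" "evF P = 0"
  shows "6 \<le> degree P"
proof (rule ccontr)
  interpret e: ring_map evF by (rule ring_map_evF)
  assume small: "\<not> 6 \<le> degree P"
  obtain N where N: "prime_elem N" "N dvd sextic" "evF N = 0"
    using evF_factor[OF _ evF_sextic] degree_sextic by (metis degree_0 zero_neq_numeral)
  have N0: "N \<noteq> 0" using N(1) by auto
  obtain N' where "sextic = N * N'" using N(2) by (elim dvdE)
  then have "6 dvd degree N" by (rule sextic_factor_degree)
  moreover have "degree N > 0" by (rule evF_const_eq_0[OF N(3) N0])
  moreover have "degree N \<le> 6"
    using dvd_imp_degree_le[OF N(2)] degree_sextic by (metis degree_0 zero_neq_numeral)
  ultimately have dN: "degree N = 6" by (auto elim!: dvdE)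
  define d where "d = (LEAST m. \<exists>Q. Q \<noteq> 0 \<and> evF Q = 0 \<and> degree Q = m)"
  have "\<exists>Q. Q \<noteq> 0 \<and> evF Q = 0 \<and> degree Q = d"
    unfolding d_def by (rule LeastI_ex) (use assms in blast)
  then obtain Q where Q: "Q \<noteq> 0" "evF Q = 0" "degree Q = d" by blast
  have min: "d \<le> degree R" if "R \<noteq> 0" "evF R = 0" for R
    unfolding d_def by (rule Least_le) (use that in blast)
  have d6: "d < 6" using min[OF assms] small by simp
  \<comment> \<open>The coefficients lie in a ring and not in a field, so N is divided by Q up to a
    factor a. By minimality of Q the remainder, which also annihilates the series, is zero.\<close>
  obtain a q where a: "a \<noteq> 0" "smult a N = Q * q + pseudo_mod N Q" using pseudo_mod(1)[OF Q(1)] by blast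
  have "evF (pseudo_mod N Q) = 0"
    using arg_cong[OF a(2), of evF] unfolding evF_smult e.add e.mult N(3) Q(2) by simp
  then have "pseudo_mod N Q = 0"
    using min[of "pseudo_mod N Q"] pseudo_mod(2)[OF Q(1), of N] Q(3) by (meson leD)
  then have aN: "smult a N = Q * q" using a(2) by simp
  have q0: "q \<noteq> 0" using aN a(1) N0 by auto
  have "degree Q + degree q = 6" using degree_mult_eq[OF Q(1) q0] aN a(1) dN by (metis degree_smult_eq)
  moreover have "d > 0" using evF_const_eq_0[OF Q(2,1)] Q(3) by simp
  ultimately have dq: "degree q < 6" using Q(3) by simp
  have "N dvd Q * q" unfolding aN[symmetric] by (simp add: dvd_smult)
  then have "N dvd Q \<or> N dvd q" using N(1) by (simp add: prime_elem_dvd_mult_iff)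
  then show False
    using dvd_imp_degree_le[of N Q] dvd_imp_degree_le[of N q] dN d6 dq Q(1,3) q0 by auto
qed

lemma alg_degree_ntgf: "alg_degree_biv (ntgf 3 0) 6"
proof -
  have a: "annihilates_biv P (ntgf 3 0) \<longleftrightarrow> P \<noteq> 0 \<and> evF P = 0" for P
    unfolding annihilates_biv_def evF_def ..
  have "sextic \<noteq> 0" using degree_sextic by auto
  then show ?thesis
    unfolding alg_degree_biv_def a using evF_sextic degree_sextic evF_degree_ge by blast
qed

theorem theorem13p2:
  shows "alg_degree_biv (ntgf 3 0) 6 \<and>
         ntgf 3 0 $ 1 = 0 \<and>
         (\<exists>!S :: rat fps. S = fps_X ^ 3 * (1 + 2 * S)\<^sup>2) \<and>
         (\<forall>S :: rat fps. S = fps_X ^ 3 * (1 + 2 * S)\<^sup>2 \<longrightarrow>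
            (\<forall>i\<ge>2. alg_deg_le (ntgf 3 0 $ i) 2 \<and> rat_fun_of (fps_X ^ i * ntgf 3 0 $ i) S) \<and>
            ntgf 3 0 $ 2 = 2 * fps_X * (1 + S - S\<^sup>2) \<and>
            ntgf 3 0 $ 3 = 2 * S * (1 - S))"
proof (intro conjI allI impI)
  show "alg_degree_biv (ntgf 3 0) 6" by (rule alg_degree_ntgf)
  show "ntgf 3 0 $ 1 = 0" unfolding ntgf_outer by (rule outer_1)
  show "\<exists>!S :: rat fps. S = fps_X ^ 3 * (1 + 2 * S)\<^sup>2" by (rule S_unique)
  show "alg_deg_le (ntgf 3 0 $ i) 2" for i unfolding ntgf_outer by (rule alg_deg_le_outer)
  fix S :: "rat fps" assume S: "S = fps_X ^ 3 * (1 + 2 * S)\<^sup>2"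
  show "rat_fun_of (fps_X ^ i * ntgf 3 0 $ i) S" for i
    unfolding ntgf_outer qs_def[symmetric] by (rule rat_fun_qs[OF S])
  define z :: "rat fps" where "z = fps_X ^ 3"
  have z0: "z \<noteq> 0" unfolding z_def by simp
  have "fps_X ^ 2 * outer 2 = fps_X ^ 2 * (2 * fps_X * (1 + S - S\<^sup>2))"
    using qs_2[OF S] unfolding qs_def by (simp add: power2_eq_square power3_eq_cube ac_simps)
  then show "ntgf 3 0 $ 2 = 2 * fps_X * (1 + S - S\<^sup>2)" unfolding ntgf_outer by simp
  \<comment> \<open>By \<open>cubic_qs_3\<close> and \<open>qs_2\<close> the left side equals 4 z (1
    + S - S^2) - 4 z = 4 z S (1 - S), from which 2 t^3 is cancelled.\<close>
  have "(2 * z) * outer 3 = (2 * z) * (2 * S * (1 - S))"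
    using cubic_qs_3 unfolding qs_2[OF S] qs_def[of 3] z_def[symmetric]
    by (simp add: algebra_simps power2_eq_square)
  moreover have "2 * z \<noteq> 0" using z0 by simp
  ultimately have "outer 3 = 2 * S * (1 - S)" using mult_left_cancel by blast
  then show "ntgf 3 0 $ 3 = 2 * S * (1 - S)" unfolding ntgf_outer .
qed

end
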